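(* Let $n\ge2$ and let $\Omega\subset\mathbb{C}^n$ be a bounded strongly pseudoconvex domain with $C^2$-smooth boundary. Let $\lambda\ge1$. Then for any $0<c_2<\frac1{16}$ there exists a constant $c_1>0$ such that for all $x,y\in\Omega$ and every Kobayashi $\lambda$-quasi-geodesic $\gamma$ in $\Omega$ joining $x$ and $y$, $$l_d(\gamma)\le c_1|x-y|^{c_2}.$$
   Context: Notation: $|\cdot|$ is the Euclidean norm on $\mathbb{C}^n$ and $l_d$ denotes Euclidean length of curves. Strongly pseudoconvex: a domain $\Omega=\{z:\rho(z)<0\}$ in $\mathbb{C}^n$ ($n\ge2$) with $C^2$-smooth boundary ($\rho$ a $C^2$ defining function) is strongly pseudoconvex if the Levi form $L_\rho(p;v)=\sum_{\nu,\mu=1}^n\frac{\partial^2\rho}{\partial z_\nu\partial\bar z_\mu}(p)v_\nu\bar v_\mu$, $v\in\mathbb{C}^n$, is positive definite for every $p\in\partial\Omega$. Kobayashi metric: $k_\Omega(x;v)=\inf\{|\xi|: f:\mathbb{D}\to\Omega \text{ holomorphic},\ f(0)=x,\ d(f)_0(\xi)=v\}$, and the Kobayashi distance $K_\Omega(x,y)$ is the infimum of $\int_a^b k_\Omega(\sigma(t);\sigma'(t))\,dt$ over absolutely continuous curves $\sigma:[a,b]\to\Omega$ joining $x$ to $y$. A Kobayashi $\lambda$-quasi-geodesic is a curve $\sigma:I\to\Omega$ ($I\subset\mathbb{R}$ an interval) with $\frac1\lambda|t-s|\le K_\Omega(\sigma(s),\sigma(t))\le\lambda|t-s|$ for all $s,t\in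 I$. *)

theory Defs
  imports "HOL-Analysis.Analysis"
begin

definition C2_on :: "('a::real_normed_vector \<Rightarrow> 'b::real_normed_vector) \<Rightarrow> 'a set \<Rightarrow> bool" where
  "C2_on f U \<longleftrightarrow>
    (\<exists>(f1 :: 'a \<Rightarrow> 'a \<Rightarrow>\<^sub>L 'b) (f2 :: 'a \<Rightarrow> 'a \<Rightarrow>\<^sub>L ('a \<Rightarrow>\<^sub>L 'b)).
       (\<forall>x\<in>U. (f has_derivative blinfun_apply (f1 x)) (at x)) \<and>
       (\<forall>x\<in>U. (f1 has_derivative blinfun_apply (f2 x)) (at x)) \<and>
       continuous_on U f2)"

text \<open>The Wirtinger operators \<open>\<partial>/\<partial>z\<^sub>j = (\<partial>/\<partial>x\<^sub>j - \<i> \<partial>/\<partial>y\<^sub>j)/2\<close> and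
  \<open>\<partial>/\<partial>zbar\<^sub>j = (\<partial>/\<partial>x\<^sub>j + \<i> \<partial>/\<partial>y\<^sub>j)/2\<close>; the real directions of \<open>x\<^sub>j\<close> and \<open>y\<^sub>j\<close> are
  \<open>axis j 1\<close> and \<open>axis j \<i>\<close>.\<close>

definition d_z :: "'n::finite \<Rightarrow> (complex^'n \<Rightarrow> complex) \<Rightarrow> complex^'n \<Rightarrow> complex" where
  "d_z j f p = (frechet_derivative f (at p) (axis j 1)
                 - \<i> * frechet_derivative f (at p) (axis j \<i>)) / 2"

definition d_zbar :: "'n::finite \<Rightarrow> (complex^'n \<Rightarrow> complex) \<Rightarrow> complex^'n \<Rightarrow> complex" where
  "d_zbar j f p = (frechet_derivative f (at p) (axis j 1)
                    + \<i> * frechet_derivative f (at p) (axis j \<i>)) / 2"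

definition levi_form :: "(complex^'n::finite \<Rightarrow> real) \<Rightarrow> complex^'n \<Rightarrow> complex^'n \<Rightarrow> complex" where
  "levi_form \<rho> p v =
    (\<Sum>\<nu>\<in>UNIV. \<Sum>\<mu>\<in>UNIV.
       d_z \<nu> (d_zbar \<mu> (\<lambda>z. complex_of_real (\<rho> z))) p * (v $ \<nu>) * cnj (v $ \<mu>))"

text \<open>The defining function need only live on an open neighbourhood of the closure of the
  domain; \<open>U = UNIV\<close> is allowed.\<close>

definition C2_defining_function ::
    "(complex^'n::finite \<Rightarrow> real) \<Rightarrow> (complex^'n) set \<Rightarrow> bool" where
  "C2_defining_function \<rho> \<Omega> \<longleftrightarrow>
    (\<exists>U. open U \<and> closure \<Omega> \<subseteq> U \<and> C2_on \<rho> U \<and> \<Omega> = {z \<in> U. \<rho> z < 0} \<and>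
         (\<forall>p\<in>frontier \<Omega>. frechet_derivative \<rho> (at p) \<noteq> (\<lambda>v. 0)))"

text \<open>The Levi form of a real \<open>C\<^sup>2\<close> function is Hermitian, so its values are real and
  positivity may be read off the real part.\<close>

definition strongly_pseudoconvex_domain :: "(complex^'n::finite) set \<Rightarrow> bool" where
  "strongly_pseudoconvex_domain \<Omega> \<longleftrightarrow>
    open \<Omega> \<and> connected \<Omega> \<and> \<Omega> \<noteq> {} \<and>
    (\<exists>\<rho>. C2_defining_function \<rho> \<Omega> \<and>
         (\<forall>p\<in>frontier \<Omega>. \<forall>v. v \<noteq> 0 \<longrightarrow> 0 < Re (levi_form \<rho> p v)))"

text \<open>Metric, distance and length take values in \<open>ennreal\<close>, so that the infimum over an empty
  family is \<open>\<infinity>\<close>.\<close>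

definition kobayashi_metric :: "(complex^'n::finite) set \<Rightarrow> complex^'n \<Rightarrow> complex^'n \<Rightarrow> ennreal" where
  "kobayashi_metric \<Omega> x v =
    Inf {ennreal (cmod \<xi>) | \<xi> f.
           (\<forall>j. (\<lambda>\<zeta>. f \<zeta> $ j) holomorphic_on ball 0 1) \<and> f ` ball 0 1 \<subseteq> \<Omega> \<and> f 0 = x \<and>
           (\<forall>j. deriv (\<lambda>\<zeta>. f \<zeta> $ j) 0 * \<xi> = v $ j)}"

definition absolutely_continuous_on ::
    "real \<Rightarrow> real \<Rightarrow> (real \<Rightarrow> 'a::metric_space) \<Rightarrow> bool" where
  "absolutely_continuous_on a b \<sigma> \<longleftrightarrow>
    (\<forall>\<epsilon>>0. \<exists>\<delta>>0. \<forall>(m::nat) (s::nat \<Rightarrow> real) (t::nat \<Rightarrow> real).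
       (\<forall>i<m. a \<le> s i \<and> s i \<le> t i \<and> t i \<le> b) \<longrightarrow>
       (\<forall>i<m. \<forall>j<m. i \<noteq> j \<longrightarrow> {s i<..<t i} \<inter> {s j<..<t j} = {}) \<longrightarrow>
       (\<Sum>i<m. t i - s i) < \<delta> \<longrightarrow>
       (\<Sum>i<m. dist (\<sigma> (s i)) (\<sigma> (t i))) < \<epsilon>)"

text \<open>An absolutely continuous curve in \<open>\<complex>\<^sup>n\<close> is differentiable almost everywhere, and the
  value of \<open>vector_derivative\<close> on the exceptional null set does not affect the integral.\<close>

definition kobayashi_dist :: "(complex^'n::finite) set \<Rightarrow> complex^'n \<Rightarrow> complex^'n \<Rightarrow> ennreal" where
  "kobayashi_dist \<Omega> x y =
    Inf {\<integral>\<^sup>+ t \<in> {a..b}. kobayashi_metric \<Omega> (\<sigma> t) (vector_derivative \<sigma> (at t)) \<partial>lebesgue | a b \<sigma>.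
           a \<le> b \<and> absolutely_continuous_on a b \<sigma> \<and> \<sigma> ` {a..b} \<subseteq> \<Omega> \<and> \<sigma> a = x \<and> \<sigma> b = y}"

definition kobayashi_quasi_geodesic ::
    "(complex^'n::finite) set \<Rightarrow> real \<Rightarrow> real set \<Rightarrow> (real \<Rightarrow> complex^'n) \<Rightarrow> bool" where
  "kobayashi_quasi_geodesic \<Omega> \<kappa> I \<sigma> \<longleftrightarrow>
    is_interval I \<and> continuous_on I \<sigma> \<and> \<sigma> ` I \<subseteq> \<Omega> \<and>
    (\<forall>s\<in>I. \<forall>t\<in>I. ennreal (1 / \<kappa> * \<bar>t - s\<bar>) \<le> kobayashi_dist \<Omega> (\<sigma> s) (\<sigma> t) \<and>
                   kobayashi_dist \<Omega> (\<sigma> s) (\<sigma> t) \<le> ennreal (\<kappa> * \<bar>t - s\<bar>))"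

definition curve_length :: "real set \<Rightarrow> (real \<Rightarrow> 'a::metric_space) \<Rightarrow> ennreal" where
  "curve_length I \<sigma> =
    Sup {\<Sum>i<m. ennreal (dist (\<sigma> (t i)) (\<sigma> (t (Suc i)))) | (m::nat) (t::nat \<Rightarrow> real).
           (\<forall>i\<le>m. t i \<in> I) \<and> (\<forall>i<m. t i \<le> t (Suc i))}"

end

theory Submission
  imports Defs "HOL-Complex_Analysis.Complex_Analysis"
begin

text \<open>
  Write \<open>h = -\<rho>\<close> for a defining function and \<open>L\<close> for the complex linear part of its
  derivative. Up to constants the Kobayashi metric at \<open>z\<close> is \<open>|L v| / h + |v| / sqrt h\<close>.
  The upper bound uses affine discs. For the lower bound, the second-order expansion at \<open>z\<close> of
  the strictly plurisubharmonic \<open>\<rho>\<close> gives a holomorphic quadratic polynomial \<open>p\<close> with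
  \<open>Re p + c |w - z|^2 \<le> \<rho> w - \<rho> z \<le> h\<close> for \<open>w\<close> in the domain near \<open>z\<close>; composing it
  with a disc and applying the Schwarz lemma bounds the derivative of the disc at its centre.

  Moving points by \<open>s\<close> along \<open>-grad \<rho>\<close> lifts a curve at height \<open>h \<le> s\<close> to height comparable
  to \<open>s\<close> and shrinks its Kobayashi length by the factor \<open>sqrt (h / s)\<close>. Comparing a
  quasi-geodesic with its lifted outer parts bounds the time \<open>T\<close> it spends above height \<open>s\<close> by
  \<open>J + ln (1 + |x - y| / s) + 1\<close>, where \<open>J\<close> is \<open>1 / sqrt s\<close> times the integral of
  \<open>sqrt h\<close> over the remaining times. Doubling \<open>s\<close> contracts \<open>J\<close>, so \<open>J + T\<close> is bounded at
  the scale \<open>s = |x - y|\<close>. As the Euclidean speed is at most a constant times \<open>sqrt h\<close>, the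
  length is \<open>O(sqrt |x - y|)\<close>, which is stronger than the stated exponent.
\<close>

section \<open>Absolutely continuous curves\<close>

text \<open>The distance is an infimum over all absolutely continuous curves, so a lower bound must
  hold along each of them. It comes from integrating the derivative of a test function, which
  requires differentiability almost everywhere and the fundamental theorem of calculus for
  absolutely continuous functions; hence the opening part. The metric along a curve is not shown to
  be measurable, so its integral is compared with measurable functions below or above it.

  The factor \<open>sqrt (h / s)\<close> is due to the tangential term of the metric; the normal
  term gains even \<open>h / s\<close>. The bound for \<open>T\<close> contains a large multiple of
  \<open>J\<close>, so the contraction of \<open>J\<close> alone would not close the recursion; but
  what \<open>J\<close> gains from one scale to the next is at most what \<open>T\<close> loses, and
  the sum \<open>J + T\<close> can be controlled.

  The recursion stops early if the curve stays low or the height leaves the range of the estimates.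
  Where it runs to a height comparable to |x - y|, the remaining time is bounded, and since heights
  change at most exponentially in time they stay O(|x - y|). Endpoints close to each other relative
  to their height are compared with a segment instead.\<close>

lemma absolutely_continuous_onD:
  assumes "absolutely_continuous_on a b f" and "e > 0"
  obtains d where "d > 0"
    "\<forall>(m::nat) s t. (\<forall>i<m. a \<le> s i \<and> s i \<le> t i \<and> t i \<le> b) \<longrightarrow>
       (\<forall>i<m. \<forall>j<m. i \<noteq> j \<longrightarrow> {s i<..<t i} \<inter> {s j<..<t j} = {}) \<longrightarrow>
       (\<Sum>i<m. t i - s i) < d \<longrightarrow> (\<Sum>i<m. dist (f (s i)) (f (t i))) < e"
  using assms(1)[unfolded absolutely_continuous_on_def, THEN spec, THEN mp, OF assms(2)]
  by (elim exE conjE) (rule that)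

section \<open>Divisions of intervals and finite Vitali coverings\<close>

lemma absolutely_continuous_on_division:
  fixes f :: "real \<Rightarrow> 'a::metric_space"
  assumes "absolutely_continuous_on a b f" and "e > 0"
  obtains d where "d > 0"
    "\<forall>D. D division_of \<Union>D \<longrightarrow> \<Union>D \<subseteq> {a..b} \<longrightarrow> sum (measure lebesgue) D < d
      \<longrightarrow> (\<Sum>K\<in>D. dist (f (Inf K)) (f (Sup K))) < e"
proof -
  obtain d where d: "d > 0"
    "\<forall>(m::nat) s t. (\<forall>i<m. a \<le> s i \<and> s i \<le> t i \<and> t i \<le> b) \<longrightarrow>
       (\<forall>i<m. \<forall>j<m. i \<noteq> j \<longrightarrow> {s i<..<t i} \<inter> {s j<..<t j} = {}) \<longrightarrow>
       (\<Sum>i<m. t i - s i) < d \<longrightarrow> (\<Sum>i<m. dist (f (s i)) (f (t i))) < e"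
    by (rule absolutely_continuous_onD[OF assms])
  show thesis
  proof (rule that[OF d(1)], intro allI impI)
    fix D assume D: "D division_of \<Union>D" "\<Union>D \<subseteq> {a..b}" "sum (measure lebesgue) D < d"
    note dv = division_ofD[OF D(1)]
    \<comment> \<open>Absolute continuity is defined for numbered intervals, whereas a division is a
      set of intervals; \<open>g\<close> numbers its members.\<close>
    obtain g where g: "bij_betw g {..<card D} D"
      using ex_bij_betw_nat_finite[OF dv(1)] by (metis atLeast0LessThan)
    have gD: "g i \<in> D" if "i < card D" for i
      using g that by (auto simp: bij_betw_def)
    have K: "\<exists>u v. K = {u..v} \<and> u \<le> v \<and> a \<le> u \<and> v \<le> b" if "K \<in> D" for K
    proof -
      obtain u v where "K = cbox u v" using dv(4) \<open>K \<in> D\<close> by blast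
      moreover have "K \<noteq> {}" using dv(3) that by blast
      moreover have "K \<subseteq> {a..b}" using D(2) that by blast
      ultimately show ?thesis by auto
    qed
    have K2: "K = {Inf K..Sup K} \<and> Inf K \<le> Sup K \<and> a \<le> Inf K \<and> Sup K \<le> b \<and> measure lebesgue K = Sup K - Inf K"
      if "K \<in> D" for K
      using K[OF that] by force
    have 1: "(\<Sum>i<card D. h (g i)) = sum h D" for h :: "real set \<Rightarrow> real"
      using sum.reindex_bij_betw[OF g] by blast
    have "(\<Sum>i<card D. dist (f (Inf (g i))) (f (Sup (g i)))) < e"
    proof (rule d(2)[THEN spec, THEN spec, THEN spec, THEN mp, THEN mp, THEN mp])
      show "\<forall>i<card D. a \<le> Inf (g i) \<and> Inf (g i) \<le> Sup (g i) \<and> Sup (g i) \<le> b"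
        using K2 gD by blast
      show "\<forall>i<card D. \<forall>j<card D. i \<noteq> j \<longrightarrow>
           {Inf (g i)<..<Sup (g i)} \<inter> {Inf (g j)<..<Sup (g j)} = {}"
      proof (intro allI impI)
        fix i j assume ij: "i < card D" "j < card D" "i \<noteq> j"
        then have "g i \<noteq> g j"
          using g by (auto simp: bij_betw_def inj_on_def)
        then have "interior (g i) \<inter> interior (g j) = {}"
          using dv(5) gD ij by blast
        then show "{Inf (g i)<..<Sup (g i)} \<inter> {Inf (g j)<..<Sup (g j)} = {}"
          using K2[OF gD[OF ij(1)]] K2[OF gD[OF ij(2)]]
          by (metis interior_atLeastAtMost_real)
      qed
      have "(\<Sum>i<card D. Sup (g i) - Inf (g i)) = (\<Sum>i<card D. measure lebesgue (g i))"
        using K2 gD by (intro sum.cong) auto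
      also have "\<dots> < d" using 1[of "measure lebesgue"] D(3) by simp
      finally show "(\<Sum>i<card D. Sup (g i) - Inf (g i)) < d" .
    qed
    then show "(\<Sum>K\<in>D. dist (f (Inf K)) (f (Sup K))) < e"
      using 1[of "\<lambda>K. dist (f (Inf K)) (f (Sup K))"] by simp
  qed
qed

text \<open>Vitali's theorem gives a countable disjoint subfamily that covers \<open>E\<close> up to
  a null set. Its union lies in \<open>S\<close>, which has finite measure, so a finite subfamily
  misses only measure below \<open>e\<close>. The missed part and the null set form
  \<open>T\<close>.\<close>

lemma vitali_finite_intervals:
  fixes E S :: "real set"
  assumes "open S" "S \<in> lmeasurable" "E \<subseteq> S" "e > 0"
    and P: "\<And>x d. \<lbrakk>x \<in> E; d > 0\<rbrakk> \<Longrightarrow> \<exists>u v. u < v \<and> u \<le> x \<and> x \<le> v \<and> v - u < d \<and> P u v"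
  obtains D T where "finite D" "\<forall>u v. (u, v) \<in> D \<longrightarrow> u < v \<and> {u..v} \<subseteq> S \<and> P u v"
    "pairwise (\<lambda>i j. disjnt {fst i..snd i} {fst j..snd j}) D"
    "T \<in> lmeasurable" "measure lebesgue T < e" "E \<subseteq> T \<union> (\<Union>i\<in>D. {fst i..snd i})"
proof -
  define K where "K = {(u::real, v). u < v \<and> {u..v} \<subseteq> S \<and> P u v}"
  \<comment> \<open>The covering theorem is applied to balls: an interval, indexed by its pair of
    endpoints, is the ball about its midpoint.\<close>
  let ?a = "\<lambda>i::real\<times>real. (fst i + snd i) / 2" and ?r = "\<lambda>i::real\<times>real. (snd i - fst i) / 2"
  have cb: "cball (?a i) (?r i) = {fst i..snd i}" for i
    by (simp add: cball_eq_atLeastAtMost field_simps)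
  have pos: "0 < ?r i" if "i \<in> K" for i
    using that by (auto simp: K_def)
  obtain C where C: "countable C" "C \<subseteq> K"
    "pairwise (\<lambda>i j. disjnt (cball (?a i) (?r i)) (cball (?a j) (?r j))) C"
    "negligible (E - (\<Union>i \<in> C. cball (?a i) (?r i)))"
  proof (rule Vitali_covering_theorem_cballs[of K ?r E ?a, OF pos])
    fix x and d :: real assume x: "x \<in> E" "0 < d"
    then obtain k where k: "k > 0" "ball x k \<subseteq> S"
      using \<open>open S\<close> \<open>E \<subseteq> S\<close> by (meson openE subsetD)
    obtain u v where uv: "u < v" "u \<le> x" "x \<le> v" "v - u < min k d" "P u v"
      using P[of x "min k d"] x k by auto
    have "{u..v} \<subseteq> ball x k" using uv by (auto simp: dist_real_def)
    then have "(u, v) \<in> K" using uv k by (auto simp: K_def)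
    moreover have "x \<in> cball (?a (u,v)) (?r (u,v))" using uv by (simp only: cb) auto
    ultimately show "\<exists>i. i \<in> K \<and> x \<in> cball (?a i) (?r i) \<and> ?r i < d"
      using uv by (intro exI[of _ "(u,v)"]) auto
  qed blast+
  define F where "F = (\<lambda>i. {fst i..snd i}) ` C"
  have F: "countable F" "\<And>A. A \<in> F \<Longrightarrow> A \<in> lmeasurable" "disjoint F" "\<Union>F \<subseteq> S"
  proof -
    show "countable F" using C by (simp add: F_def)
    show "A \<in> lmeasurable" if "A \<in> F" for A using that by (auto simp: F_def)
    show "disjoint F" using C(3) by (auto simp: F_def cb pairwise_def)
    show "\<Union>F \<subseteq> S" using C(2) by (fastforce simp: F_def K_def)
  qed
  have mF: "\<Union>F \<in> lmeasurable"
  proof -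
    have "\<Union>F \<in> sets lebesgue"
      using F by (intro sets.countable_Union) (auto simp: fmeasurableD)
    then show ?thesis
      using F(4) \<open>S \<in> lmeasurable\<close> fmeasurableI2 by blast
  qed
  obtain F' where F': "F' \<subseteq> F" "finite F'" "measure lebesgue (\<Union>F - \<Union>F') < e"
  proof -
    have bnd: "measure lebesgue (\<Union>G) \<le> measure lebesgue S" if "G \<subseteq> F" "finite G" for G
    proof (rule measure_mono_fmeasurable)
      show "\<Union>G \<subseteq> S" using F(4) that(1) by blast
      show "\<Union>G \<in> sets lebesgue"
        using fmeasurableD[OF F(2)] that by (intro sets.finite_Union) blast+
    qed fact
    obtain G where G: "G \<subseteq> F" "finite G" "measure lebesgue (\<Union>F) - e < measure lebesgue (\<Union>G)"
      by (rule measure_countable_Union_approachable[OF F(1) \<open>e>0\<close> F(2) bnd])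
    have "\<Union>G \<in> lmeasurable" using G F by (intro fmeasurable.finite_Union) auto
    then have "measure lebesgue (\<Union>F - \<Union>G) = measure lebesgue (\<Union>F) - measure lebesgue (\<Union>G)"
      using G mF by (intro measurable_measure_Diff) (auto simp: fmeasurableD)
    then show ?thesis using that[of G] G by linarith
  qed
  obtain D where D: "D \<subseteq> C" "finite D" "F' = (\<lambda>i. {fst i..snd i}) ` D"
    using F' unfolding F_def by (meson finite_subset_image)
  define N where "N = E - (\<Union>i \<in> C. {fst i..snd i})"
  have N: "negligible N" using C(4) by (simp add: N_def cb)
  define T where "T = N \<union> (\<Union>F - \<Union>F')"
  have "\<Union>F' \<in> lmeasurable" using F' F by (intro fmeasurable.finite_Union) auto
  then have dm: "\<Union>F - \<Union>F' \<in> lmeasurable" using mF by (intro fmeasurable_Diff) (auto simp: fmeasurableD)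
  show thesis
  proof (rule that[of D T])
    show "finite D" by fact
    show "\<forall>u v. (u, v) \<in> D \<longrightarrow> u < v \<and> {u..v} \<subseteq> S \<and> P u v"
      using D C(2) by (auto simp: K_def)
    show "pairwise (\<lambda>i j. disjnt {fst i..snd i} {fst j..snd j}) D"
      using pairwise_subset[OF C(3) D(1)] by (simp add: cb)
    show "T \<in> lmeasurable"
      unfolding T_def using dm N negligible_imp_measurable by blast
    show "measure lebesgue T < e"
    proof -
      have "measure lebesgue T \<le> measure lebesgue N + measure lebesgue (\<Union>F - \<Union>F')"
        unfolding T_def using dm negligible_imp_measurable[OF N]
        by (intro measure_Un_le) (auto simp: fmeasurableD)
      then show ?thesis using F'(3) negligible_imp_measure0[OF N] by linarith
    qed
    show "E \<subseteq> T \<union> (\<Union>i\<in>D. {fst i..snd i})"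
      unfolding T_def N_def using D(3) by (auto simp: F_def)
  qed
qed

text \<open>The interval is connected, so it cannot meet both one member of \<open>Q\<close> and the
  union of the others, which are disjoint closed sets covering it.\<close>

lemma interval_subset_one:
  fixes Q :: "real set set"
  assumes "finite Q" "disjoint Q" "\<And>K. K \<in> Q \<Longrightarrow> closed K" "{u..v} \<subseteq> \<Union>Q" "u \<le> v"
  obtains K where "K \<in> Q" "{u..v} \<subseteq> K"
proof -
  obtain K where K: "K \<in> Q" "u \<in> K" using assms by fastforce
  have c: "closed (\<Union>(Q - {K}))" using assms by (intro closed_Union) auto
  have d: "K \<inter> \<Union>(Q - {K}) = {}"
    using assms(2) K(1) by (auto simp: pairwise_def disjnt_def)
  have "\<Union>(Q - {K}) \<inter> {u..v} = {}"
  proof (rule ccontr)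
    assume "\<Union>(Q - {K}) \<inter> {u..v} \<noteq> {}"
    moreover have "K \<inter> {u..v} \<noteq> {}" using K assms(5) by auto
    moreover have "{u..v} \<subseteq> K \<union> \<Union>(Q - {K})" using assms(4) by auto
    moreover have "K \<inter> \<Union>(Q - {K}) \<inter> {u..v} = {}" using d by auto
    ultimately show False
      using connected_closedD[of "{u..v}" K "\<Union>(Q - {K})"] assms(3)[OF K(1)] c by auto
  qed
  then have "{u..v} \<subseteq> K" using assms(4) K(1) by fast
  then show thesis using that K by blast
qed

lemma sum_division_increment:
  fixes f :: "real \<Rightarrow> real"
  assumes "p division_of {u..v}" "u \<le> v"
  shows "(\<Sum>K\<in>p. f (Sup K) - f (Inf K)) = f v - f u"
proof -
  note dv = division_ofD[OF assms(1)]
  have K2: "Inf K \<in> K \<and> (\<exists>x y. K = {x..y})" if K: "K \<in> p" for K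
    using dv(3)[OF K] dv(4)[OF K] by force
  \<comment> \<open>Tagging each member by its left endpoint makes the telescoping sum for tagged
    divisions applicable.\<close>
  define q where "q = (\<lambda>K. (Inf K, K)) ` p"
  have "q tagged_division_of {u..v}"
  proof (rule tagged_division_ofI)
    show "finite q" using dv(1) by (simp add: q_def)
    show "\<Union>{K. \<exists>x. (x, K) \<in> q} = {u..v}" using dv(6) unfolding q_def by blast
    fix x K assume "(x, K) \<in> q"
    then have xK: "K \<in> p" "x = Inf K" by (auto simp: q_def)
    show "x \<in> K" "K \<subseteq> {u..v}" "\<exists>a b. K = cbox a b"
      using xK K2 dv(2,4) by auto
    fix x' K' assume "(x', K') \<in> q" "(x, K) \<noteq> (x', K')"
    then have "K' \<in> p" "K \<noteq> K'" using xK by (auto simp: q_def)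
    then show "interior K \<inter> interior K' = {}" using dv(5) xK by blast
  qed
  from additive_tagged_division_1[OF assms(2) this, of f]
  show ?thesis
    unfolding q_def by (subst (asm) sum.reindex) (auto simp: inj_on_def o_def)
qed

lemma division_of_disjoint_intervals:
  fixes D :: "(real \<times> real) set"
  assumes "finite D" "\<And>u v. (u, v) \<in> D \<Longrightarrow> u < v"
    "pairwise (\<lambda>i j. disjnt {fst i..snd i} {fst j..snd j}) D"
  defines "F \<equiv> (\<lambda>i. {fst i..snd i}) ` D"
  shows "F division_of \<Union>F" "disjoint F" "sum g F = (\<Sum>(u,v)\<in>D. g {u..v})"
    "measure lebesgue (\<Union>F) = (\<Sum>(u,v)\<in>D. v - u)"
proof -
  show dj: "disjoint F" using assms(3) by (auto simp: F_def pairwise_def)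
  show div: "F division_of \<Union>F"
  proof (rule division_ofI)
    show "finite F" using assms by (simp add: F_def)
    show "K \<noteq> {}" if "K \<in> F" for K using that assms(2) by (fastforce simp: F_def)
    show "\<exists>a b. K = cbox a b" if "K \<in> F" for K using that by (auto simp: F_def)
    show "interior K1 \<inter> interior K2 = {}" if "K1 \<in> F" "K2 \<in> F" "K1 \<noteq> K2" for K1 K2
    proof -
      have "K1 \<inter> K2 = {}" using dj that by (auto simp: pairwise_def disjnt_def)
      then show ?thesis using interior_subset[of K1] interior_subset[of K2] by blast
    qed
  qed auto
  have inj: "inj_on (\<lambda>i. {fst i..snd i}) D"
  proof (rule inj_onI)
    fix i j assume ij: "i \<in> D" "j \<in> D" "{fst i..snd i} = {fst j..snd j}"
    have "fst i < snd i" using assms(2)[of "fst i" "snd i"] ij by auto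
    then show "i = j" using ij(3) by (auto simp: prod_eq_iff Icc_eq_Icc)
  qed
  show s: "sum g F = (\<Sum>(u,v)\<in>D. g {u..v})" for g :: "real set \<Rightarrow> 'b::comm_monoid_add"
    unfolding F_def by (subst sum.reindex[OF inj]) (auto simp: o_def case_prod_unfold)
  have "measure lebesgue (\<Union>F) = sum (measure lebesgue) F"
    using content_division[OF div] by simp
  also have "\<dots> = (\<Sum>(u,v)\<in>D. measure lebesgue {u..v})" by (rule s)
  also have "\<dots> = (\<Sum>(u,v)\<in>D. v - u)" 
  proof (rule sum.cong[OF refl], clarify)
    fix u v assume "(u, v) \<in> D"
    then show "measure lebesgue {u..v} = v - u" using assms(2)[of u v] by simp
  qed
  finally show "measure lebesgue (\<Union>F) = (\<Sum>(u,v)\<in>D. v - u)" .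
qed

section \<open>Differentiability almost everywhere of absolutely continuous functions\<close>

lemma negligible_if_measure_le:
  fixes E :: "real set"
  assumes "\<And>e. e > 0 \<Longrightarrow> \<exists>T\<in>lmeasurable. E \<subseteq> T \<and> measure lebesgue T \<le> C * e" and "C \<ge> 0"
  shows "negligible E"
  unfolding negligible_outer_le
proof (intro allI impI)
  fix e :: real assume "e > 0"
  then obtain T where T: "T \<in> lmeasurable" "E \<subseteq> T" "measure lebesgue T \<le> C * (e / (C + 1))"
    using assms(1)[of "e / (C + 1)"] assms(2) by force
  have "C * (e / (C + 1)) \<le> e"
    using \<open>e > 0\<close> assms(2) by (simp add: field_simps)
  then show "\<exists>T. E \<subseteq> T \<and> T \<in> lmeasurable \<and> measure lebesgue T \<le> e"
    using T by (meson order_trans)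
qed

text \<open>Cover \<open>E\<close> by disjoint intervals of slope at most \<open>p\<close> and,
  inside them, by disjoint intervals of slope at least \<open>q\<close>. Both families have total
  length close to the outer measure of \<open>E\<close>, so by absolute continuity \<open>f\<close>
  changes little on their difference. Comparing the increments bounds \<open>q - p\<close> times
  this length by an arbitrarily small number.\<close>

lemma negligible_slope_gap:
  fixes f :: "real \<Rightarrow> real"
  assumes ac: "absolutely_continuous_on a b f" and "p < q" and "E \<subseteq> {a<..<b}"
    and lo: "\<And>x d. \<lbrakk>x \<in> E; d > 0\<rbrakk> \<Longrightarrow> \<exists>u v. u < v \<and> u \<le> x \<and> x \<le> v \<and> v - u < d \<and> f v - f u \<le> p * (v - u)"
    and hi: "\<And>x d. \<lbrakk>x \<in> E; d > 0\<rbrakk> \<Longrightarrow> \<exists>u v. u < v \<and> u \<le> x \<and> x \<le> v \<and> v - u < d \<and> f v - f u \<ge> q * (v - u)"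
  shows "negligible E"
proof -
  \<comment> \<open>\<open>E\<close> is not known to be measurable; \<open>m\<close> is its outer
    measure.\<close>
  define M where "M = {measure lebesgue S | S. S \<in> lmeasurable \<and> E \<subseteq> S}"
  define m where "m = Inf M"
  have bdd: "bdd_below M" by (rule bdd_belowI[of _ 0]) (auto simp: M_def)
  have "measure lebesgue {a<..<b} \<in> M" using assms(3) by (auto simp: M_def intro!: exI[of _ "{a<..<b}"])
  then have ne: "M \<noteq> {}" by auto
  have m_le: "m \<le> measure lebesgue S" if "S \<in> lmeasurable" "E \<subseteq> S" for S
    unfolding m_def using that by (intro cInf_lower bdd) (auto simp: M_def)
  have key: "m \<le> (2 + (3 * \<bar>p\<bar> + 1) / (q - p)) * e" if "e > 0" for e
  proof -
    obtain d where d: "d > 0" "\<forall>D. D division_of \<Union>D \<longrightarrow> \<Union>D \<subseteq> {a..b} \<longrightarrow> sum (measure lebesgue) D < d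
      \<longrightarrow> (\<Sum>K\<in>D. dist (f (Inf K)) (f (Sup K))) < e"
      by (rule absolutely_continuous_on_division[OF ac \<open>e > 0\<close>])
    \<comment> \<open>The total lengths of the two families will differ by less than
      \<open>3 * \<eta>\<close>, and this has to stay below \<open>d\<close>.\<close>
    define \<eta> where "\<eta> = min e (d / 4)"
    have \<eta>: "\<eta> > 0" "\<eta> \<le> e" "3 * \<eta> < d" using d(1) \<open>e > 0\<close> by (auto simp: \<eta>_def)
    obtain S0 where S0: "S0 \<in> lmeasurable" "E \<subseteq> S0" "measure lebesgue S0 < m + \<eta> / 2"
      using cInf_lessD[OF ne, of "m + \<eta> / 2"] \<eta> unfolding m_def M_def by auto
    obtain T0 where T0: "open T0" "S0 \<subseteq> T0" "T0 - S0 \<in> lmeasurable" "emeasure lebesgue (T0 - S0) < ennreal (\<eta> / 2)"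
      using sets_lebesgue_outer_open[of S0 "\<eta> / 2"] S0 \<eta> by (auto simp: fmeasurableD)
    define U where "U = T0 \<inter> {a<..<b}"
    have U: "open U" "E \<subseteq> U" "U \<subseteq> {a<..<b}"
      using T0 S0 assms(3) by (auto simp: U_def)
    moreover have "U \<in> lmeasurable"
      using U(1,3) by (intro lmeasurable_open bounded_subset[OF bounded_box[of a b]]) (auto simp: box_real)
    ultimately have U: "open U" "E \<subseteq> U" "U \<subseteq> {a<..<b}" "U \<in> lmeasurable" by auto
    have mT: "measure lebesgue (T0 - S0) < \<eta> / 2"
      using T0(3,4) \<eta> by (simp add: emeasure_eq_measure2 ennreal_less_iff)
    have "measure lebesgue U \<le> measure lebesgue (S0 \<union> (T0 - S0))"
      using T0(2) U fmeasurable.Un[OF S0(1) T0(3)]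
      by (intro measure_mono_fmeasurable) (auto simp: U_def fmeasurableD)
    also have "\<dots> \<le> measure lebesgue S0 + measure lebesgue (T0 - S0)"
      using S0 T0 by (intro measure_Un_le) (auto simp: fmeasurableD)
    finally have mU: "measure lebesgue U < m + \<eta>" using mT S0 by simp
    obtain D1 T1 where D1: "finite D1" "\<forall>u v. (u, v) \<in> D1 \<longrightarrow> u < v \<and> {u..v} \<subseteq> U \<and> f v - f u \<le> p * (v - u)"
      "pairwise (\<lambda>i j. disjnt {fst i..snd i} {fst j..snd j}) D1"
      "T1 \<in> lmeasurable" "measure lebesgue T1 < \<eta>" "E \<subseteq> T1 \<union> (\<Union>i\<in>D1. {fst i..snd i})"
      by (rule vitali_finite_intervals[OF U(1,4,2) \<eta>(1) lo])
    define O1 where "O1 = (\<Union>i\<in>D1. {fst i<..<snd i})"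
    have O1: "open O1" "O1 \<in> lmeasurable"
      using D1(1) by (auto simp: O1_def intro!: fmeasurable.finite_Union)
    obtain D2 T2 where D2: "finite D2" "\<forall>u v. (u, v) \<in> D2 \<longrightarrow> u < v \<and> {u..v} \<subseteq> O1 \<and> f v - f u \<ge> q * (v - u)"
      "pairwise (\<lambda>i j. disjnt {fst i..snd i} {fst j..snd j}) D2"
      "T2 \<in> lmeasurable" "measure lebesgue T2 < \<eta>" "E \<inter> O1 \<subseteq> T2 \<union> (\<Union>i\<in>D2. {fst i..snd i})"
      by (rule vitali_finite_intervals[OF O1 Int_lower2 \<eta>(1) hi[OF IntD1]])
    define F1 where "F1 = (\<lambda>i. {fst i..snd i}) ` D1"
    define F2 where "F2 = (\<lambda>i. {fst i..snd i}) ` D2"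
    note dF1 = division_of_disjoint_intervals[OF D1(1) _ D1(3), folded F1_def]
    note dF2 = division_of_disjoint_intervals[OF D2(1) _ D2(3), folded F2_def]
    have divF1: "F1 division_of \<Union>F1" and djF1: "disjoint F1" using dF1(1,2) D1(2) by blast+
    have divF2: "F2 division_of \<Union>F2" using dF2(1) D2(2) by blast
    define S1 where "S1 = (\<Sum>(u,v)\<in>D1. v - u)"
    define S2 where "S2 = (\<Sum>(u,v)\<in>D2. v - u)"
    have mF1: "measure lebesgue (\<Union>F1) = S1" unfolding S1_def using dF1(4) D1(2) by blast
    have mF2: "measure lebesgue (\<Union>F2) = S2" unfolding S2_def using dF2(4) D2(2) by blast
    have "{fst i..snd i} \<subseteq> U" if "i \<in> D1" for i
      using D1(2)[rule_format, of "fst i" "snd i"] that by simp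
    then have subU: "\<Union>F1 \<subseteq> U" unfolding F1_def by (rule UN_least)
    have lF1: "\<Union>F1 \<in> lmeasurable" using D1(1) by (auto simp: F1_def intro!: fmeasurable.finite_Union)
    have lF2: "\<Union>F2 \<in> lmeasurable" using D2(1) by (auto simp: F2_def intro!: fmeasurable.finite_Union)
    have S1U: "S1 < m + \<eta>"
      using measure_mono_fmeasurable[OF subU fmeasurableD[OF lF1] U(4)] mF1 mU by simp
    define N where "N = fst ` D1 \<union> snd ` D1"
    have N: "negligible N" using D1(1) by (auto simp: N_def intro: negligible_finite)
    have "E \<subseteq> (T1 \<union> T2) \<union> (\<Union>F2 \<union> N)"
    proof
      fix x assume x: "x \<in> E"
      show "x \<in> (T1 \<union> T2) \<union> (\<Union>F2 \<union> N)"
      proof (cases "x \<in> T1")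
        case False
        then obtain i where i: "i \<in> D1" "x \<in> {fst i..snd i}" using D1(6) x by auto
        show ?thesis
        proof (cases "x \<in> {fst i<..<snd i}")
          case True
          then have "x \<in> O1" using i by (auto simp: O1_def)
          then have "x \<in> T2 \<union> \<Union>F2" using D2(6) x unfolding F2_def by blast
          then show ?thesis by blast
        next
          case False
          then have "x = fst i \<or> x = snd i" using i by auto
          then show ?thesis using i by (auto simp: N_def)
        qed
      qed auto
    qed
    then have "m \<le> measure lebesgue ((T1 \<union> T2) \<union> (\<Union>F2 \<union> N))"
      using D1(4) D2(4) lF2 negligible_imp_measurable[OF N] by (intro m_le) auto
    also have "\<dots> \<le> (measure lebesgue T1 + measure lebesgue T2) + (measure lebesgue (\<Union>F2) + measure lebesgue N)"
      using D1(4) D2(4) lF2 negligible_imp_measurable[OF N]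
      by (intro order_trans[OF measure_Un_le] add_mono measure_Un_le) (auto simp: fmeasurableD)
    finally have mS2: "m \<le> 2 * \<eta> + S2"
      using D1(5) D2(5) mF2 negligible_imp_measure0[OF N] by simp
    have "{fst i..snd i} \<subseteq> O1" if "i \<in> D2" for i
      using D2(2)[rule_format, of "fst i" "snd i"] that by simp
    then have "\<Union>F2 \<subseteq> O1" unfolding F2_def by (rule UN_least)
    also have "O1 \<subseteq> \<Union>F1" unfolding F1_def O1_def by (rule UN_mono) auto
    finally have sub21: "\<Union>F2 \<subseteq> \<Union>F1" .
    \<comment> \<open>Extending \<open>F2\<close> to a division of the larger union exhibits the
      difference of the two coverings as the intervals in \<open>r - F2\<close>.\<close>
    obtain r where r: "F2 \<subseteq> r" "r division_of \<Union>F1"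
      using partial_division_extend[OF divF2 divF1 sub21] .
    note dr = division_ofD[OF r(2)]
    let ?c = "measure lebesgue :: real set \<Rightarrow> real"
    let ?g = "\<lambda>K. f (Sup K) - f (Inf K)"
    have "sum ?c r = sum ?c F1"
      using content_division[OF r(2)] content_division[OF divF1] by simp
    also have "\<dots> = (\<Sum>(u,v)\<in>D1. ?c {u..v})" using dF1(3) D1(2) by blast
    also have "\<dots> = S1" unfolding S1_def
    proof (rule sum.cong[OF refl], clarify)
      fix u v assume "(u, v) \<in> D1"
      then show "?c {u..v} = v - u" using D1(2)[rule_format, of u v] by simp
    qed
    finally have cr: "sum ?c r = S1" .
    have cF2: "sum ?c F2 = S2"
    proof -
      have "sum ?c F2 = (\<Sum>(u,v)\<in>D2. ?c {u..v})" using dF2(3) D2(2) by blast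
      also have "\<dots> = S2" unfolding S2_def
      proof (rule sum.cong[OF refl], clarify)
        fix u v assume "(u, v) \<in> D2"
        then show "?c {u..v} = v - u" using D2(2)[rule_format, of u v] by simp
      qed
      finally show ?thesis .
    qed
    have gF1: "sum ?g F1 \<le> p * S1"
    proof -
      have "sum ?g F1 = (\<Sum>(u,v)\<in>D1. ?g {u..v})" using dF1(3) D1(2) by blast
      also have "\<dots> \<le> (\<Sum>(u,v)\<in>D1. p * (v - u))"
      proof (rule sum_mono, clarify)
        fix u v assume "(u, v) \<in> D1"
        then show "f (Sup {u..v}) - f (Inf {u..v}) \<le> p * (v - u)" using D1(2)[rule_format, of u v] by simp
      qed
      finally show ?thesis by (simp add: S1_def sum_distrib_left case_prod_unfold)
    qed
    have gF2: "sum ?g F2 \<ge> q * S2"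
    proof -
      have "(\<Sum>(u,v)\<in>D2. q * (v - u)) \<le> (\<Sum>(u,v)\<in>D2. ?g {u..v})"
      proof (rule sum_mono, clarify)
        fix u v assume "(u, v) \<in> D2"
        then show "q * (v - u) \<le> f (Sup {u..v}) - f (Inf {u..v})" using D2(2)[rule_format, of u v] by simp
      qed
      also have "\<dots> = sum ?g F2" by (rule dF2(3)[symmetric]) (use D2(2) in blast)
      finally show ?thesis by (simp add: S2_def sum_distrib_left case_prod_unfold)
    qed
    \<comment> \<open>Each member of \<open>r\<close> lies in a single interval of
      \<open>F1\<close>, so \<open>r\<close> splits into divisions of these intervals and the
      increments telescope.\<close>
    have gr: "sum ?g r = sum ?g F1"
    proof -
      have one: "\<exists>K\<in>F1. k \<subseteq> K" if k: "k \<in> r" for k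
      proof -
        obtain x y where xy: "k = {x..y}" "x \<le> y" using dr(3,4)[OF k] by force
        have "{x..y} \<subseteq> \<Union>F1" using dr(2)[OF k] xy by simp
        moreover have F1: "finite F1" "\<And>K. K \<in> F1 \<Longrightarrow> closed K" using D1(1) by (auto simp: F1_def)
        ultimately obtain K where "K \<in> F1" "{x..y} \<subseteq> K"
          using interval_subset_one[OF F1(1) djF1 F1(2) _ xy(2)] by auto
        then show ?thesis using xy(1) by auto
      qed
      have djr: "K = K'" if "K \<in> F1" "K' \<in> F1" "k \<in> r" "k \<subseteq> K" "k \<subseteq> K'" for K K' k
      proof (rule ccontr)
        assume "K \<noteq> K'"
        then have "K \<inter> K' = {}" using djF1 that by (auto simp: pairwise_def disjnt_def)
        then show False using dr(3)[OF that(3)] that by blast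
      qed
      have "r = (\<Union>K\<in>F1. {k \<in> r. k \<subseteq> K})" using one by auto
      then have "sum ?g r = sum ?g (\<Union>K\<in>F1. {k \<in> r. k \<subseteq> K})" by simp
      also have "\<dots> = (\<Sum>K\<in>F1. sum ?g {k \<in> r. k \<subseteq> K})"
      proof (rule sum.UNION_disjoint)
        show "finite F1" using D1(1) by (simp add: F1_def)
        show "\<forall>K\<in>F1. finite {k \<in> r. k \<subseteq> K}" using dr(1) by simp
        show "\<forall>K\<in>F1. \<forall>K'\<in>F1. K \<noteq> K' \<longrightarrow> {k \<in> r. k \<subseteq> K} \<inter> {k \<in> r. k \<subseteq> K'} = {}"
          using djr by blast
      qed
      also have "\<dots> = sum ?g F1"
      proof (rule sum.cong[OF refl])
        fix K assume K: "K \<in> F1"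
        then obtain u v where uv: "(u, v) \<in> D1" "K = {u..v}" by (auto simp: F1_def)
        then have "u < v" using D1(2) by auto
        have "{k \<in> r. k \<subseteq> K} division_of {u..v}"
        proof (rule division_ofI)
          show "\<Union>{k \<in> r. k \<subseteq> K} = {u..v}"
          proof
            show "{u..v} \<subseteq> \<Union>{k \<in> r. k \<subseteq> K}"
            proof
              fix x assume x: "x \<in> {u..v}"
              then have "x \<in> \<Union>F1" using K uv by auto
              then obtain k where k: "k \<in> r" "x \<in> k" using dr(6) by auto
              obtain K' where K': "K' \<in> F1" "k \<subseteq> K'" using one[OF k(1)] by auto
              have "x \<in> K \<inter> K'" using x uv k K' by auto
              then have "K = K'" using djF1 K K' by (auto simp: pairwise_def disjnt_def)
              then show "x \<in> \<Union>{k \<in> r. k \<subseteq> K}" using k K' by auto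
            qed
          qed (use uv in auto)
          show "finite {k \<in> r. k \<subseteq> K}" using dr(1) by simp
          show "k \<subseteq> {u..v}" if "k \<in> {k \<in> r. k \<subseteq> K}" for k using that uv(2) by simp
          show "k \<noteq> {}" if "k \<in> {k \<in> r. k \<subseteq> K}" for k using dr(3) that by simp
          show "\<exists>a b. k = cbox a b" if "k \<in> {k \<in> r. k \<subseteq> K}" for k using dr(4) that by simp
          show "interior k \<inter> interior l = {}"
            if "k \<in> {k \<in> r. k \<subseteq> K}" "l \<in> {k \<in> r. k \<subseteq> K}" "k \<noteq> l" for k l
            using dr(5) that by simp
        qed
        from sum_division_increment[OF this, of f] \<open>u < v\<close>
        show "sum ?g {k \<in> r. k \<subseteq> K} = ?g K" by (simp add: uv(2))
      qed
      finally show ?thesis .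
    qed
    have fin: "finite r" using dr(1) .
    have "sum ?c (r - F2) = S1 - S2"
      using cr cF2 sum_diff[OF fin r(1), of ?c] by simp
    also have "\<dots> < d" using mS2 S1U \<eta> by linarith
    finally have small: "sum ?c (r - F2) < d" .
    have "(\<Sum>K\<in>r - F2. dist (f (Inf K)) (f (Sup K))) < e"
    proof (rule d(2)[rule_format])
      show "(r - F2) division_of \<Union>(r - F2)"
        using division_of_subset[OF division_of_union_self[OF r(2)]] by blast
      show "\<Union>(r - F2) \<subseteq> {a..b}"
      proof -
        have "\<Union>(r - F2) \<subseteq> \<Union>r" by blast
        also have "\<dots> \<subseteq> {a<..<b}" using dr(6) subU U(3) by simp
        also have "\<dots> \<subseteq> {a..b}" by auto
        finally show ?thesis .
      qed
    qed fact
    moreover have "sum ?g (r - F2) \<ge> - (\<Sum>K\<in>r - F2. dist (f (Inf K)) (f (Sup K)))"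
      unfolding sum_negf[symmetric] by (rule sum_mono) (auto simp: dist_real_def)
    moreover have "sum ?g (r - F2) = sum ?g r - sum ?g F2"
      using sum_diff[OF fin r(1), of ?g] by simp
    ultimately have "q * S2 \<le> p * S1 + e" using gr gF1 gF2 by linarith
    then have "(q - p) * S2 \<le> p * (S1 - S2) + e" by (simp add: algebra_simps)
    also have "p * (S1 - S2) \<le> \<bar>p\<bar> * (3 * \<eta>)"
    proof -
      have "0 \<le> sum ?c (r - F2)" by (simp add: sum_nonneg)
      then have "0 \<le> S1 - S2" using cr cF2 sum_diff[OF fin r(1), of ?c] by simp
      moreover have "S1 - S2 \<le> 3 * \<eta>" using mS2 S1U by linarith
      ultimately show ?thesis by (intro mult_mono) auto
    qed
    also have "\<bar>p\<bar> * (3 * \<eta>) \<le> \<bar>p\<bar> * (3 * e)" using \<eta> by (intro mult_left_mono) auto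
    finally have "(q - p) * S2 \<le> (3 * \<bar>p\<bar> + 1) * e" by (simp add: algebra_simps)
    then have "S2 \<le> (3 * \<bar>p\<bar> + 1) / (q - p) * e"
      using \<open>p < q\<close> by (simp add: field_simps)
    then show ?thesis using mS2 \<eta>(2) by (simp add: algebra_simps)
  qed
  show ?thesis
  proof (rule negligible_if_measure_le)
    fix e :: real assume e: "e > 0"
    obtain S0 where S0: "S0 \<in> lmeasurable" "E \<subseteq> S0" "measure lebesgue S0 < m + e"
      using cInf_lessD[OF ne, of "m + e"] e unfolding m_def M_def by auto
    then show "\<exists>T\<in>lmeasurable. E \<subseteq> T \<and> measure lebesgue T \<le> (3 + (3 * \<bar>p\<bar> + 1) / (q - p)) * e"
      using key[OF e] by (intro bexI[of _ S0]) (auto simp: algebra_simps)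
  qed (use \<open>p < q\<close> in auto)
qed

text \<open>Locally, on an interval shorter than the \<open>d\<close> that absolute continuity
  assigns to 1, increments over disjoint intervals add up to less than 1. Intervals of slope at
  least \<open>1 / e\<close> there have total length below \<open>e\<close>.\<close>

lemma negligible_slope_unbounded:
  fixes f :: "real \<Rightarrow> real"
  assumes ac: "absolutely_continuous_on a b f" and "E \<subseteq> {a<..<b}"
    and E: "\<And>x d q. \<lbrakk>x \<in> E; d > 0\<rbrakk>
      \<Longrightarrow> \<exists>u v. u < v \<and> u \<le> x \<and> x \<le> v \<and> v - u < d \<and> \<bar>f v - f u\<bar> \<ge> q * (v - u)"
  shows "negligible E"
proof -
  obtain d where d: "d > 0" "\<forall>D. D division_of \<Union>D \<longrightarrow> \<Union>D \<subseteq> {a..b} \<longrightarrow> sum (measure lebesgue) D < d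
      \<longrightarrow> (\<Sum>K\<in>D. dist (f (Inf K)) (f (Sup K))) < 1"
    by (rule absolutely_continuous_on_division[OF ac zero_less_one])
  show ?thesis
    unfolding locally_negligible_alt[of E]
  proof
    fix x assume "x \<in> E"
    define J where "J = {max a (x - d / 3)<..<min b (x + d / 3)}"
    have J: "open J" "J \<in> lmeasurable" "J \<subseteq> {a<..<b}" by (auto simp: J_def)
    have mJ: "measure lebesgue J < d"
    proof -
      have "measure lebesgue J \<le> measure lebesgue {x - d / 3..x + d / 3}"
        using J(2) by (intro measure_mono_fmeasurable) (auto simp: J_def)
      also have "\<dots> < d" using d(1) by simp
      finally show ?thesis .
    qed
    have "negligible (E \<inter> J)"
    proof (rule negligible_if_measure_le[of _ 2])
      fix e :: real assume e: "e > 0"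
      obtain D T where D: "finite D" "\<forall>u v. (u, v) \<in> D \<longrightarrow> u < v \<and> {u..v} \<subseteq> J \<and> \<bar>f v - f u\<bar> \<ge> 1 / e * (v - u)"
        "pairwise (\<lambda>i j. disjnt {fst i..snd i} {fst j..snd j}) D"
        "T \<in> lmeasurable" "measure lebesgue T < e" "E \<inter> J \<subseteq> T \<union> (\<Union>i\<in>D. {fst i..snd i})"
        by (rule vitali_finite_intervals[OF J(1,2) Int_lower2 e E[OF IntD1]])
      define F where "F = (\<lambda>i. {fst i..snd i}) ` D"
      have D2: "u < v" if "(u, v) \<in> D" for u v using D(2) that by blast
      note dF = division_of_disjoint_intervals[OF D(1) D2 D(3), folded F_def]
      have "{fst i..snd i} \<subseteq> J" if "i \<in> D" for i
        using D(2)[rule_format, of "fst i" "snd i"] that by simp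
      then have FJ: "\<Union>F \<subseteq> J" unfolding F_def by (rule UN_least)
      have lF: "\<Union>F \<in> lmeasurable" using D(1) by (auto simp: F_def intro!: fmeasurable.finite_Union)
      have "measure lebesgue (\<Union>F) \<le> measure lebesgue J"
        using FJ J lF by (intro measure_mono_fmeasurable) (auto simp: fmeasurableD)
      moreover have "sum (measure lebesgue) F = measure lebesgue (\<Union>F)"
        using content_division[OF dF(1)] by simp
      ultimately have "sum (measure lebesgue) F < d" using mJ by simp
      moreover have "\<Union>F \<subseteq> {a..b}" using FJ J(3) by (meson greaterThanLessThan_subseteq_atLeastAtMost_iff order_refl order_trans)
      ultimately have "(\<Sum>K\<in>F. dist (f (Inf K)) (f (Sup K))) < 1"
        using d(2) dF(1) by blast
      also have "(\<Sum>K\<in>F. dist (f (Inf K)) (f (Sup K))) = (\<Sum>(u,v)\<in>D. dist (f (Inf {u..v})) (f (Sup {u..v})))"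
        by (rule dF(3))
      finally have 1: "(\<Sum>(u,v)\<in>D. dist (f (Inf {u..v})) (f (Sup {u..v}))) < 1" .
      have "(\<Sum>(u,v)\<in>D. 1 / e * (v - u)) \<le> (\<Sum>(u,v)\<in>D. dist (f (Inf {u..v})) (f (Sup {u..v})))"
      proof (rule sum_mono, clarify)
        fix u v assume "(u, v) \<in> D"
        then show "1 / e * (v - u) \<le> dist (f (Inf {u..v})) (f (Sup {u..v}))"
          using D(2)[rule_format, of u v] by (simp add: dist_real_def abs_minus_commute)
      qed
      moreover have "(\<Sum>(u,v)\<in>D. 1 / e * (v - u)) = 1 / e * measure lebesgue (\<Union>F)"
        using dF(4) by (simp add: sum_divide_distrib case_prod_unfold)
      ultimately have "1 / e * measure lebesgue (\<Union>F) < 1" using 1 by linarith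
      then have mF: "measure lebesgue (\<Union>F) < e" using e by (simp add: field_simps)
      show "\<exists>T\<in>lmeasurable. E \<inter> J \<subseteq> T \<and> measure lebesgue T \<le> 2 * e"
      proof (intro bexI conjI)
        show "E \<inter> J \<subseteq> T \<union> \<Union>F" using D(6) by (simp add: F_def)
        show "T \<union> \<Union>F \<in> lmeasurable" using D(4) lF by (rule fmeasurable.Un)
        have "measure lebesgue (T \<union> \<Union>F) \<le> measure lebesgue T + measure lebesgue (\<Union>F)"
          using D(4) lF by (intro measure_Un_le) (auto simp: fmeasurableD)
        then show "measure lebesgue (T \<union> \<Union>F) \<le> 2 * e" using mF D(5) by linarith
      qed
    qed simp
    moreover have "openin (top_of_set E) (E \<inter> J)" using J(1) by (rule openin_open_Int)
    moreover have "x \<in> E \<inter> J" using \<open>x \<in> E\<close> assms(2) d(1) by (auto simp: J_def)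
    ultimately show "\<exists>U. openin (top_of_set E) U \<and> x \<in> U \<and> negligible U" by blast
  qed
qed

text \<open>The derivative is \<open>Sup A\<close>, the lower limit of the difference quotient,
  where \<open>A\<close> collects its eventual strict lower bounds. It is finite because the slopes
  are bounded. For \<open>c\<close> above it, choose rationals \<open>p < q\<close> in between:
  \<open>p\<close> is not in \<open>A\<close>, so the second alternative of the gap condition must
  hold, and the quotient is eventually below \<open>c\<close>.\<close>

lemma real_differentiable_slopes:
  fixes f :: "real \<Rightarrow> real"
  assumes bnd: "d0 > 0" "\<And>u v. \<lbrakk>u < v; u \<le> x; x \<le> v; v - u < d0\<rbrakk> \<Longrightarrow> \<bar>f v - f u\<bar> < M * (v - u)"
    and gap: "\<And>p q. \<lbrakk>p \<in> \<rat>; q \<in> \<rat>; p < q\<rbrakk> \<Longrightarrow> \<exists>d>0.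
      (\<forall>u v. u < v \<and> u \<le> x \<and> x \<le> v \<and> v - u < d \<longrightarrow> f v - f u > p * (v - u)) \<or>
      (\<forall>u v. u < v \<and> u \<le> x \<and> x \<le> v \<and> v - u < d \<longrightarrow> f v - f u < q * (v - u))"
  shows "f differentiable (at x)"
proof -
  define Q where "Q y = (f y - f x) / (y - x)" for y
  have ev: "\<forall>\<^sub>F y in at x. P (Q y)"
    if d: "d > 0" "\<And>u v. \<lbrakk>u < v; u \<le> x; x \<le> v; v - u < d\<rbrakk> \<Longrightarrow> P ((f v - f u) / (v - u))" for d P
    unfolding eventually_at
  proof (intro exI[of _ d] conjI ballI impI)
    fix y assume y: "y \<noteq> x \<and> dist y x < d"
    show "P (Q y)"
    proof (cases "y < x")
      case True
      then have "P ((f x - f y) / (x - y))" using y by (intro d(2)) (auto simp: dist_real_def)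
      moreover have "(f x - f y) / (x - y) = Q y"
        unfolding Q_def by (metis minus_diff_eq minus_divide_divide)
      ultimately show ?thesis by simp
    next
      case False
      then show ?thesis unfolding Q_def using y by (intro d(2)) (auto simp: dist_real_def)
    qed
  qed (use d in auto)
  have b: "\<forall>\<^sub>F y in at x. \<bar>Q y\<bar> < M"
  proof (rule ev[OF bnd(1)])
    fix u v assume "u < v" "u \<le> x" "x \<le> v" "v - u < d0"
    then show "\<bar>(f v - f u) / (v - u)\<bar> < M"
      using bnd(2)[of u v] by (simp add: field_simps)
  qed
  define A where "A = {p. \<forall>\<^sub>F y in at x. Q y > p}"
  have "- M \<in> A" using b unfolding A_def by (auto elim: eventually_mono)
  have ub: "p \<le> M" if "p \<in> A" for p
  proof (rule ccontr)
    assume "\<not> p \<le> M"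
    have "\<forall>\<^sub>F y in at x. p < Q y \<and> \<bar>Q y\<bar> < M"
      using that b by (auto simp: A_def intro: eventually_conj)
    then have "\<forall>\<^sub>F y in at x. False" by eventually_elim (use \<open>\<not> p \<le> M\<close> in auto)
    then show False by simp
  qed
  have bdd: "bdd_above A" using ub by (rule bdd_aboveI)
  have "(Q \<longlongrightarrow> Sup A) (at x)"
  proof (rule order_tendstoI)
    fix c assume "c < Sup A"
    then obtain p where "p \<in> A" "c < p" using \<open>- M \<in> A\<close> less_cSupD by blast
    then show "\<forall>\<^sub>F y in at x. c < Q y" by (auto simp: A_def elim: eventually_mono)
  next
    fix c assume "Sup A < c"
    then obtain q where q: "q \<in> \<rat>" "Sup A < q" "q < c" using Rats_dense_in_real by blast
    then obtain p where p: "p \<in> \<rat>" "Sup A < p" "p < q" using Rats_dense_in_real by blast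
    have "p \<notin> A" using p(2) bdd by (meson cSup_upper not_le)
    obtain d where d: "d > 0" "(\<forall>u v. u < v \<and> u \<le> x \<and> x \<le> v \<and> v - u < d \<longrightarrow> f v - f u > p * (v - u)) \<or>
      (\<forall>u v. u < v \<and> u \<le> x \<and> x \<le> v \<and> v - u < d \<longrightarrow> f v - f u < q * (v - u))"
      using gap[OF p(1) q(1) p(3)] by blast
    show "\<forall>\<^sub>F y in at x. Q y < c"
    proof (cases "\<forall>u v. u < v \<and> u \<le> x \<and> x \<le> v \<and> v - u < d \<longrightarrow> f v - f u > p * (v - u)")
      case True
      have "\<forall>\<^sub>F y in at x. Q y > p"
        by (rule ev[OF d(1)]) (use True in \<open>auto simp: pos_less_divide_eq\<close>)
      then show ?thesis using \<open>p \<notin> A\<close> by (simp add: A_def)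
    next
      case False
      then have *: "\<forall>u v. u < v \<and> u \<le> x \<and> x \<le> v \<and> v - u < d \<longrightarrow> f v - f u < q * (v - u)"
        using d(2) by blast
      have "\<forall>\<^sub>F y in at x. Q y < q"
        by (rule ev[OF d(1)]) (use * in \<open>auto simp: pos_divide_less_eq\<close>)
      then show ?thesis by eventually_elim (use q in auto)
    qed
  qed
  then have "(f has_field_derivative Sup A) (at x)"
    unfolding has_field_derivative_iff Q_def .
  then show ?thesis using field_differentiable_def field_differentiable_imp_differentiable by blast
qed

text \<open>A point without derivative has unbounded slopes or a slope gap for some pair of
  rationals; these are countably many null sets.\<close>

lemma absolutely_continuous_on_real_differentiable_ae:
  fixes f :: "real \<Rightarrow> real"
  assumes ac: "absolutely_continuous_on a b f"
  shows "negligible {x \<in> {a<..<b}. \<not> f differentiable (at x)}"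
proof -
  define I where "I x d u v \<longleftrightarrow> u < v \<and> u \<le> x \<and> x \<le> v \<and> v - u < d" for x d u v :: real
  define E0 where "E0 = {x \<in> {a<..<b}. \<forall>d>0. \<forall>q. \<exists>u v. I x d u v \<and> \<bar>f v - f u\<bar> \<ge> q * (v - u)}"
  define E where "E p q = {x \<in> {a<..<b}. \<forall>d>0. (\<exists>u v. I x d u v \<and> f v - f u \<le> p * (v - u)) \<and>
    (\<exists>u v. I x d u v \<and> f v - f u \<ge> q * (v - u))}" for p q
  have "negligible E0"
    by (rule negligible_slope_unbounded[OF ac]) (auto simp: E0_def I_def)
  have nE: "negligible (E p q)" if "p < q" for p q
    by (rule negligible_slope_gap[OF ac that]) (auto simp: E_def I_def)
  define R where "R = {(p::real, q). p \<in> \<rat> \<and> q \<in> \<rat> \<and> p < q}"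
  have "countable R"
    by (rule countable_subset[of _ "\<rat> \<times> \<rat>"]) (auto simp: R_def countable_rat)
  then have "negligible (\<Union>r\<in>R. E (fst r) (snd r))"
    using nE by (intro negligible_countable_Union) (auto simp: R_def)
  then have "negligible (E0 \<union> (\<Union>r\<in>R. E (fst r) (snd r)))"
    using \<open>negligible E0\<close> negligible_Un by blast
  then show ?thesis
  proof (rule negligible_subset)
    show "{x \<in> {a<..<b}. \<not> f differentiable (at x)} \<subseteq> E0 \<union> (\<Union>r\<in>R. E (fst r) (snd r))"
    proof (rule ccontr)
      assume "\<not> {x \<in> {a<..<b}. \<not> f differentiable (at x)} \<subseteq> E0 \<union> (\<Union>r\<in>R. E (fst r) (snd r))"
      then obtain x where x: "x \<in> {a<..<b}" "\<not> f differentiable (at x)" "x \<notin> E0"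
        "x \<notin> (\<Union>r\<in>R. E (fst r) (snd r))" by blast
      obtain d0 q0 where "d0 > 0" "\<And>u v. I x d0 u v \<Longrightarrow> \<not> \<bar>f v - f u\<bar> \<ge> q0 * (v - u)"
        using x(1,3) unfolding E0_def by blast
      then have 1: "\<bar>f v - f u\<bar> < q0 * (v - u)" if "u < v" "u \<le> x" "x \<le> v" "v - u < d0" for u v
        using that unfolding I_def by (meson not_le)
      have 2: "\<exists>d>0.
        (\<forall>u v. u < v \<and> u \<le> x \<and> x \<le> v \<and> v - u < d \<longrightarrow> f v - f u > p * (v - u)) \<or>
        (\<forall>u v. u < v \<and> u \<le> x \<and> x \<le> v \<and> v - u < d \<longrightarrow> f v - f u < q * (v - u))"
        if "p \<in> \<rat>" "q \<in> \<rat>" "p < q" for p q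
      proof -
        have "(p, q) \<in> R" using that by (simp add: R_def)
        then have "x \<notin> E p q" using x(4) by force
        then obtain d where d: "d > 0" "\<not> ((\<exists>u v. I x d u v \<and> f v - f u \<le> p * (v - u)) \<and>
            (\<exists>u v. I x d u v \<and> f v - f u \<ge> q * (v - u)))"
          using x(1) unfolding E_def by blast
        from d(2) have "(\<forall>u v. I x d u v \<longrightarrow> f v - f u > p * (v - u)) \<or>
            (\<forall>u v. I x d u v \<longrightarrow> f v - f u < q * (v - u))"
          by (metis not_le)
        with d(1) show ?thesis unfolding I_def by blast
      qed
      have "f differentiable (at x)"
        by (rule real_differentiable_slopes[OF \<open>d0 > 0\<close> 1 2])
      then show False using x(2) by blast
    qed
  qed
qed

lemma absolutely_continuous_on_lipschitz_image:
  assumes "absolutely_continuous_on a b \<sigma>" "C \<ge> 0"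
    and le: "\<And>s t. \<lbrakk>a \<le> s; s \<le> t; t \<le> b\<rbrakk> \<Longrightarrow> dist (\<phi> s) (\<phi> t) \<le> C * dist (\<sigma> s) (\<sigma> t)"
  shows "absolutely_continuous_on a b \<phi>"
  unfolding absolutely_continuous_on_def
proof (intro allI impI)
  fix e :: real assume e: "e > 0"
  then have "e / (C + 1) > 0" using assms(2) by simp
  then obtain d where d: "d > 0" "\<forall>(m::nat) s t. (\<forall>i<m. a \<le> s i \<and> s i \<le> t i \<and> t i \<le> b) \<longrightarrow>
          (\<forall>i<m. \<forall>j<m. i \<noteq> j \<longrightarrow> {s i<..<t i} \<inter> {s j<..<t j} = {}) \<longrightarrow>
          (\<Sum>i<m. t i - s i) < d \<longrightarrow> (\<Sum>i<m. dist (\<sigma> (s i)) (\<sigma> (t i))) < e / (C + 1)"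
    by (rule absolutely_continuous_onD[OF assms(1)])
  have "(\<Sum>i<m. dist (\<phi> (s i)) (\<phi> (t i))) < e"
    if st: "\<forall>i<m. a \<le> s i \<and> s i \<le> t i \<and> t i \<le> b"
      "\<forall>i<m. \<forall>j<m. i \<noteq> j \<longrightarrow> {s i<..<t i} \<inter> {s j<..<t j} = {}"
      "(\<Sum>i<m. t i - s i) < d" for m :: nat and s t
  proof -
    have 1: "(\<Sum>i<m. dist (\<sigma> (s i)) (\<sigma> (t i))) < e / (C + 1)"
      by (rule d(2)[THEN spec, THEN spec, THEN spec, THEN mp, THEN mp, THEN mp, OF st])
    have "(\<Sum>i<m. dist (\<phi> (s i)) (\<phi> (t i))) \<le> (\<Sum>i<m. C * dist (\<sigma> (s i)) (\<sigma> (t i)))"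
      using st(1) by (intro sum_mono le) auto
    also have "\<dots> = C * (\<Sum>i<m. dist (\<sigma> (s i)) (\<sigma> (t i)))" by (simp add: sum_distrib_left)
    also have "\<dots> \<le> C * (e / (C + 1))" using 1 assms(2) by (intro mult_left_mono) auto
    also have "\<dots> < e" using e assms(2) by (simp add: field_simps)
    finally show ?thesis .
  qed
  with d(1) show "\<exists>\<delta>>0. \<forall>(m::nat) s t. (\<forall>i<m. a \<le> s i \<and> s i \<le> t i \<and> t i \<le> b) \<longrightarrow>
          (\<forall>i<m. \<forall>j<m. i \<noteq> j \<longrightarrow> {s i<..<t i} \<inter> {s j<..<t j} = {}) \<longrightarrow>
          (\<Sum>i<m. t i - s i) < \<delta> \<longrightarrow> (\<Sum>i<m. dist (\<phi> (s i)) (\<phi> (t i))) < e"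
    by (intro exI[of _ d]) simp
qed

lemma absolutely_continuous_on_differentiable_ae:
  fixes f :: "real \<Rightarrow> 'a::euclidean_space"
  assumes ac: "absolutely_continuous_on a b f"
  shows "negligible {x \<in> {a<..<b}. \<not> f differentiable (at x)}"
proof -
  have "absolutely_continuous_on a b (\<lambda>x. f x \<bullet> i)" if "i \<in> Basis" for i
    using that by (intro absolutely_continuous_on_lipschitz_image[OF ac, of 1])
      (auto simp: dist_real_def dist_norm inner_diff_left[symmetric] Basis_le_norm)
  then have "negligible (\<Union>i\<in>Basis. {x \<in> {a<..<b}. \<not> (\<lambda>x. f x \<bullet> i) differentiable (at x)})"
    using absolutely_continuous_on_real_differentiable_ae by (intro negligible_Union) auto
  then show ?thesis
    by (rule negligible_subset) (auto simp: differentiable_componentwise_within[of f])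
qed

section \<open>The fundamental theorem of calculus for absolutely continuous functions\<close>

lemma sets_lebesgue_negligible_outer_open:
  fixes N :: "'a::euclidean_space set"
  assumes "negligible N" "e > 0"
  obtains U where "open U" "N \<subseteq> U" "U \<in> lmeasurable" "measure lebesgue U < e"
proof -
  have N: "N \<in> lmeasurable" using assms(1) negligible_imp_measurable by blast
  obtain U where U: "open U" "N \<subseteq> U" "U - N \<in> lmeasurable" "emeasure lebesgue (U - N) < ennreal e"
    using sets_lebesgue_outer_open[OF fmeasurableD[OF N] assms(2)] by blast
  have UN: "U = (U - N) \<union> N" using U(2) by blast
  have l: "U \<in> lmeasurable" using fmeasurable.Un[OF U(3) N] UN by simp
  have "measure lebesgue (U - N) < e"
    using U(3,4) assms(2) by (simp add: emeasure_eq_measure2 ennreal_less_iff)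
  moreover have "measure lebesgue U \<le> measure lebesgue (U - N) + measure lebesgue N"
    using measure_Un_le[OF fmeasurableD[OF U(3)] fmeasurableD[OF N]] UN by simp
  ultimately have "measure lebesgue U < e" using negligible_imp_measure0[OF assms(1)] by simp
  with U(1,2) l that show thesis by blast
qed

text \<open>Off \<open>N\<close> the gauge makes the linear approximation accurate up to
  \<open>e1\<close> times the length. On \<open>N\<close> it keeps the intervals inside an open set
  of measure below \<open>d\<close>, where \<open>m\<close> contributes nothing and absolute
  continuity makes the increments small. With the Henstock-Kurzweil integral, integrability is part
  of the conclusion.\<close>

lemma absolutely_continuous_on_has_integral:
  fixes \<phi> m :: "real \<Rightarrow> real"
  assumes ac: "absolutely_continuous_on a b \<phi>" and "a \<le> b" and N: "negligible N"
    and der: "\<And>t. t \<in> {a..b} - N \<Longrightarrow> (\<phi> has_real_derivative m t) (at t)"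
    and zero: "\<And>t. t \<in> N \<Longrightarrow> m t = 0"
  shows "(m has_integral (\<phi> b - \<phi> a)) {a..b}"
proof -
  have "\<exists>\<gamma>. gauge \<gamma> \<and> (\<forall>p. p tagged_division_of cbox a b \<and> \<gamma> fine p \<longrightarrow>
        norm ((\<Sum>(x, K)\<in>p. measure lborel K *\<^sub>R m x) - (\<phi> b - \<phi> a)) < e)" if "e > 0" for e
  proof -
    define e1 where "e1 = e / (2 * (b - a + 1))"
    have e1: "e1 > 0" "e1 * (b - a) \<le> e / 2"
      using \<open>e > 0\<close> \<open>a \<le> b\<close> by (auto simp: e1_def field_simps)
    obtain d where d: "d > 0" "\<forall>D. D division_of \<Union>D \<longrightarrow> \<Union>D \<subseteq> {a..b} \<longrightarrow> sum (measure lebesgue) D < d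
      \<longrightarrow> (\<Sum>K\<in>D. dist (\<phi> (Inf K)) (\<phi> (Sup K))) < e / 2"
      by (rule absolutely_continuous_on_division[OF ac half_gt_zero[OF \<open>e > 0\<close>]])
    obtain U where U: "open U" "N \<subseteq> U" "U \<in> lmeasurable" "measure lebesgue U < d"
      by (rule sets_lebesgue_negligible_outer_open[OF N d(1)])
    have "\<exists>r>0. (t \<in> {a..b} - N \<longrightarrow> (\<forall>y. \<bar>y - t\<bar> < r \<longrightarrow> \<bar>\<phi> y - \<phi> t - m t * (y - t)\<bar> \<le> e1 * \<bar>y - t\<bar>))
        \<and> (t \<in> N \<longrightarrow> ball t r \<subseteq> U)" for t
    proof (cases "t \<in> N")
      case True
      then show ?thesis using U(1,2) by (meson DiffD2 open_contains_ball subsetD)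
    next
      case False
      show ?thesis
      proof (cases "t \<in> {a..b}")
        case True
        have "(\<phi> has_derivative (\<lambda>h. m t * h)) (at t)"
          using der[of t] True False by (auto simp: has_field_derivative_def mult.commute[of _ "m t"])
        from has_derivative_at_alt[THEN iffD1, OF this] e1(1)
        show ?thesis using False by (auto simp: real_norm_def)
      qed (use False in \<open>auto intro: exI[of _ 1]\<close>)
    qed
    then obtain r where r: "\<And>t. r t > 0"
      "\<And>t y. \<lbrakk>t \<in> {a..b} - N; \<bar>y - t\<bar> < r t\<rbrakk> \<Longrightarrow> \<bar>\<phi> y - \<phi> t - m t * (y - t)\<bar> \<le> e1 * \<bar>y - t\<bar>"
      "\<And>t. t \<in> N \<Longrightarrow> ball t (r t) \<subseteq> U" by metis
    have "norm ((\<Sum>(x, K)\<in>p. measure lborel K *\<^sub>R m x) - (\<phi> b - \<phi> a)) < e"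
      if p: "p tagged_division_of {a..b}" "(\<lambda>t. ball t (r t)) fine p" for p
    proof -
      note tp = tagged_division_ofD[OF p(1)]
      have K: "x \<in> K \<and> K \<subseteq> {a..b} \<and> K \<subseteq> ball x (r x) \<and> K = {Inf K..Sup K} \<and> Inf K \<le> Sup K \<and>
          measure lborel K = Sup K - Inf K" if xK: "(x, K) \<in> p" for x K
      proof -
        obtain u v where uv: "K = {u..v}" using tp(4)[OF xK] by auto
        have "x \<in> K" "K \<subseteq> {a..b}" "K \<subseteq> ball x (r x)"
          using tp(2,3)[OF xK] fineD[OF p(2) xK] by auto
        moreover have "u \<le> v" using \<open>x \<in> K\<close> uv by simp
        ultimately show ?thesis using uv by simp
      qed
      let ?g = "\<lambda>(x, K). measure lborel K *\<^sub>R m x - (\<phi> (Sup K) - \<phi> (Inf K))"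
      define p1 where "p1 = {(x, K) \<in> p. x \<notin> N}"
      define p2 where "p2 = {(x, K) \<in> p. x \<in> N}"
      have pu: "p = p1 \<union> p2" "p1 \<inter> p2 = {}" by (auto simp: p1_def p2_def)
      have fin: "finite p1" "finite p2" using tp(1) pu(1) by auto
      have "(\<Sum>(x, K)\<in>p. measure lborel K *\<^sub>R m x) - (\<phi> b - \<phi> a) = sum ?g p"
        using additive_tagged_division_1[OF \<open>a \<le> b\<close> p(1), of \<phi>]
        by (simp add: sum_subtractf case_prod_unfold)
      also have "\<dots> = sum ?g p1 + sum ?g p2"
        unfolding pu(1) using fin pu(2) by (rule sum.union_disjoint)
      finally have eq: "(\<Sum>(x, K)\<in>p. measure lborel K *\<^sub>R m x) - (\<phi> b - \<phi> a) = sum ?g p1 + sum ?g p2" .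
      have "\<bar>sum ?g p1\<bar> \<le> (\<Sum>(x, K)\<in>p1. e1 * measure lborel K)"
      proof (rule order_trans[OF sum_abs sum_mono], clarify)
        fix x K assume xK: "(x, K) \<in> p1"
        then have xp: "(x, K) \<in> p" "x \<notin> N" by (auto simp: p1_def)
        note k = K[OF xp(1)]
        have x: "x \<in> {a..b} - N" using k xp by blast
        have i: "Inf K \<in> K" "Sup K \<in> K" using k by (metis atLeastAtMost_iff order_refl)+
        have "\<bar>\<phi> (Inf K) - \<phi> x - m x * (Inf K - x)\<bar> \<le> e1 * \<bar>Inf K - x\<bar>"
          using i k by (intro r(2)[OF x]) (auto simp: dist_real_def)
        moreover have "\<bar>\<phi> (Sup K) - \<phi> x - m x * (Sup K - x)\<bar> \<le> e1 * \<bar>Sup K - x\<bar>"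
          using i k by (intro r(2)[OF x]) (auto simp: dist_real_def)
        moreover have "Inf K \<le> x" "x \<le> Sup K" using k by (metis atLeastAtMost_iff)+
        ultimately have "\<bar>m x * (Sup K - Inf K) - (\<phi> (Sup K) - \<phi> (Inf K))\<bar> \<le> e1 * (Sup K - Inf K)"
          by (simp add: algebra_simps abs_le_iff)
        then show "\<bar>measure lborel K *\<^sub>R m x - (\<phi> (Sup K) - \<phi> (Inf K))\<bar> \<le> e1 * measure lborel K"
          using k by (simp add: mult.commute)
      qed
      also have "\<dots> \<le> (\<Sum>(x, K)\<in>p. e1 * measure lborel K)"
        using e1(1) tp(1) by (intro sum_mono2) (auto simp: p1_def)
      also have "\<dots> = e1 * (b - a)"
        using additive_content_tagged_division[of p a b] p(1) \<open>a \<le> b\<close>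
        by (simp add: sum_distrib_left[symmetric] case_prod_unfold)
      finally have s1: "\<bar>sum ?g p1\<bar> \<le> e / 2" using e1(2) by linarith
      have p2s: "p2 \<subseteq> p" by (auto simp: p2_def)
      have tpd: "p2 tagged_partial_division_of {a..b}"
        using tagged_partial_division_subset[OF tagged_division_of_def[THEN iffD1, OF p(1), THEN conjunct1] p2s] .
      define D where "D = snd ` p2"
      have divD: "D division_of \<Union>D"
        unfolding D_def by (rule partial_division_of_tagged_division[OF tpd])
      have DU: "\<Union>D \<subseteq> U"
      proof
        fix y assume "y \<in> \<Union>D"
        then obtain x K where xK: "(x, K) \<in> p" "x \<in> N" "y \<in> K" by (auto simp: D_def p2_def)
        then have "y \<in> ball x (r x)" using K[OF xK(1)] by blast
        then show "y \<in> U" using r(3)[OF xK(2)] by blast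
      qed
      have "\<Union>D \<in> lmeasurable"
      proof (rule fmeasurable.finite_Union)
        show "finite D" using divD by (rule division_of_finite)
        show "D \<subseteq> lmeasurable" using division_ofD(4)[OF divD] lmeasurable_cbox by blast
      qed
      then have "measure lebesgue (\<Union>D) \<le> measure lebesgue U"
        using DU U(3) by (intro measure_mono_fmeasurable) (auto simp: fmeasurableD)
      moreover have "sum (measure lebesgue) D = measure lebesgue (\<Union>D)"
        using content_division[OF divD] by simp
      ultimately have "sum (measure lebesgue) D < d" using U(4) by simp
      moreover have "\<Union>D \<subseteq> {a..b}" using tp(3) p2s unfolding D_def by fastforce
      ultimately have sD: "(\<Sum>K\<in>D. dist (\<phi> (Inf K)) (\<phi> (Sup K))) < e / 2" using d(2) divD by blast
      have "p2 tagged_division_of \<Union>D"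
        unfolding D_def by (rule tagged_partial_division_of_Union_self[OF tpd])
      \<comment> \<open>Passing from the tagged intervals to the set of intervals calls for a
        function that vanishes on boxes with empty interior. The empty box is given the value 0
        separately, since \<open>Inf {}\<close> carries no information.\<close>
      moreover define \<delta> where "\<delta> K = (if K = {} then 0 else dist (\<phi> (Inf K)) (\<phi> (Sup K)))" for K :: "real set"
      have "\<delta> (cbox u v) = 0" if "box u v = {}" for u v :: real
        using that by (cases "u = v") (auto simp: \<delta>_def box_eq_empty)
      ultimately have "(\<Sum>(x, K)\<in>p2. \<delta> K) = sum \<delta> D"
        unfolding D_def by (rule sum.over_tagged_division_lemma)
      moreover have "sum \<delta> D = (\<Sum>K\<in>D. dist (\<phi> (Inf K)) (\<phi> (Sup K)))"
        using division_ofD(3)[OF divD] by (intro sum.cong) (auto simp: \<delta>_def)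
      moreover have "(\<Sum>(x, K)\<in>p2. \<delta> K) = (\<Sum>(x, K)\<in>p2. dist (\<phi> (Inf K)) (\<phi> (Sup K)))"
      proof (rule sum.cong[OF refl], clarify)
        fix x K assume "(x, K) \<in> p2"
        then have "K \<noteq> {}" using K p2s by blast
        then show "\<delta> K = dist (\<phi> (Inf K)) (\<phi> (Sup K))" by (simp add: \<delta>_def)
      qed
      ultimately have "(\<Sum>(x, K)\<in>p2. dist (\<phi> (Inf K)) (\<phi> (Sup K))) < e / 2" using sD by simp
      moreover have "\<bar>sum ?g p2\<bar> \<le> (\<Sum>(x, K)\<in>p2. dist (\<phi> (Inf K)) (\<phi> (Sup K)))"
      proof (rule order_trans[OF sum_abs sum_mono], clarify)
        fix x K assume "(x, K) \<in> p2"
        then have "m x = 0" using zero by (auto simp: p2_def)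
        then show "\<bar>measure lborel K *\<^sub>R m x - (\<phi> (Sup K) - \<phi> (Inf K))\<bar> \<le> dist (\<phi> (Inf K)) (\<phi> (Sup K))"
          by (simp add: dist_real_def)
      qed
      ultimately show ?thesis using eq s1 by simp
    qed
    moreover have "gauge (\<lambda>t. ball t (r t))" using r(1) by (rule gauge_ball_dependent[rule_format])
    ultimately show ?thesis by (intro exI[of _ "\<lambda>t. ball t (r t)"]) auto
  qed
  then have "(m has_integral (\<phi> b - \<phi> a)) (cbox a b)"
    unfolding has_integral by blast
  then show ?thesis by simp
qed

text \<open>No measurability of \<open>g\<close> is available, so its integral is bounded below by
  that of \<open>\<bar>m\<bar> / B\<close>, which is measurable because \<open>m\<close> is
  Henstock-Kurzweil integrable. If \<open>\<bar>m\<bar>\<close> has infinite integral the claim is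
  trivial; otherwise \<open>m\<close> is Lebesgue integrable and both integrals agree.\<close>

lemma absolutely_continuous_on_diff_le_nn_integral:
  fixes \<phi> :: "real \<Rightarrow> real" and g :: "real \<Rightarrow> ennreal"
  assumes ac: "absolutely_continuous_on a b \<phi>" and "a \<le> b" "B > 0" and N: "negligible N"
    and der: "\<And>t. t \<in> {a<..<b} - N \<Longrightarrow> \<exists>m. (\<phi> has_real_derivative m) (at t) \<and> ennreal (\<bar>m\<bar> / B) \<le> g t"
  shows "ennreal \<bar>\<phi> b - \<phi> a\<bar> \<le> ennreal B * (\<integral>\<^sup>+ t \<in> {a..b}. g t \<partial>lebesgue)"
proof -
  \<comment> \<open>The endpoints join the null set because \<open>der\<close> speaks of interior
    points only.\<close>
  define N' where "N' = N \<union> {a, b}"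
  have N': "negligible N'" using N by (simp add: N'_def negligible_Un)
  define m where "m t = (if t \<in> {a..b} - N' then deriv \<phi> t else 0)" for t
  have dm: "(\<phi> has_real_derivative m t) (at t) \<and> ennreal (\<bar>m t\<bar> / B) \<le> g t" if "t \<in> {a..b} - N'" for t
  proof -
    have "t \<in> {a<..<b} - N" using that by (auto simp: N'_def)
    from der[OF this] obtain k where k: "(\<phi> has_real_derivative k) (at t)" "ennreal (\<bar>k\<bar> / B) \<le> g t" by blast
    then have "m t = k" using that by (simp add: m_def DERIV_imp_deriv)
    then show ?thesis using k by simp
  qed
  have hi: "(m has_integral (\<phi> b - \<phi> a)) {a..b}"
    using dm by (intro absolutely_continuous_on_has_integral[OF ac \<open>a \<le> b\<close> N']) (auto simp: m_def)
  have mm: "m \<in> borel_measurable (lebesgue_on {a..b})"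
    by (rule integrable_imp_measurable) (use hi in blast)
  define M where "M t = indicator {a..b} t *\<^sub>R m t" for t
  have Meq: "M = (\<lambda>t. indicator {a..b} t *\<^sub>R m t)" by (simp only: M_def[abs_def])
  have mm' [measurable]: "M \<in> borel_measurable lebesgue"
    unfolding M_def using mm by (subst (asm) borel_measurable_restrict_space_iff) auto
  have le0: "(\<integral>\<^sup>+ t. ennreal (\<bar>M t\<bar> / B) \<partial>lebesgue) \<le> (\<integral>\<^sup>+ t \<in> {a..b}. g t \<partial>lebesgue)"
  proof (rule nn_integral_mono)
    fix t :: real
    show "ennreal (\<bar>M t\<bar> / B) \<le> g t * indicator {a..b} t"
      using dm[of t] by (cases "t \<in> {a..b} - N'") (auto simp: m_def M_def indicator_def)
  qed
  have eq0: "ennreal B * (\<integral>\<^sup>+ t. ennreal (\<bar>M t\<bar> / B) \<partial>lebesgue)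
      = (\<integral>\<^sup>+ t. ennreal \<bar>M t\<bar> \<partial>lebesgue)"
  proof -
    have "ennreal B * (\<integral>\<^sup>+ t. ennreal (\<bar>M t\<bar> / B) \<partial>lebesgue)
      = (\<integral>\<^sup>+ t. ennreal B * ennreal (\<bar>M t\<bar> / B) \<partial>lebesgue)"
      by (rule nn_integral_cmult[symmetric]) measurable
    also have "\<dots> = (\<integral>\<^sup>+ t. ennreal \<bar>M t\<bar> \<partial>lebesgue)"
      using \<open>B > 0\<close> by (intro nn_integral_cong) (simp add: ennreal_mult[symmetric])
    finally show ?thesis .
  qed
  have le: "(\<integral>\<^sup>+ t. ennreal \<bar>M t\<bar> \<partial>lebesgue) \<le> ennreal B * (\<integral>\<^sup>+ t \<in> {a..b}. g t \<partial>lebesgue)"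
    unfolding eq0[symmetric] by (rule mult_left_mono[OF le0]) simp
  show ?thesis
  proof (cases "(\<integral>\<^sup>+ t. ennreal \<bar>M t\<bar> \<partial>lebesgue) = \<infinity>")
    case True
    then show ?thesis using le by (simp add: top_unique)
  next
    case False
    then have int: "integrable lebesgue M"
      using mm' by (intro integrableI_bounded) (auto simp: less_top)
    then have "set_integrable lebesgue {a..b} m" by (simp only: set_integrable_def Meq)
    from has_integral_set_lebesgue[OF this] have "(m has_integral (LINT t:{a..b}|lebesgue. m t)) {a..b}" .
    then have "\<phi> b - \<phi> a = (LINT t:{a..b}|lebesgue. m t)" using hi has_integral_unique by blast
    also have "\<dots> = integral\<^sup>L lebesgue M"
      by (simp only: set_lebesgue_integral_def Meq)
    finally have "ennreal \<bar>\<phi> b - \<phi> a\<bar> \<le> (\<integral>\<^sup>+ t. ennreal \<bar>M t\<bar> \<partial>lebesgue)"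
      using integral_norm_bound_ennreal[OF int] by simp
    then show ?thesis using le by (rule order_trans)
  qed
qed

section \<open>Second-order expansion of the defining function\<close>

text \<open>Twice the complex-linear part of a real-linear \<open>\<alpha>\<close>. For real-valued
  \<open>\<alpha>\<close> it is the complex-linear functional with real part
  \<open>\<alpha>\<close>.\<close>

definition clin :: "(complex^'n::finite \<Rightarrow> complex) \<Rightarrow> complex^'n \<Rightarrow> complex" where
  "clin \<alpha> u = \<alpha> u - \<i> * \<alpha> (\<i> *s u)"

lemma complex_vec_sum_axis:
  fixes u :: "complex^'n::finite"
  shows "u = (\<Sum>j\<in>UNIV. Re (u $ j) *\<^sub>R axis j 1 + Im (u $ j) *\<^sub>R axis j \<i>)"
    "\<i> *s u = (\<Sum>j\<in>UNIV. Re (u $ j) *\<^sub>R axis j \<i> - Im (u $ j) *\<^sub>R axis j 1)"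
  by (auto simp: vec_eq_iff axis_def complex_eq_iff if_distrib[of "\<lambda>x. Re x"] if_distrib[of "\<lambda>x. Im x"]
      if_distrib[of "\<lambda>x. _ * x"] sum_negf cong: if_cong)

lemma clin_sum_axis:
  assumes "linear \<alpha>"
  shows "clin \<alpha> u = (\<Sum>j\<in>UNIV. u $ j * (\<alpha> (axis j 1) - \<i> * \<alpha> (axis j \<i>)))"
proof -
  interpret \<alpha>: linear \<alpha> by fact
  have 1: "\<alpha> u = (\<Sum>j\<in>UNIV. of_real (Re (u $ j)) * \<alpha> (axis j 1) + of_real (Im (u $ j)) * \<alpha> (axis j \<i>))"
    by (subst complex_vec_sum_axis(1)[of u]) (simp only: \<alpha>.sum \<alpha>.add \<alpha>.scaleR scaleR_conv_of_real[where 'a=complex])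
  have 2: "\<alpha> (\<i> *s u) = (\<Sum>j\<in>UNIV. of_real (Re (u $ j)) * \<alpha> (axis j \<i>) - of_real (Im (u $ j)) * \<alpha> (axis j 1))"
    by (subst complex_vec_sum_axis(2)[of u]) (simp only: \<alpha>.sum \<alpha>.diff \<alpha>.scaleR scaleR_conv_of_real[where 'a=complex])
  have c: "u $ j = of_real (Re (u $ j)) + \<i> * of_real (Im (u $ j))" for j
    by (simp add: complex_eq_iff)
  have key: "u $ j * (\<alpha> (axis j 1) - \<i> * \<alpha> (axis j \<i>)) =
      (of_real (Re (u $ j)) * \<alpha> (axis j 1) + of_real (Im (u $ j)) * \<alpha> (axis j \<i>)) -
      \<i> * (of_real (Re (u $ j)) * \<alpha> (axis j \<i>) - of_real (Im (u $ j)) * \<alpha> (axis j 1))" for j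
    by (subst c) (simp add: algebra_simps)
  show ?thesis
    unfolding clin_def 1 2 key by (simp only: sum_subtractf[symmetric] sum_distrib_left)
qed

lemma clin_axis: "clin \<alpha> (axis j 1) = \<alpha> (axis j 1) - \<i> * \<alpha> (axis j \<i>)"
proof -
  have "\<i> *s axis j (1::complex) = (axis j \<i> :: complex^'a)"
    by (simp add: vec_eq_iff axis_def)
  then show ?thesis by (simp add: clin_def)
qed

lemma norm_i_smult [simp]: "norm (\<i> *s (u::complex^'n::finite)) = norm u"
  by (simp add: norm_vec_def norm_mult)

lemma norm_csmult: "norm (\<zeta> *s (u::complex^'n::finite)) = cmod \<zeta> * norm u"
  by (simp add: norm_vec_def norm_mult L2_set_right_distrib)

text \<open>If \<open>L\<close> is the derivative of \<open>\<rho>\<close>, this is twice the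
  (1,0)-differential of \<open>\<rho>\<close>. Its modulus measures the component of a vector in the
  complex normal direction.\<close>

definition cpart :: "((complex^'n::finite) \<Rightarrow>\<^sub>L real) \<Rightarrow> complex^'n \<Rightarrow> complex" where
  "cpart L = clin (\<lambda>u. complex_of_real (blinfun_apply L u))"

lemma linear_of_real_blinfun: "linear (\<lambda>u. complex_of_real (blinfun_apply L u))"
  by (rule linearI) (auto simp: blinfun.add_right blinfun.scaleR_right scaleR_conv_of_real)

lemma cpart_sum_axis: "cpart L u = (\<Sum>j\<in>UNIV. u $ j * cpart L (axis j 1))"
  unfolding cpart_def clin_axis by (rule clin_sum_axis[OF linear_of_real_blinfun])

lemma Re_cpart [simp]: "Re (cpart L u) = blinfun_apply L u"
  by (simp add: cpart_def clin_def)

lemma cpart_add: "cpart L (u + v) = cpart L u + cpart L v"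
  unfolding cpart_sum_axis[of L "u + v"] cpart_sum_axis[of L u] cpart_sum_axis[of L v]
  by (simp add: distrib_right sum.distrib)

lemma cpart_csmult: "cpart L (\<zeta> *s u) = \<zeta> * cpart L u"
  unfolding cpart_sum_axis[of L "\<zeta> *s u"] cpart_sum_axis[of L u]
  by (simp add: sum_distrib_left mult.assoc)

lemma cpart_scaleR: "cpart L (x *\<^sub>R u) = x *\<^sub>R cpart L u"
proof -
  have "x *\<^sub>R u = complex_of_real x *s u" unfolding vec_eq_iff by (simp add: scaleR_conv_of_real[symmetric])
  then show ?thesis by (simp add: cpart_csmult scaleR_conv_of_real)
qed

lemma cpart_diff_left: "cpart (L - L') u = cpart L u - cpart L' u"
  by (simp add: cpart_def clin_def blinfun.diff_left algebra_simps)

lemma norm_cpart: "cmod (cpart L u) \<le> 2 * norm L * norm u"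
proof -
  have "cmod (cpart L u) \<le> cmod (complex_of_real (L u)) + cmod (\<i> * complex_of_real (L (\<i> *s u)))"
    unfolding cpart_def clin_def by (rule norm_triangle_ineq4)
  also have "\<dots> = \<bar>L u\<bar> + \<bar>L (\<i> *s u)\<bar>" by (simp add: norm_mult)
  also have "\<dots> \<le> norm L * norm u + norm L * norm u"
    using norm_blinfun[of L u] norm_blinfun[of L "\<i> *s u"] by (intro add_mono) auto
  finally show ?thesis by (simp add: mult_ac)
qed

text \<open>The Levi form and the holomorphic part of a real quadratic form \<open>B\<close>:
  half of \<open>B u u\<close> is the sum of the first and the real part of the second.\<close>

definition levi :: "((complex^'n::finite) \<Rightarrow>\<^sub>L ((complex^'n) \<Rightarrow>\<^sub>L real)) \<Rightarrow> complex^'n \<Rightarrow> real" where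
  "levi B u = (B u u + B (\<i> *s u) (\<i> *s u)) / 4"

definition holq :: "((complex^'n::finite) \<Rightarrow>\<^sub>L ((complex^'n) \<Rightarrow>\<^sub>L real)) \<Rightarrow> complex^'n \<Rightarrow> complex^'n \<Rightarrow> complex" where
  "holq B u v = clin (\<lambda>w. cpart (B w) v) u / 4"

lemma i_i_smult [simp]: "\<i> *s (\<i> *s (u::complex^'n::finite)) = - u"
  by (simp add: vec_eq_iff mult.assoc[symmetric])

lemma half_quadratic: "blinfun_apply (blinfun_apply B u) u / 2 = levi B u + Re (holq B u u)"
  by (simp add: levi_def holq_def clin_def cpart_def field_simps)

lemma linear_cpart_left: "linear (\<lambda>w. cpart (blinfun_apply B w) v)"
  by (rule linearI)
    (simp_all add: cpart_def clin_def blinfun.add_left blinfun.add_right blinfun.scaleR_left blinfun.scaleR_right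
      scaleR_conv_of_real algebra_simps)

lemma holq_sum_axis:
  "holq B u v = (\<Sum>j\<in>UNIV. \<Sum>k\<in>UNIV. u $ j * v $ k * holq B (axis j 1) (axis k 1))"
proof -
  have "holq B u v = (\<Sum>j\<in>UNIV. u $ j * holq B (axis j 1) v)" for u
  proof -
    have "clin (\<lambda>w. cpart (B w) v) u = (\<Sum>j\<in>UNIV. u $ j * clin (\<lambda>w. cpart (B w) v) (axis j 1))"
      unfolding clin_axis by (rule clin_sum_axis[OF linear_cpart_left])
    then show ?thesis unfolding holq_def by (simp add: sum_divide_distrib)
  qed
  moreover have "holq B w v = (\<Sum>k\<in>UNIV. v $ k * holq B w (axis k 1))" for w
    unfolding holq_def clin_def cpart_sum_axis[of "B w" v] cpart_sum_axis[of "B (\<i> *s w)" v]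
    by (simp add: sum_divide_distrib sum_distrib_left sum_subtractf algebra_simps diff_divide_distrib)
  ultimately show ?thesis
    by (simp add: sum_distrib_left mult.assoc)
qed

text \<open>The iterated Wirtinger derivatives assemble to \<open>clin \<gamma> v / 4\<close>, where
  \<open>\<gamma> w\<close> is the conjugate of \<open>cpart (F2 p w) v\<close>. The mixed terms, in
  \<open>v\<close> and \<open>\<i> *s v\<close>, enter only the imaginary part.\<close>

lemma Re_levi_form:
  fixes \<rho> :: "complex^'n::finite \<Rightarrow> real"
  assumes "open U" "p \<in> U"
    and F1: "\<And>x. x \<in> U \<Longrightarrow> (\<rho> has_derivative blinfun_apply (F1 x)) (at x)"
    and F2: "\<And>x. x \<in> U \<Longrightarrow> (F1 has_derivative blinfun_apply (F2 x)) (at x)"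
  shows "Re (levi_form \<rho> p v) = levi (F2 p) v"
proof -
  let ?B = "\<lambda>w u. blinfun_apply (blinfun_apply (F2 p) w) u"
  have zb: "d_zbar \<mu> (\<lambda>z. complex_of_real (\<rho> z)) x =
      (of_real (F1 x (axis \<mu> 1)) + \<i> * of_real (F1 x (axis \<mu> \<i>))) / 2" if "x \<in> U" for \<mu> x
  proof -
    have "((\<lambda>z. complex_of_real (\<rho> z)) has_derivative (\<lambda>u. of_real (F1 x u))) (at x)"
      by (rule has_derivative_of_real[OF F1[OF that]])
    from frechet_derivative_at[OF this] show ?thesis
      unfolding d_zbar_def by metis
  qed
  have dz: "d_z \<nu> (d_zbar \<mu> (\<lambda>z. complex_of_real (\<rho> z))) p =
     ((of_real (?B (axis \<nu> 1) (axis \<mu> 1)) + \<i> * of_real (?B (axis \<nu> 1) (axis \<mu> \<i>))) -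
      \<i> * (of_real (?B (axis \<nu> \<i>) (axis \<mu> 1)) + \<i> * of_real (?B (axis \<nu> \<i>) (axis \<mu> \<i>)))) / 4" for \<mu> \<nu>
  proof -
    have a: "((\<lambda>x. complex_of_real (F1 x u)) has_derivative (\<lambda>w. of_real (?B w u))) (at p)" for u
    proof -
      have "((\<lambda>x. blinfun_apply (F1 x) u) has_derivative (\<lambda>w. ?B w u)) (at p)"
        using F2[OF \<open>p \<in> U\<close>] by (auto intro!: derivative_eq_intros simp: blinfun.bilinear_simps)
      then show ?thesis by (rule has_derivative_of_real)
    qed
    have "((\<lambda>x. (of_real (F1 x (axis \<mu> 1)) + \<i> * of_real (F1 x (axis \<mu> \<i>))) / 2) has_derivative
        (\<lambda>w. (of_real (?B w (axis \<mu> 1)) + \<i> * of_real (?B w (axis \<mu> \<i>))) / 2)) (at p)"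
      by (intro bounded_linear.has_derivative[OF bounded_linear_divide] has_derivative_add has_derivative_mult_right a)
    then have "(d_zbar \<mu> (\<lambda>z. complex_of_real (\<rho> z)) has_derivative
        (\<lambda>w. (of_real (?B w (axis \<mu> 1)) + \<i> * of_real (?B w (axis \<mu> \<i>))) / 2)) (at p)"
      by (rule has_derivative_transform_within_open[OF _ assms(1,2)]) (simp add: zb)
    from frechet_derivative_at[OF this]
    have "frechet_derivative (d_zbar \<mu> (\<lambda>z. complex_of_real (\<rho> z))) (at p) =
      (\<lambda>w. (of_real (?B w (axis \<mu> 1)) + \<i> * of_real (?B w (axis \<mu> \<i>))) / 2)" by simp
    then show ?thesis unfolding d_z_def by (simp add: field_simps)
  qed
  define \<gamma> where "\<gamma> w = cnj (cpart (F2 p w) v)" for w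
  have lin: "linear \<gamma>"
  proof (rule linearI)
    interpret l: linear "\<lambda>w. cpart (blinfun_apply (F2 p) w) v" by (rule linear_cpart_left)
    show "\<gamma> (x + y) = \<gamma> x + \<gamma> y" for x y unfolding \<gamma>_def by (subst l.add) simp
    show "\<gamma> (c *\<^sub>R x) = c *\<^sub>R \<gamma> x" for c x unfolding \<gamma>_def by (subst l.scaleR) simp
  qed
  have g: "\<gamma> w = (\<Sum>\<mu>\<in>UNIV. (of_real (?B w (axis \<mu> 1)) + \<i> * of_real (?B w (axis \<mu> \<i>))) * cnj (v $ \<mu>))" for w
    unfolding \<gamma>_def cpart_def clin_sum_axis[OF linear_of_real_blinfun]
    by (simp add: mult.commute)
  have "levi_form \<rho> p v = (\<Sum>\<nu>\<in>UNIV. v $ \<nu> * (\<gamma> (axis \<nu> 1) - \<i> * \<gamma> (axis \<nu> \<i>))) / 4"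
    unfolding levi_form_def dz g
    by (simp add: sum_divide_distrib sum_distrib_left sum_subtractf[symmetric] algebra_simps diff_divide_distrib add_divide_distrib)
  also have "\<dots> = clin \<gamma> v / 4" unfolding clin_sum_axis[OF lin] ..
  finally have eq: "levi_form \<rho> p v = clin \<gamma> v / 4" .
  have "Re (clin \<gamma> v) = ?B v v + ?B (\<i> *s v) (\<i> *s v)"
    by (simp add: clin_def \<gamma>_def cpart_def)
  then show ?thesis by (simp add: eq levi_def)
qed

section \<open>Uniform constants of a strongly pseudoconvex domain\<close>

lemma second_order_lower:
  fixes \<phi> :: "real \<Rightarrow> real"
  assumes "\<And>t. \<lbrakk>0 \<le> t; t \<le> 1\<rbrakk> \<Longrightarrow> (\<phi> has_real_derivative \<phi>' t) (at t)"
    and "\<And>t. \<lbrakk>0 \<le> t; t \<le> 1\<rbrakk> \<Longrightarrow> (\<phi>' has_real_derivative \<phi>'' t) (at t)"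
    and "\<And>t. \<lbrakk>0 \<le> t; t \<le> 1\<rbrakk> \<Longrightarrow> \<phi>'' t \<ge> m"
  shows "\<phi> 1 \<ge> \<phi> 0 + \<phi>' 0 + m / 2"
proof -
  have 1: "\<phi>' 0 + m * t \<le> \<phi>' t" if t: "0 \<le> t" "t \<le> 1" for t
  proof -
    have "\<phi>' 0 - m * 0 \<le> \<phi>' t - m * t"
    proof (rule DERIV_nonneg_imp_nondecreasing[OF t(1)])
      fix x assume "0 \<le> x" "x \<le> t"
      then have "((\<lambda>x. \<phi>' x - m * x) has_real_derivative (\<phi>'' x - m)) (at x)"
        using t by (auto intro!: derivative_eq_intros assms(2))
      then show "\<exists>y. ((\<lambda>x. \<phi>' x - m * x) has_real_derivative y) (at x) \<and> 0 \<le> y"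
        using assms(3)[of x] \<open>0 \<le> x\<close> \<open>x \<le> t\<close> t by auto
    qed
    then show ?thesis by simp
  qed
  have "\<phi> 0 - \<phi>' 0 * 0 - m * 0\<^sup>2 / 2 \<le> \<phi> 1 - \<phi>' 0 * 1 - m * 1\<^sup>2 / 2"
  proof (rule DERIV_nonneg_imp_nondecreasing[OF zero_le_one])
    fix x :: real assume x: "0 \<le> x" "x \<le> 1"
    then have "((\<lambda>x. \<phi> x - \<phi>' 0 * x - m * x\<^sup>2 / 2) has_real_derivative (\<phi>' x - \<phi>' 0 - m * x)) (at x)"
      by (auto intro!: derivative_eq_intros assms(1))
    then show "\<exists>y. ((\<lambda>x. \<phi> x - \<phi>' 0 * x - m * x\<^sup>2 / 2) has_real_derivative y) (at x) \<and> 0 \<le> y"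
      using 1[OF x] by (intro exI[of _ "\<phi>' x - \<phi>' 0 - m * x"]) auto
  qed
  then show ?thesis by simp
qed

text \<open>The quantitative consequences of compactness on which all later estimates rest.
  \<open>M\<close> bounds sizes and Lipschitz constants, \<open>r\<close> is a radius for the
  expansions, \<open>h\<^sub>0\<close> the thickness of a boundary collar; \<open>g\<close> bounds
  the gradient from below there, and \<open>c\<close> the quadratic gain that remains beside the
  real part of a holomorphic polynomial.\<close>

locale spd =
  fixes \<Omega> :: "(complex^'n::finite) set" and \<rho> :: "complex^'n \<Rightarrow> real"
    and F1 :: "complex^'n \<Rightarrow> (complex^'n) \<Rightarrow>\<^sub>L real"
    and F2 :: "complex^'n \<Rightarrow> (complex^'n) \<Rightarrow>\<^sub>L ((complex^'n) \<Rightarrow>\<^sub>L real)"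
    and M r h\<^sub>0 g c :: real
  assumes open_dom: "open \<Omega>" and conn: "connected \<Omega>" and ne: "\<Omega> \<noteq> {}"
    and csts: "1 \<le> M" "0 < r" "r \<le> 1" "0 < h\<^sub>0" "0 < g" "0 < c"
    and norm_le: "z \<in> \<Omega> \<Longrightarrow> norm z \<le> M"
    and neg: "z \<in> \<Omega> \<Longrightarrow> \<rho> z < 0"
    and inside: "\<lbrakk>z \<in> \<Omega>; norm u \<le> r; \<rho> (z + u) < 0\<rbrakk> \<Longrightarrow> z + u \<in> \<Omega>"
    and taylor: "\<lbrakk>z \<in> \<Omega>; norm u \<le> r\<rbrakk> \<Longrightarrow> \<bar>\<rho> (z + u) - \<rho> z - F1 z u\<bar> \<le> M * (norm u)\<^sup>2"
    and F1_lip: "\<lbrakk>p \<in> \<Omega>; q \<in> \<Omega>\<rbrakk> \<Longrightarrow> norm (F1 p - F1 q) \<le> M * norm (p - q)"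
    and F1_le: "z \<in> \<Omega> \<Longrightarrow> norm (F1 z) \<le> M"
    and rho_lip: "\<lbrakk>p \<in> \<Omega>; q \<in> \<Omega>\<rbrakk> \<Longrightarrow> \<bar>\<rho> p - \<rho> q\<bar> \<le> M * norm (p - q)"
    and rho_ge: "z \<in> \<Omega> \<Longrightarrow> - \<rho> z \<le> M"
    and F1_deriv: "z \<in> \<Omega> \<Longrightarrow> (\<rho> has_derivative blinfun_apply (F1 z)) (at z)"
    and F1_ge: "\<lbrakk>z \<in> \<Omega>; - \<rho> z \<le> h\<^sub>0\<rbrakk> \<Longrightarrow> g \<le> norm (F1 z)"
    and levi_ge: "\<lbrakk>z \<in> \<Omega>; - \<rho> z \<le> h\<^sub>0; norm u \<le> r\<rbrakk>
      \<Longrightarrow> \<rho> z + F1 z u + Re (holq (F2 z) u u) + c * (norm u)\<^sup>2 \<le> \<rho> (z + u)"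
    and core: "\<eta> > 0 \<Longrightarrow> compact {z \<in> \<Omega>. - \<rho> z \<ge> \<eta>}"

lemma levi_diff: "levi (B - B') u = levi B u - levi B' u"
  by (simp add: levi_def blinfun.diff_left diff_divide_distrib add_divide_distrib)

lemma abs_quadratic_le: "\<bar>blinfun_apply (blinfun_apply B u) u\<bar> \<le> norm B * (norm u)\<^sup>2"
proof -
  have "norm (blinfun_apply (blinfun_apply B u) u) \<le> norm (blinfun_apply B u) * norm u"
    by (rule norm_blinfun)
  also have "\<dots> \<le> (norm B * norm u) * norm u"
    by (intro mult_right_mono norm_blinfun) auto
  finally show ?thesis by (simp add: power2_eq_square mult.assoc)
qed

lemma abs_levi_le: "\<bar>levi B u\<bar> \<le> norm B * (norm u)\<^sup>2"
  using abs_quadratic_le[of B u] abs_quadratic_le[of B "\<i> *s u"] unfolding levi_def by simp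

lemma levi_scaleR: "levi B (t *\<^sub>R u) = t\<^sup>2 * levi B u"
proof -
  have "\<i> *s (t *\<^sub>R u) = t *\<^sub>R (\<i> *s u)" by (simp add: vec_eq_iff)
  then show ?thesis
    by (simp add: levi_def blinfun.scaleR_left blinfun.scaleR_right power2_eq_square algebra_simps)
qed

text \<open>On the compact \<open>r0\<close>-neighbourhood \<open>N\<close> of the closure,
  \<open>\<rho>\<close> and its first two derivatives are bounded and \<open>F2\<close> is uniformly
  continuous. Gradient and Levi form have positive minima over the compact frontier (and unit
  vectors), and these persist, with a loss, in a collar.\<close>

lemma spd_exists:
  fixes \<Omega> :: "(complex^'n::finite) set"
  assumes "bounded \<Omega>" and "strongly_pseudoconvex_domain \<Omega>"
  obtains \<rho> F1 F2 M r h\<^sub>0 g c where "spd \<Omega> \<rho> F1 F2 M r h\<^sub>0 g c"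
proof -
  from assms(2) obtain \<rho> where op: "open \<Omega>" and conn: "connected \<Omega>" and ne: "\<Omega> \<noteq> {}"
    and df: "C2_defining_function \<rho> \<Omega>"
    and lv: "\<And>p v. \<lbrakk>p \<in> frontier \<Omega>; v \<noteq> 0\<rbrakk> \<Longrightarrow> 0 < Re (levi_form \<rho> p v)"
    unfolding strongly_pseudoconvex_domain_def by blast
  from df obtain U where U: "open U" "closure \<Omega> \<subseteq> U" "C2_on \<rho> U" "\<Omega> = {z \<in> U. \<rho> z < 0}"
    and nd: "\<And>p. p \<in> frontier \<Omega> \<Longrightarrow> frechet_derivative \<rho> (at p) \<noteq> (\<lambda>v. 0)"
    unfolding C2_defining_function_def by blast
  from U(3) obtain F1 F2 where F1: "\<And>x. x \<in> U \<Longrightarrow> (\<rho> has_derivative blinfun_apply (F1 x)) (at x)"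
    and F2: "\<And>x. x \<in> U \<Longrightarrow> (F1 has_derivative blinfun_apply (F2 x)) (at x)"
    and F2c: "continuous_on U F2"
    unfolding C2_on_def by blast
  define C where "C = closure \<Omega>"
  have C: "compact C" "C \<subseteq> U" "\<Omega> \<subseteq> C" using assms(1) U(2) closure_subset by (auto simp: C_def compact_closure)
  obtain r0 where r0: "r0 > 0" "(\<Union>x\<in>C. cball x r0) \<subseteq> U"
    using compact_subset_open_imp_cball_epsilon_subset[OF C(1) U(1) C(2)] by blast
  define N where "N = {x + y | x y. x \<in> C \<and> y \<in> cball 0 r0}"
  have cN: "compact N" unfolding N_def by (rule compact_sums[OF C(1) compact_cball])
  have NU: "N \<subseteq> U" using r0(2) unfolding N_def by (fastforce simp: dist_norm)
  have inN: "z + u \<in> N" if "z \<in> C" "norm u \<le> r0" for z u using that by (auto simp: N_def)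
  have CN: "C \<subseteq> N" using inN[of _ 0] r0(1) by auto
  have contr: "continuous_on N \<rho>"
    using F1 NU by (meson continuous_at_imp_continuous_on has_derivative_continuous subsetD)
  have contF1: "continuous_on N F1"
    using F2 NU by (meson continuous_at_imp_continuous_on has_derivative_continuous subsetD)
  have contF2: "continuous_on N F2" using F2c NU continuous_on_subset by blast
  have "bounded (\<rho> ` N)" "bounded (F1 ` N)" "bounded (F2 ` N)" "bounded N"
    using compact_continuous_image[OF contr cN] compact_continuous_image[OF contF1 cN]
      compact_continuous_image[OF contF2 cN] cN compact_imp_bounded by blast+
  note bdd = this
  from bdd(1) obtain B1 where B1: "\<And>x. x \<in> N \<Longrightarrow> norm (\<rho> x) \<le> B1" unfolding bounded_iff by blast
  from bdd(2) obtain B2 where B2: "\<And>x. x \<in> N \<Longrightarrow> norm (F1 x) \<le> B2" unfolding bounded_iff by blast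
  from bdd(3) obtain B3 where B3: "\<And>x. x \<in> N \<Longrightarrow> norm (F2 x) \<le> B3" unfolding bounded_iff by blast
  from bdd(4) obtain B4 where B4: "\<And>x. x \<in> N \<Longrightarrow> norm x \<le> B4" unfolding bounded_iff by blast
  note B = B1 B2 B3 B4
  define M1 where "M1 = 1 + \<bar>B1\<bar> + \<bar>B2\<bar> + \<bar>B3\<bar> + \<bar>B4\<bar>"
  have M1: "M1 \<ge> 1" "\<And>x. x \<in> N \<Longrightarrow> \<bar>\<rho> x\<bar> \<le> M1 \<and> norm (F1 x) \<le> M1 \<and> norm (F2 x) \<le> M1 \<and> norm x \<le> M1"
    using B by (fastforce simp: M1_def)+
  have seg: "z + t *\<^sub>R u \<in> N" if "z \<in> C" "norm u \<le> r0" "0 \<le> t" "t \<le> 1" for z u and t :: real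
  proof (rule inN[OF that(1)])
    show "norm (t *\<^sub>R u) \<le> r0" using that by (simp add: mult_le_one order_trans[OF mult_left_le_one_le])
  qed
  have d1: "((\<lambda>t. \<rho> (z + t *\<^sub>R u)) has_real_derivative F1 (z + t *\<^sub>R u) u) (at t)"
    if "z + t *\<^sub>R u \<in> N" for z u t
  proof -
    have "((\<lambda>t. z + t *\<^sub>R u) has_derivative (\<lambda>h. h *\<^sub>R u)) (at t)"
      by (auto intro!: derivative_eq_intros)
    from has_derivative_compose[OF this F1] that NU
    show ?thesis by (auto simp: has_field_derivative_def blinfun.scaleR_right mult_commute_abs)
  qed
  have d2: "((\<lambda>t. blinfun_apply (F1 (z + t *\<^sub>R u)) u) has_real_derivative F2 (z + t *\<^sub>R u) u u) (at t)"
    if "z + t *\<^sub>R u \<in> N" for z u t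
  proof -
    have "((\<lambda>t. z + t *\<^sub>R u) has_derivative (\<lambda>h. h *\<^sub>R u)) (at t)"
      by (auto intro!: derivative_eq_intros)
    from has_derivative_compose[OF this F2] that NU
    have "((\<lambda>t. F1 (z + t *\<^sub>R u)) has_derivative (\<lambda>h. F2 (z + t *\<^sub>R u) (h *\<^sub>R u))) (at t)" by auto
    from bounded_linear.has_derivative[OF blinfun.bounded_linear_left[of u] this]
    show ?thesis by (auto simp: has_field_derivative_def blinfun.scaleR_right blinfun.scaleR_left mult_commute_abs)
  qed
  have t2: "\<rho> z + F1 z u + m / 2 \<le> \<rho> (z + u)"
    if zu: "z \<in> C" "norm u \<le> r0" and m: "\<And>t. \<lbrakk>0 \<le> t; t \<le> 1\<rbrakk> \<Longrightarrow> m \<le> F2 (z + t *\<^sub>R u) u u" for z u m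
    using second_order_lower[of "\<lambda>t. \<rho> (z + t *\<^sub>R u)" "\<lambda>t. F1 (z + t *\<^sub>R u) u"
        "\<lambda>t. F2 (z + t *\<^sub>R u) u u" m] d1 d2 m seg[OF zu] by simp
  have t2': "\<rho> (z + u) \<le> \<rho> z + F1 z u + m / 2"
    if zu: "z \<in> C" "norm u \<le> r0" and m: "\<And>t. \<lbrakk>0 \<le> t; t \<le> 1\<rbrakk> \<Longrightarrow> F2 (z + t *\<^sub>R u) u u \<le> m" for z u m
    using second_order_lower[of "\<lambda>t. - \<rho> (z + t *\<^sub>R u)" "\<lambda>t. - F1 (z + t *\<^sub>R u) u"
        "\<lambda>t. - F2 (z + t *\<^sub>R u) u u" "- m"] DERIV_minus[OF d1] DERIV_minus[OF d2] m seg[OF zu] by simp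
  have taylor: "\<bar>\<rho> (z + u) - \<rho> z - F1 z u\<bar> \<le> M1 * (norm u)\<^sup>2" if zu: "z \<in> C" "norm u \<le> r0" for z u
  proof -
    have b: "\<bar>F2 (z + t *\<^sub>R u) u u\<bar> \<le> M1 * (norm u)\<^sup>2" if "0 \<le> t" "t \<le> 1" for t
    proof -
      have "norm (F2 (z + t *\<^sub>R u)) \<le> M1" using M1(2) seg[OF zu that] by blast
      then show ?thesis using abs_quadratic_le[of "F2 (z + t *\<^sub>R u)" u]
        by (meson mult_right_mono order_trans zero_le_power2)
    qed
    have "\<rho> z + F1 z u + (- (M1 * (norm u)\<^sup>2)) / 2 \<le> \<rho> (z + u)"
    proof (rule t2[OF zu])
      fix t :: real assume "0 \<le> t" "t \<le> 1"
      from b[OF this] show "- (M1 * (norm u)\<^sup>2) \<le> F2 (z + t *\<^sub>R u) u u" by linarith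
    qed
    moreover have "\<rho> (z + u) \<le> \<rho> z + F1 z u + (M1 * (norm u)\<^sup>2) / 2"
    proof (rule t2'[OF zu])
      fix t :: real assume "0 \<le> t" "t \<le> 1"
      from b[OF this] show "F2 (z + t *\<^sub>R u) u u \<le> M1 * (norm u)\<^sup>2" by linarith
    qed
    moreover have "0 \<le> M1 * (norm u)\<^sup>2" using M1(1) by simp
    ultimately show ?thesis by (simp add: abs_le_iff)
  qed
  have cbN: "cball z r0 \<subseteq> N" if "z \<in> C" for z
    using inN[OF that, of "_ - z"] by (fastforce simp: dist_norm norm_minus_commute)
  have F1loc: "norm (F1 p - F1 q) \<le> M1 * norm (p - q)" if "q \<in> C" "norm (p - q) \<le> r0" for p q
  proof (rule differentiable_bound[of "cball q r0"])
    show "(F1 has_derivative blinfun_apply (F2 x)) (at x within cball q r0)" if "x \<in> cball q r0" for x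
      using F2 cbN[OF \<open>q \<in> C\<close>] NU that has_derivative_at_withinI by blast
    show "onorm (blinfun_apply (F2 x)) \<le> M1" if "x \<in> cball q r0" for x
      using M1(2) cbN[OF \<open>q \<in> C\<close>] that by (auto simp: norm_blinfun.rep_eq[symmetric])
  qed (use that r0(1) in \<open>auto simp: dist_norm norm_minus_commute\<close>)
  have rloc: "\<bar>\<rho> p - \<rho> q\<bar> \<le> M1 * norm (p - q)" if "q \<in> C" "norm (p - q) \<le> r0" for p q
  proof -
    have "norm (\<rho> p - \<rho> q) \<le> M1 * norm (p - q)"
    proof (rule differentiable_bound[of "cball q r0"])
      show "(\<rho> has_derivative blinfun_apply (F1 x)) (at x within cball q r0)" if "x \<in> cball q r0" for x
        using F1 cbN[OF \<open>q \<in> C\<close>] NU that has_derivative_at_withinI by blast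
      show "onorm (blinfun_apply (F1 x)) \<le> M1" if "x \<in> cball q r0" for x
        using M1(2) cbN[OF \<open>q \<in> C\<close>] that by (auto simp: norm_blinfun.rep_eq[symmetric])
    qed (use that r0(1) in \<open>auto simp: dist_norm norm_minus_commute\<close>)
    then show ?thesis by simp
  qed
  \<comment> \<open>A segment between points more than \<open>r0\<close> apart may leave
    \<open>N\<close>. For such points the trivial bound \<open>2 * M1\<close> gives the Lipschitz
    estimate, at the price of the second summand.\<close>
  define M where "M = M1 + 2 * M1 / r0"
  have M: "M \<ge> M1" using M1(1) r0(1) by (simp add: M_def)
  have far: "X \<le> M * norm (p - q)" if "norm (p - q) > r0" "X \<le> 2 * M1" for X and p q :: "complex^'n"
  proof -
    have "X \<le> (2 * M1 / r0) * r0" using that r0(1) by simp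
    also have "\<dots> \<le> M * norm (p - q)" using that(1) r0(1) M1(1) by (intro mult_mono) (auto simp: M_def)
    finally show ?thesis .
  qed
  have near: "X \<le> M * norm (p - q)" if "X \<le> M1 * norm (p - q)" for X and p q :: "complex^'n"
    using that M by (meson mult_right_mono norm_ge_zero order_trans)
  have F1lip: "norm (F1 p - F1 q) \<le> M * norm (p - q)" if "p \<in> C" "q \<in> C" for p q
  proof (cases "norm (p - q) \<le> r0")
    case True
    then show ?thesis using near F1loc that by blast
  next
    case False
    have "norm (F1 p - F1 q) \<le> norm (F1 p) + norm (F1 q)" by (rule norm_triangle_ineq4)
    also have "\<dots> \<le> 2 * M1" using M1(2)[of p] M1(2)[of q] that CN by fastforce
    finally show ?thesis using far False by force
  qed
  have rlip: "\<bar>\<rho> p - \<rho> q\<bar> \<le> M * norm (p - q)" if "p \<in> C" "q \<in> C" for p q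
  proof (cases "norm (p - q) \<le> r0")
    case True
    then show ?thesis using near rloc that by blast
  next
    case False
    have "\<bar>\<rho> p - \<rho> q\<bar> \<le> 2 * M1" using M1(2)[of p] M1(2)[of q] that CN by fastforce
    then show ?thesis using far False by force
  qed
  have fr: "p \<in> C \<and> \<rho> p = 0" if "p \<in> frontier \<Omega>" for p
  proof -
    have pC: "p \<in> C" and pn: "p \<notin> \<Omega>" using that op by (auto simp: C_def frontier_def interior_open)
    have "\<rho> p \<le> 0"
    proof -
      have "closure \<Omega> \<subseteq> {x \<in> C. \<rho> x \<le> 0}"
      proof (rule closure_minimal)
        show "\<Omega> \<subseteq> {x \<in> C. \<rho> x \<le> 0}" using U(4) C(3) by auto
        show "closed {x \<in> C. \<rho> x \<le> 0}"
          using contr CN C(1) by (intro continuous_on_closed_Collect_le continuous_on_const)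
            (auto intro: continuous_on_subset compact_imp_closed)
      qed
      then show ?thesis using pC by (auto simp: C_def)
    qed
    moreover have "\<not> \<rho> p < 0" using pn U(4) pC C(2) by blast
    ultimately show ?thesis using pC by simp
  qed
  have zeroC: "p \<in> frontier \<Omega>" if "p \<in> C" "\<rho> p \<ge> 0" for p
    using that op U(4) by (auto simp: C_def frontier_def interior_open)
  have cfr: "compact (frontier \<Omega>)" using assms(1) by (rule compact_frontier_bounded)
  \<comment> \<open>On the compact part of the closure outside \<open>W\<close> the function
    \<open>\<rho>\<close> is negative, hence bounded away from 0.\<close>
  have nbhd: "\<exists>h>0. \<forall>z\<in>\<Omega>. - \<rho> z \<le> h \<longrightarrow> z \<in> W" if "open W" "frontier \<Omega> \<subseteq> W" for W
  proof (cases "C - W = {}")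
    case True
    then show ?thesis using C(3) by (intro exI[of _ 1]) auto
  next
    case False
    have "compact (C - W)" using C(1) that(1) by (rule compact_diff)
    moreover have "continuous_on (C - W) (\<lambda>z. - \<rho> z)"
      using contr CN by (intro continuous_on_minus) (auto intro: continuous_on_subset)
    ultimately obtain z0 where z0: "z0 \<in> C - W" "\<And>z. z \<in> C - W \<Longrightarrow> - \<rho> z0 \<le> - \<rho> z"
      using continuous_attains_inf[of "C - W"] False by blast
    have "\<rho> z0 < 0" using zeroC[of z0] z0(1) that(2) by force
    then show ?thesis using z0(2) C(3) by (intro exI[of _ "- \<rho> z0 / 2"]) force
  qed
  have n0: "F1 p \<noteq> 0" if "p \<in> frontier \<Omega>" for p
  proof
    assume "F1 p = 0"
    moreover have "frechet_derivative \<rho> (at p) = blinfun_apply (F1 p)"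
      using frechet_derivative_at[OF F1] fr[OF that] C(2) by (metis subsetD)
    ultimately show False using nd[OF that] by (simp add: fun_eq_iff)
  qed
  obtain g where g: "g > 0" "\<And>p. p \<in> frontier \<Omega> \<Longrightarrow> 2 * g \<le> norm (F1 p)"
  proof (cases "frontier \<Omega> = {}")
    case True
    then show ?thesis using that[of 1] by auto
  next
    case False
    have "continuous_on (frontier \<Omega>) (\<lambda>p. norm (F1 p))"
      using contF1 fr CN by (intro continuous_on_norm) (auto intro: continuous_on_subset)
    then obtain p0 where "p0 \<in> frontier \<Omega>" "\<And>p. p \<in> frontier \<Omega> \<Longrightarrow> norm (F1 p0) \<le> norm (F1 p)"
      using continuous_attains_inf[OF cfr False] by blast
    then show ?thesis using n0[of p0] that[of "norm (F1 p0) / 2"] by auto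
  qed
  \<comment> \<open>Of the \<open>4 * c\<close>, one \<open>c\<close> is spent on moving from the
    frontier to \<open>z\<close> and half of another on moving along the segment from
    \<open>z\<close>; at least \<open>c\<close> is left.\<close>
  obtain c where c: "c > 0" "\<And>p v. \<lbrakk>p \<in> frontier \<Omega>; norm v = 1\<rbrakk> \<Longrightarrow> 4 * c \<le> levi (F2 p) v"
  proof (cases "frontier \<Omega> \<times> sphere (0::complex^'n) 1 = {}")
    case True
    then have "\<not> (p \<in> frontier \<Omega> \<and> norm v = 1)" for p and v :: "complex^'n" by auto
    then show ?thesis using that[of 1] by auto
  next
    case False
    let ?S = "frontier \<Omega> \<times> sphere (0::complex^'n) 1"
    have cS: "compact ?S" using cfr by (intro compact_Times) auto
    have blis: "continuous_on ?S (\<lambda>x. \<i> *s snd x)"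
    proof -
      have "linear (\<lambda>u::complex^'n. \<i> *s u)"
        by (rule linearI) (simp_all add: vec_eq_iff algebra_simps)
      then have "bounded_linear (\<lambda>u::complex^'n. \<i> *s u)" by (simp add: linear_conv_bounded_linear)
      from bounded_linear.continuous_on[OF this continuous_on_snd[OF continuous_on_id]]
      show ?thesis .
    qed
    have "continuous_on ?S (\<lambda>x. F2 (fst x))"
      using fr CN by (intro continuous_on_compose2[OF contF2]) (auto intro: continuous_intros)
    then have "continuous_on ?S (\<lambda>x. levi (F2 (fst x)) (snd x))"
      unfolding levi_def using blis by (intro continuous_intros) auto
    then obtain x0 where x0: "x0 \<in> ?S" "\<And>x. x \<in> ?S \<Longrightarrow> levi (F2 (fst x0)) (snd x0) \<le> levi (F2 (fst x)) (snd x)"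
      using continuous_attains_inf[OF cS False] by blast
    have p0: "fst x0 \<in> frontier \<Omega>" "snd x0 \<noteq> 0" using x0(1) by (auto simp: mem_Times_iff)
    have pU: "fst x0 \<in> U" using fr[OF p0(1)] C(2) by blast
    have "0 < levi (F2 (fst x0)) (snd x0)"
      using Re_levi_form[OF U(1) pU F1 F2, of "snd x0"] lv[OF p0] by simp
    then show ?thesis using x0(2) that[of "levi (F2 (fst x0)) (snd x0) / 4"] by fastforce
  qed
  obtain d where d: "d > 0" "\<And>x y. \<lbrakk>x \<in> N; y \<in> N; dist y x < d\<rbrakk> \<Longrightarrow> dist (F2 y) (F2 x) < c"
    using compact_uniformly_continuous[OF contF2 cN] c(1) unfolding uniformly_continuous_on_def by metis
  \<comment> \<open>\<open>d\<close> controls the change of \<open>F2\<close> and \<open>r0\<close>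
    admits the local Lipschitz bound; \<open>g / M1\<close> lets the norm of \<open>F1\<close> drop
    from \<open>2 * g\<close> to no less than \<open>g\<close>.\<close>
  define d' where "d' = min d (min r0 (g / M1))"
  have d': "d' > 0" using d(1) r0(1) g(1) M1(1) by (simp add: d'_def)
  obtain h0 where h0: "h0 > 0" "\<And>z. \<lbrakk>z \<in> \<Omega>; - \<rho> z \<le> h0\<rbrakk> \<Longrightarrow> \<exists>p\<in>frontier \<Omega>. dist p z < d'"
    using nbhd[of "\<Union>p\<in>frontier \<Omega>. ball p d'"] d' by force
  have gge: "g \<le> norm (F1 z)" if z: "z \<in> \<Omega>" "- \<rho> z \<le> h0" for z
  proof -
    obtain p where p: "p \<in> frontier \<Omega>" "dist p z < d'" using h0(2)[OF z] by blast
    have "norm (F1 p - F1 z) \<le> M1 * norm (p - z)"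
      using z(1) C(3) p(2) by (intro F1loc) (auto simp: d'_def dist_norm)
    also have "\<dots> \<le> M1 * (g / M1)" using p(2) M1(1) by (intro mult_left_mono) (auto simp: d'_def dist_norm)
    also have "\<dots> = g" using M1(1) by simp
    finally have "norm (F1 p - F1 z) \<le> g" .
    moreover have "norm (F1 p) \<le> norm (F1 z) + norm (F1 p - F1 z)" by (metis norm_triangle_sub)
    ultimately show ?thesis using g(2)[OF p(1)] by linarith
  qed
  define r where "r = min (min r0 1) (d / 2)"
  have r: "r > 0" "r \<le> 1" "r \<le> r0" "r < d" using r0(1) d(1) by (auto simp: r_def)
  have lge: "\<rho> z + F1 z u + Re (holq (F2 z) u u) + c * (norm u)\<^sup>2 \<le> \<rho> (z + u)"
    if z: "z \<in> \<Omega>" "- \<rho> z \<le> h0" "norm u \<le> r" for z u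
  proof -
    obtain p where p: "p \<in> frontier \<Omega>" "dist p z < d'" using h0(2)[OF z(1,2)] by blast
    have zC: "z \<in> C" using z(1) C(3) by blast
    have pN: "p \<in> N" "z \<in> N" using fr[OF p(1)] zC CN by auto
    have "dist p z < d" using p(2) by (simp add: d'_def)
    then have "norm (F2 p - F2 z) < c" using d(2)[OF pN(2,1)] by (simp add: dist_norm)
    then have "\<bar>levi (F2 p) u - levi (F2 z) u\<bar> \<le> c * (norm u)\<^sup>2"
      using abs_levi_le[of "F2 p - F2 z" u] unfolding levi_diff
      by (meson less_imp_le mult_right_mono order_trans zero_le_power2)
    moreover have "4 * c * (norm u)\<^sup>2 \<le> levi (F2 p) u"
    proof (cases "u = 0")
      case False
      have "4 * c \<le> levi (F2 p) (u /\<^sub>R norm u)" using False by (intro c(2)[OF p(1)]) simp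
      then show ?thesis using False unfolding levi_scaleR by (simp add: field_simps)
    qed (simp add: levi_def)
    ultimately have l: "3 * c * (norm u)\<^sup>2 \<le> levi (F2 z) u" by linarith
    have "\<rho> z + F1 z u + (F2 z u u - c * (norm u)\<^sup>2) / 2 \<le> \<rho> (z + u)"
    proof (rule t2[OF zC])
      show "norm u \<le> r0" using z(3) r(3) by simp
      fix t :: real assume t: "0 \<le> t" "t \<le> 1"
      have "z + t *\<^sub>R u \<in> N" using t z(3) r(3) by (intro seg[OF zC]) auto
      moreover have "dist (z + t *\<^sub>R u) z < d"
      proof -
        have "dist (z + t *\<^sub>R u) z = t * norm u" using t by (simp add: dist_norm)
        also have "\<dots> \<le> norm u" using t by (simp add: mult_left_le_one_le)
        finally show ?thesis using z(3) r(4) by simp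
      qed
      ultimately have "norm (F2 (z + t *\<^sub>R u) - F2 z) < c" using d(2) pN(2) by (simp add: dist_norm)
      then have "\<bar>(F2 (z + t *\<^sub>R u) - F2 z) u u\<bar> \<le> c * (norm u)\<^sup>2"
        using abs_quadratic_le[of "F2 (z + t *\<^sub>R u) - F2 z" u]
        by (meson less_imp_le mult_right_mono order_trans zero_le_power2)
      then show "F2 z u u - c * (norm u)\<^sup>2 \<le> F2 (z + t *\<^sub>R u) u u"
        by (simp add: blinfun.diff_left abs_le_iff)
    qed
    moreover have "F2 z u u / 2 = levi (F2 z) u + Re (holq (F2 z) u u)" by (rule half_quadratic)
    ultimately have "\<rho> z + F1 z u + Re (holq (F2 z) u u) + levi (F2 z) u - c * (norm u)\<^sup>2 / 2 \<le> \<rho> (z + u)"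
      by (simp add: diff_divide_distrib)
    moreover have "0 \<le> c * (norm u)\<^sup>2" using c(1) by simp
    ultimately show ?thesis using l by linarith
  qed
  have "spd \<Omega> \<rho> F1 F2 M r h0 g c"
  proof
    show "compact {z \<in> \<Omega>. - \<rho> z \<ge> \<eta>}" if "\<eta> > 0" for \<eta>
    proof -
      have "{z \<in> \<Omega>. - \<rho> z \<ge> \<eta>} = {z \<in> C. \<rho> z \<le> - \<eta>}" using U(4) C that by auto
      moreover have "closed {z \<in> C. \<rho> z \<le> - \<eta>}"
        using contr CN C(1) by (intro continuous_on_closed_Collect_le continuous_on_const)
          (auto intro: continuous_on_subset compact_imp_closed)
      moreover have "C \<inter> {z \<in> C. \<rho> z \<le> - \<eta>} = {z \<in> C. \<rho> z \<le> - \<eta>}" by blast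
      ultimately show ?thesis using compact_Int_closed[OF C(1), of "{z \<in> C. \<rho> z \<le> - \<eta>}"] by simp
    qed
    show "z + u \<in> \<Omega>" if "z \<in> \<Omega>" "norm u \<le> r" "\<rho> (z + u) < 0" for z u
      using inN[of z u] that C(3) r(3) NU U(4) by auto
    show "\<bar>\<rho> (z + u) - \<rho> z - F1 z u\<bar> \<le> M * (norm u)\<^sup>2" if "z \<in> \<Omega>" "norm u \<le> r" for z u
    proof -
      have "\<bar>\<rho> (z + u) - \<rho> z - F1 z u\<bar> \<le> M1 * (norm u)\<^sup>2" using that C(3) r(3) by (intro taylor) auto
      also have "\<dots> \<le> M * (norm u)\<^sup>2" using M by (intro mult_right_mono) auto
      finally show ?thesis .
    qed
    show "norm (F1 p - F1 q) \<le> M * norm (p - q)" if "p \<in> \<Omega>" "q \<in> \<Omega>" for p q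
      using F1lip that C(3) by blast
    show "\<bar>\<rho> p - \<rho> q\<bar> \<le> M * norm (p - q)" if "p \<in> \<Omega>" "q \<in> \<Omega>" for p q
      using rlip that C(3) by blast
    show "norm (F1 z) \<le> M" "norm z \<le> M" "- \<rho> z \<le> M" if "z \<in> \<Omega>" for z
      using M1(2)[of z] that C(3) CN M by force+
    show "(\<rho> has_derivative blinfun_apply (F1 z)) (at z)" if "z \<in> \<Omega>" for z using F1 that C by blast
  qed (use op conn ne r c(1) h0(1) g(1) M M1(1) gge lge U(4) in auto)
  then show thesis by (rule that)
qed

section \<open>The Kobayashi metric near the boundary\<close>

lemma schwarz_scaled:
  assumes holg: "g holomorphic_on ball 0 s" and "s > 0" "B > 0" and g0: "g 0 = 0"
    and lt: "\<forall>\<zeta>. cmod \<zeta> < s \<longrightarrow> cmod (g \<zeta>) < B"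
  shows "cmod (deriv g 0) \<le> B / s" "cmod \<zeta> < s \<Longrightarrow> cmod (g \<zeta>) \<le> B * cmod \<zeta> / s"
proof -
  define G where "G \<zeta> = g (of_real s * \<zeta>) / of_real B" for \<zeta>
  have in_ball: "cmod (of_real s * \<zeta>) < s" if "cmod \<zeta> < 1" for \<zeta>
    using that \<open>s > 0\<close> by (simp add: norm_mult)
  have holG: "G holomorphic_on ball 0 1"
    unfolding G_def using \<open>B > 0\<close> in_ball
    by (intro holomorphic_on_divide holomorphic_on_const
        holomorphic_on_compose_gen[OF _ holg, unfolded o_def] holomorphic_intros) auto
  have G0: "G 0 = 0" by (simp add: G_def g0)
  have G1: "cmod (G \<zeta>) < 1" if "cmod \<zeta> < 1" for \<zeta>
    using lt[rule_format, OF in_ball[OF that]] \<open>B > 0\<close> by (simp add: G_def norm_divide)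
  have dg: "(g has_field_derivative deriv g 0) (at 0)"
    using holg \<open>s > 0\<close> by (intro holomorphic_derivI[of _ "ball 0 s"]) auto
  have "((\<lambda>\<zeta>. of_real s * \<zeta>) has_field_derivative of_real s) (at (0::complex))"
    by (auto intro!: derivative_eq_intros)
  from DERIV_chain2[OF _ this, of g "deriv g 0"] dg
  have "((\<lambda>\<zeta>. g (of_real s * \<zeta>)) has_field_derivative deriv g 0 * of_real s) (at 0)" by simp
  then have "(G has_field_derivative deriv g 0 * of_real s / of_real B) (at 0)"
    unfolding G_def by (rule DERIV_cdivide)
  then have "deriv G 0 = deriv g 0 * of_real s / of_real B" by (rule DERIV_imp_deriv)
  moreover have "cmod (deriv G 0) \<le> 1" using Schwarz_Lemma(2)[OF holG G0 G1, of 0] by simp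
  ultimately have "cmod (deriv g 0) * s / B \<le> 1" using \<open>s > 0\<close> \<open>B > 0\<close> by (simp add: norm_mult norm_divide)
  then show "cmod (deriv g 0) \<le> B / s" using \<open>s > 0\<close> \<open>B > 0\<close> by (simp add: field_simps)
  assume \<zeta>: "cmod \<zeta> < s"
  have "cmod (\<zeta> / of_real s) < 1" using \<zeta> \<open>s > 0\<close> by (simp add: norm_divide)
  then have "cmod (G (\<zeta> / of_real s)) \<le> cmod (\<zeta> / of_real s)" using Schwarz_Lemma(1)[OF holG G0 G1] by blast
  then show "cmod (g \<zeta>) \<le> B * cmod \<zeta> / s"
    using \<open>s > 0\<close> \<open>B > 0\<close> by (simp add: G_def norm_divide field_simps)
qed

text \<open>The map \<open>w / (2 * h - w)\<close> takes the half-plane of real part below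
  \<open>h\<close> into the unit disc and fixes 0; the Schwarz lemma applies to its composition with
  \<open>g\<close>.\<close>

lemma borel_caratheodory_zero:
  assumes holg: "g holomorphic_on ball 0 s" and s: "s > 0" and "h > 0" and g0: "g 0 = 0"
    and lt: "\<forall>\<zeta>. cmod \<zeta> < s \<longrightarrow> Re (g \<zeta>) < h"
  shows "cmod (deriv g 0) \<le> 2 * h / s" "cmod \<zeta> \<le> s / 2 \<Longrightarrow> cmod (g \<zeta>) \<le> 2 * h"
proof -
  define G where "G \<zeta> = g \<zeta> / (of_real (2 * h) - g \<zeta>)" for \<zeta>
  have nz: "of_real (2 * h) - g \<zeta> \<noteq> 0" if "cmod \<zeta> < s" for \<zeta>
    using lt[rule_format, OF that] \<open>h > 0\<close> by (auto simp: complex_eq_iff)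
  have holG: "G holomorphic_on ball 0 s"
    unfolding G_def using nz by (intro holomorphic_intros holg) auto
  have G0: "G 0 = 0" by (simp add: G_def g0)
  have lt2: "cmod (g \<zeta>) < cmod (of_real (2 * h) - g \<zeta>)" if "cmod \<zeta> < s" for \<zeta>
  proof -
    have "(Re (g \<zeta>))\<^sup>2 < (2 * h - Re (g \<zeta>))\<^sup>2"
    proof -
      have "(2 * h - Re (g \<zeta>))\<^sup>2 - (Re (g \<zeta>))\<^sup>2 = 4 * h * (h - Re (g \<zeta>))"
        by (simp add: power2_eq_square algebra_simps)
      also have "\<dots> > 0" using lt[rule_format, OF that] \<open>h > 0\<close> by simp
      finally show ?thesis by simp
    qed
    then show ?thesis by (simp add: cmod_def power2_commute)
  qed
  have G1: "\<forall>\<zeta>. cmod \<zeta> < s \<longrightarrow> cmod (G \<zeta>) < 1"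
    using lt2 nz by (simp add: G_def norm_divide)
  note S = schwarz_scaled[OF holG \<open>s > 0\<close> zero_less_one G0 G1]
  have dg: "(g has_field_derivative deriv g 0) (at 0)"
    using holg \<open>s > 0\<close> by (intro holomorphic_derivI[of _ "ball 0 s"]) auto
  have "(G has_field_derivative deriv g 0 / of_real (2 * h)) (at 0)"
  proof -
    have "((\<lambda>\<zeta>. of_real (2 * h) - g \<zeta>) has_field_derivative 0 - deriv g 0) (at 0)"
      by (rule DERIV_diff[OF DERIV_const dg])
    from DERIV_divide[OF dg this nz] s show ?thesis
      using \<open>h > 0\<close> unfolding G_def by (simp add: g0)
  qed
  then have "deriv G 0 = deriv g 0 / of_real (2 * h)" by (rule DERIV_imp_deriv)
  then have "cmod (deriv g 0) / (2 * h) \<le> 1 / s" using S(1) \<open>h > 0\<close> by (simp add: norm_divide)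
  then show "cmod (deriv g 0) \<le> 2 * h / s" using \<open>s > 0\<close> \<open>h > 0\<close> by (simp add: field_simps)
  assume \<zeta>: "cmod \<zeta> \<le> s / 2"
  then have \<zeta>s: "cmod \<zeta> < s" using \<open>s > 0\<close> by simp
  have "cmod (G \<zeta>) \<le> cmod \<zeta> / s" using S(2)[OF \<zeta>s] by simp
  also have "\<dots> \<le> 1 / 2" using \<zeta> \<open>s > 0\<close> by (simp add: field_simps)
  finally have "cmod (g \<zeta>) / cmod (of_real (2 * h) - g \<zeta>) \<le> 1 / 2" unfolding G_def norm_divide .
  then have "2 * cmod (g \<zeta>) \<le> cmod (of_real (2 * h) - g \<zeta>)" using nz[OF \<zeta>s] by (simp add: field_simps)
  also have "\<dots> \<le> 2 * h + cmod (g \<zeta>)"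
    using norm_triangle_ineq4[of "of_real (2 * h)" "g \<zeta>"] \<open>h > 0\<close> by simp
  finally show "cmod (g \<zeta>) \<le> 2 * h" by simp
qed

lemma norm_vec_le_of_components:
  fixes v :: "complex^'n::finite"
  assumes "\<And>j. cmod (v $ j) \<le> B"
  shows "norm v \<le> real CARD('n) * B"
proof -
  have "norm v \<le> (\<Sum>j\<in>UNIV. cmod (v $ j))" unfolding norm_vec_def by (rule L2_set_le_sum) simp
  also have "\<dots> \<le> (\<Sum>j\<in>(UNIV::'n set). B)" by (intro sum_mono assms)
  finally show ?thesis by simp
qed

section \<open>Comparison of the Kobayashi metric with the weight\<close>

context spd
begin

definition ht :: "complex^'n \<Rightarrow> real" where "ht z = - \<rho> z"

lemma ht_pos: "z \<in> \<Omega> \<Longrightarrow> 0 < ht z"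
  using neg[of z] by (simp add: ht_def)

lemma ht_le: "z \<in> \<Omega> \<Longrightarrow> ht z \<le> M"
  using rho_ge[of z] by (simp add: ht_def)

text \<open>The weight \<open>wt z\<close> is comparable to the Kobayashi metric at \<open>z\<close>: complex normal
  directions are divided by the height \<open>ht z\<close> and all directions by its square root.\<close>

definition wt :: "complex^'n \<Rightarrow> complex^'n \<Rightarrow> real" where
  "wt z v = cmod (cpart (F1 z) v) / ht z + norm v / sqrt (ht z)"

text \<open>A radius in the weight: small enough that vectors of this weight have norm at most
  \<open>r\<close> and a quadratic Taylor error of at most \<open>ht z / 16\<close>.\<close>

definition a\<^sub>0 :: real where "a\<^sub>0 = r / (4 * M)"

lemma a0: "0 < a\<^sub>0" "a\<^sub>0 \<le> 1 / 4" "a\<^sub>0 * M \<le> r" "M * a\<^sub>0\<^sup>2 \<le> 1 / 16"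
proof -
  show 1: "0 < a\<^sub>0" "a\<^sub>0 \<le> 1 / 4" "a\<^sub>0 * M \<le> r" using csts by (auto simp: a\<^sub>0_def field_simps)
  have "M * a\<^sub>0\<^sup>2 = (r * r) / (16 * M)" using csts by (simp add: a\<^sub>0_def power2_eq_square)
  also have "\<dots> \<le> 1 / 16" using csts mult_le_one[of r r] by (simp add: field_simps)
  finally show "M * a\<^sub>0\<^sup>2 \<le> 1 / 16" .
qed

lemma wt_nonneg: "z \<in> \<Omega> \<Longrightarrow> 0 \<le> wt z v"
  using ht_pos[of z] by (simp add: wt_def)

lemma wt_csmult: "wt z (\<zeta> *s v) = cmod \<zeta> * wt z v"
  by (simp add: wt_def cpart_csmult norm_csmult norm_mult distrib_left)

lemma wt_scaleR: "wt z (x *\<^sub>R v) = \<bar>x\<bar> * wt z v"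
  by (simp add: wt_def cpart_scaleR distrib_left)

lemma wtD:
  assumes "z \<in> \<Omega>" "wt z u \<le> b"
  shows "norm u \<le> b * sqrt (ht z)" "cmod (cpart (F1 z) u) \<le> b * ht z"
proof -
  have h: "0 < ht z" using ht_pos[OF assms(1)] .
  have "norm u / sqrt (ht z) \<le> b" "cmod (cpart (F1 z) u) / ht z \<le> b"
    using assms(2) h unfolding wt_def
    by (smt (verit) divide_nonneg_pos norm_ge_zero real_sqrt_gt_zero)+
  then show "norm u \<le> b * sqrt (ht z)" "cmod (cpart (F1 z) u) \<le> b * ht z"
    using h by (simp_all add: pos_divide_le_eq)
qed

text \<open>In the Taylor expansion at \<open>z\<close> the linear term is at most a quarter and the
  quadratic error at most a sixteenth of the height.\<close>

lemma inside_wt: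
  assumes z: "z \<in> \<Omega>" and u: "wt z u \<le> a\<^sub>0"
  shows "z + u \<in> \<Omega>" "ht z / 2 \<le> ht (z + u)" "ht (z + u) \<le> 2 * ht z"
proof -
  define h where "h = ht z"
  have h: "0 < h" "h \<le> M" using ht_pos[OF z] ht_le[OF z] by (auto simp: h_def)
  have nu: "norm u \<le> a\<^sub>0 * sqrt h" and cu: "cmod (cpart (F1 z) u) \<le> a\<^sub>0 * h"
    using wtD[OF z u] by (simp_all add: h_def)
  have "sqrt h \<le> M"
    using h csts(1) by (intro real_le_lsqrt) (auto simp: power2_eq_square intro: order_trans[OF _ mult_left_mono[of 1 M M]])
  then have "a\<^sub>0 * sqrt h \<le> r" using a0(1,3) by (meson less_imp_le mult_left_mono order_trans)
  then have ur: "norm u \<le> r" using nu by simp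
  have "(norm u)\<^sup>2 \<le> (a\<^sub>0 * sqrt h)\<^sup>2" using nu by (intro power_mono) auto
  then have "(norm u)\<^sup>2 \<le> a\<^sub>0\<^sup>2 * h" using h by (simp add: power_mult_distrib)
  then have "M * (norm u)\<^sup>2 \<le> M * (a\<^sub>0\<^sup>2 * h)" using csts(1) by (intro mult_left_mono) auto
  also have "\<dots> \<le> 1 / 16 * h" using a0(4) h by (simp add: mult.assoc[symmetric] mult_right_mono)
  finally have q: "M * (norm u)\<^sup>2 \<le> h / 16" by simp
  have "\<bar>F1 z u\<bar> \<le> cmod (cpart (F1 z) u)" using abs_Re_le_cmod[of "cpart (F1 z) u"] by simp
  also have "\<dots> \<le> 1 / 4 * h" using cu a0(2) h by (meson less_imp_le mult_right_mono order_trans)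
  finally have l: "\<bar>F1 z u\<bar> \<le> h / 4" by simp
  have t: "\<bar>\<rho> (z + u) + h - F1 z u\<bar> \<le> h / 16" using taylor[OF z ur] q by (simp add: h_def ht_def)
  have "\<bar>\<rho> (z + u) + h\<bar> \<le> h / 2" using t l h by linarith
  then have b: "h / 2 \<le> - \<rho> (z + u)" "- \<rho> (z + u) \<le> 2 * h" using h by linarith+
  then show "ht z / 2 \<le> ht (z + u)" "ht (z + u) \<le> 2 * ht z" by (simp_all add: h_def ht_def)
  show "z + u \<in> \<Omega>" using inside[OF z ur] b h by linarith
qed

text \<open>The affine disc in direction \<open>v\<close>, scaled to weight
  \<open>a\<^sub>0\<close>, stays in the domain. The constant disc serves \<open>v = 0\<close>,
  where no scaling is possible.\<close>

lemma kobayashi_metric_le: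
  assumes z: "z \<in> \<Omega>"
  shows "kobayashi_metric \<Omega> z v \<le> ennreal (wt z v / a\<^sub>0)"
proof (cases "v = 0")
  case True
  have "kobayashi_metric \<Omega> z v \<le> ennreal (cmod 0)"
    unfolding kobayashi_metric_def
    by (rule Inf_lower) (use z True in \<open>auto intro!: exI[of _ "\<lambda>\<zeta>. z"] exI[of _ "0::complex"]\<close>)
  then show ?thesis by simp
next
  case False
  have h: "0 < ht z" by (rule ht_pos[OF z])
  have pos: "0 < wt z v" unfolding wt_def using False h by (intro add_nonneg_pos) auto
  define \<xi> where "\<xi> = wt z v / a\<^sub>0"
  have \<xi>: "\<xi> > 0" using pos a0(1) by (simp add: \<xi>_def)
  define u where "u = of_real (1 / \<xi>) *s v"
  have wu: "wt z u = a\<^sub>0" using \<xi> pos a0(1) by (simp add: u_def wt_csmult norm_divide \<xi>_def)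
  define f where "f \<zeta> = z + \<zeta> *s u" for \<zeta>
  have fj: "f \<zeta> $ j = z $ j + \<zeta> * u $ j" for \<zeta> j by (simp add: f_def)
  have "f ` ball 0 1 \<subseteq> \<Omega>"
  proof clarify
    fix \<zeta> :: complex assume "\<zeta> \<in> ball 0 1"
    then have "wt z (\<zeta> *s u) \<le> a\<^sub>0" unfolding wt_csmult wu using a0(1) by (simp add: mult_left_le_one_le)
    then show "f \<zeta> \<in> \<Omega>" unfolding f_def by (rule inside_wt(1)[OF z])
  qed
  moreover have "(\<lambda>\<zeta>. f \<zeta> $ j) holomorphic_on ball 0 1" for j
    unfolding fj by (intro holomorphic_intros)
  moreover have "deriv (\<lambda>\<zeta>. f \<zeta> $ j) 0 * of_real \<xi> = v $ j" for j
  proof -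
    have "deriv (\<lambda>\<zeta>. f \<zeta> $ j) 0 = u $ j"
      unfolding fj by (rule DERIV_imp_deriv) (auto intro!: derivative_eq_intros)
    then show ?thesis using \<xi> by (simp add: u_def)
  qed
  moreover have "f 0 = z" by (simp add: f_def vec_eq_iff)
  ultimately have "kobayashi_metric \<Omega> z v \<le> ennreal (cmod (of_real \<xi>))"
    unfolding kobayashi_metric_def by (intro Inf_lower) blast
  then show ?thesis unfolding \<xi>_def[symmetric] using \<xi> by simp
qed

text \<open>In the collar, \<open>g\<close> is the holomorphic polynomial of the expansion at
  \<open>z\<close> composed with the disc, so \<open>Re g + c |f - z|^2 < h\<close>. The half-plane
  estimate bounds \<open>deriv g 0\<close>, the normal component of the derivative of
  \<open>f\<close>, by \<open>2 * h / s\<close>. It also gives \<open>Re g \<ge> - 2 * h\<close> on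
  the smaller disc, hence \<open>|f - z|\<close> is at most a multiple of \<open>sqrt h\<close>
  there and the Schwarz lemma bounds the full derivative. Farther inside, boundedness of the domain
  suffices.\<close>

lemma disc_derivative_bound:
  obtains C where "C > 0"
    "\<forall>(f :: complex \<Rightarrow> complex^'n) z. (\<forall>j. (\<lambda>\<zeta>. f \<zeta> $ j) holomorphic_on ball 0 1) \<longrightarrow> f ` ball 0 1 \<subseteq> \<Omega> \<longrightarrow> f 0 = z
       \<longrightarrow> wt z (\<chi> j. deriv (\<lambda>\<zeta>. f \<zeta> $ j) 0) \<le> C"
proof -
  define n where "n = real CARD('n)"
  have n: "n \<ge> 1" unfolding n_def by (simp add: Suc_leI)
  define K where "K = n * (2 * M + 1)"
  have K: "K \<ge> 1" using n csts(1) mult_mono[of 1 n 1 "2 * M + 1"] by (simp add: K_def)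
  \<comment> \<open>By the Schwarz lemma \<open>f\<close> moves by at most
    \<open>K * cmod \<zeta>\<close>, hence by at most \<open>r\<close> on the disc of radius
    \<open>s\<close>.\<close>
  define s where "s = r / K"
  have s: "0 < s" "s \<le> 1" using csts K by (auto simp: s_def field_simps)
  define C1 where "C1 = 2 * M * K / h\<^sub>0 + K / sqrt h\<^sub>0"
  define C2 where "C2 = 2 / s + n * (4 * sqrt (3 / c) / s)"
  have C1: "C1 > 0" using csts K by (auto simp: C1_def intro!: add_pos_pos divide_pos_pos mult_pos_pos)
  have C2: "C2 \<ge> 0" using csts n s by (auto simp: C2_def)
  have C12: "C1 + C2 > 0" using C1 C2 by simp
  show thesis
  proof (rule that[OF C12], intro allI impI)
    fix f :: "complex \<Rightarrow> complex^'n" and z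
    assume holf': "\<forall>j. (\<lambda>\<zeta>. f \<zeta> $ j) holomorphic_on ball 0 1" and im: "f ` ball 0 1 \<subseteq> \<Omega>" and f0: "f 0 = z"
    have holf: "(\<lambda>\<zeta>. f \<zeta> $ j) holomorphic_on ball 0 1" for j using holf' by blast
    define w where "w = (\<chi> j. deriv (\<lambda>\<zeta>. f \<zeta> $ j) 0)"
    have fO: "f \<zeta> \<in> \<Omega>" if "cmod \<zeta> < 1" for \<zeta> using im that by auto
    have z: "z \<in> \<Omega>" using fO[of 0] f0 by simp
    define h where "h = ht z"
    have h: "h > 0" using ht_pos[OF z] by (simp add: h_def)
    have holfz: "(\<lambda>\<zeta>. f \<zeta> $ j - z $ j) holomorphic_on ball 0 1" for j
      by (intro holomorphic_intros holf)
    have dfz: "((\<lambda>\<zeta>. f \<zeta> $ j - z $ j) has_field_derivative w $ j) (at 0)" for j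
    proof -
      have "((\<lambda>\<zeta>. f \<zeta> $ j) has_field_derivative w $ j) (at 0)"
        unfolding w_def vec_lambda_beta using holf[of j] by (intro holomorphic_derivI[of _ "ball 0 1"]) auto
      from DERIV_diff[OF this DERIV_const[of "z $ j"]] show ?thesis by simp
    qed
    then have dw: "deriv (\<lambda>\<zeta>. f \<zeta> $ j - z $ j) 0 = w $ j" for j by (rule DERIV_imp_deriv)
    have z0: "f 0 $ j - z $ j = 0" for j using f0 by simp
    have lt: "\<forall>\<zeta>. cmod \<zeta> < 1 \<longrightarrow> cmod (f \<zeta> $ j - z $ j) < 2 * M + 1" for j
    proof (intro allI impI)
      fix \<zeta> :: complex assume that: "cmod \<zeta> < 1"
      have "cmod (f \<zeta> $ j - z $ j) \<le> norm (f \<zeta> - z)" using Finite_Cartesian_Product.norm_nth_le[of "f \<zeta> - z" j] by simp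
      also have "\<dots> \<le> norm (f \<zeta>) + norm z" by (rule norm_triangle_ineq4)
      also have "\<dots> \<le> M + M" using norm_le fO[OF that] z by (intro add_mono) auto
      finally show "cmod (f \<zeta> $ j - z $ j) < 2 * M + 1" by simp
    qed
    have pos1: "0 < 2 * M + 1" using csts(1) by simp
    note S = schwarz_scaled[OF holfz zero_less_one pos1 z0 lt]
    have wK: "norm w \<le> K"
      unfolding K_def n_def using S(1) by (intro norm_vec_le_of_components) (simp add: dw)
    have fK: "norm (f \<zeta> - z) \<le> K * cmod \<zeta>" if "cmod \<zeta> < 1" for \<zeta>
    proof -
      have "norm (f \<zeta> - z) \<le> real CARD('n) * ((2 * M + 1) * cmod \<zeta>)"
        using S(2)[OF that] by (intro norm_vec_le_of_components) simp
      then show ?thesis by (simp add: K_def n_def mult.assoc)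
    qed
    have "wt z w \<le> C1 + C2"
    proof (cases "h \<le> h\<^sub>0")
      case False
      have "cmod (cpart (F1 z) w) \<le> 2 * norm (F1 z) * norm w" by (rule norm_cpart)
      also have "\<dots> \<le> 2 * M * K" using F1_le[OF z] wK csts(1) by (intro mult_mono) auto
      finally have "cmod (cpart (F1 z) w) / h \<le> 2 * M * K / h\<^sub>0"
        using False csts K by (intro frac_le) auto
      moreover have "norm w / sqrt h \<le> K / sqrt h\<^sub>0"
        using False csts K wK by (intro frac_le) auto
      ultimately have "wt z w \<le> C1" by (simp add: wt_def C1_def h_def)
      then show ?thesis using C2 by simp
    next
      case True
      have fr: "norm (f \<zeta> - z) \<le> r" if "cmod \<zeta> < s" for \<zeta>
      proof -
        have "norm (f \<zeta> - z) \<le> K * cmod \<zeta>" using fK that s by simp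
        also have "\<dots> \<le> K * s" using that K by (intro mult_left_mono) auto
        finally show ?thesis using K by (simp add: s_def)
      qed
      define g where "g \<zeta> = cpart (F1 z) (f \<zeta> - z) + holq (F2 z) (f \<zeta> - z) (f \<zeta> - z)" for \<zeta>
      have g_eq: "g = (\<lambda>\<zeta>. (\<Sum>j\<in>UNIV. (f \<zeta> $ j - z $ j) * cpart (F1 z) (axis j 1)) +
          (\<Sum>j\<in>UNIV. \<Sum>k\<in>UNIV. (f \<zeta> $ j - z $ j) * (f \<zeta> $ k - z $ k) * holq (F2 z) (axis j 1) (axis k 1)))"
        unfolding g_def
        by (rule ext) (simp add: cpart_sum_axis[of "F1 z" "f _ - z"] holq_sum_axis[of "F2 z" "f _ - z"])
      have holg: "g holomorphic_on ball 0 s"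
        unfolding g_eq using s(2)
        by (intro holomorphic_intros holomorphic_on_subset[OF holf]) auto
      have g0: "g 0 = 0" unfolding g_eq by (simp add: z0)
      have Reg: "Re (g \<zeta>) + c * (norm (f \<zeta> - z))\<^sup>2 < h" if "cmod \<zeta> < s" for \<zeta>
      proof -
        have "\<rho> z + F1 z (f \<zeta> - z) + Re (holq (F2 z) (f \<zeta> - z) (f \<zeta> - z)) + c * (norm (f \<zeta> - z))\<^sup>2 \<le> \<rho> (z + (f \<zeta> - z))"
          using True fr[OF that] by (intro levi_ge[OF z]) (auto simp: h_def ht_def)
        moreover have "\<rho> (f \<zeta>) < 0" using that s by (intro neg fO) auto
        ultimately show ?thesis by (simp add: g_def h_def ht_def)
      qed
      have Reg': "\<forall>\<zeta>. cmod \<zeta> < s \<longrightarrow> Re (g \<zeta>) < h"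
      proof (intro allI impI)
        fix \<zeta> assume "cmod \<zeta> < s"
        moreover have "0 \<le> c * (norm (f \<zeta> - z))\<^sup>2" using csts(6) by simp
        ultimately show "Re (g \<zeta>) < h" using Reg[of \<zeta>] by linarith
      qed
      note BC = borel_caratheodory_zero[OF holg s(1) h g0 Reg']
      \<comment> \<open>The quadratic part of \<open>g\<close> vanishes to second order at 0, so
        only the linear functional contributes.\<close>
      have "(g has_field_derivative (\<Sum>j\<in>UNIV. w $ j * cpart (F1 z) (axis j 1))) (at 0)"
        unfolding g_eq by (rule derivative_eq_intros dfz refl | simp add: z0)+
      then have "deriv g 0 = cpart (F1 z) w"
        unfolding cpart_sum_axis[of "F1 z" w] by (rule DERIV_imp_deriv)
      then have N1: "cmod (cpart (F1 z) w) / h \<le> 2 / s" using BC(1) h s by (simp add: field_simps)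
      have half: "norm (f \<zeta> - z) \<le> sqrt (3 / c) * sqrt h" if "cmod \<zeta> \<le> s / 2" for \<zeta>
      proof -
        have "- Re (g \<zeta>) \<le> 2 * h" using BC(2)[OF that] abs_Re_le_cmod[of "g \<zeta>"] by linarith
        then have "c * (norm (f \<zeta> - z))\<^sup>2 \<le> 3 * h" using Reg[of \<zeta>] that s by simp
        then have "(norm (f \<zeta> - z))\<^sup>2 \<le> 3 / c * h" using csts(6) by (simp add: field_simps)
        then have "norm (f \<zeta> - z) \<le> sqrt (3 / c * h)" by (rule real_le_rsqrt)
        then show ?thesis by (simp only: real_sqrt_mult)
      qed
      \<comment> \<open>Twice the bound for \<open>f - z\<close>, because
        \<open>schwarz_scaled\<close> asks for a strict inequality.\<close>
      define B where "B = 2 * (sqrt (3 / c) * sqrt h)"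
      have B: "B > 0" using csts(6) h by (simp add: B_def)
      have cw: "cmod (w $ j) \<le> B / (s / 2)" for j
      proof -
        have "cmod (deriv (\<lambda>\<zeta>. f \<zeta> $ j - z $ j) 0) \<le> B / (s / 2)"
        proof (rule schwarz_scaled(1))
          show "(\<lambda>\<zeta>. f \<zeta> $ j - z $ j) holomorphic_on ball 0 (s / 2)"
            using s by (intro holomorphic_on_subset[OF holfz]) auto
          show "\<forall>\<zeta>. cmod \<zeta> < s / 2 \<longrightarrow> cmod (f \<zeta> $ j - z $ j) < B"
          proof (intro allI impI)
            fix \<zeta> :: complex assume that: "cmod \<zeta> < s / 2"
            have "cmod (f \<zeta> $ j - z $ j) \<le> norm (f \<zeta> - z)" using Finite_Cartesian_Product.norm_nth_le[of "f \<zeta> - z" j] by simp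
            also have "\<dots> \<le> B / 2" using half[of \<zeta>] that by (simp add: B_def)
            also have "\<dots> < B" using B by simp
            finally show "cmod (f \<zeta> $ j - z $ j) < B" .
          qed
        qed (use s B z0 in auto)
        then show ?thesis by (simp add: dw)
      qed
      have "norm w \<le> n * (B / (s / 2))" unfolding n_def by (rule norm_vec_le_of_components[OF cw])
      also have "\<dots> = n * (4 * sqrt (3 / c) / s) * sqrt h" by (simp add: B_def)
      finally have N2: "norm w / sqrt h \<le> n * (4 * sqrt (3 / c) / s)" using h by (simp add: pos_divide_le_eq)
      have "wt z w \<le> C2" using N1 N2 unfolding wt_def C2_def h_def by linarith
      then show ?thesis using C1 by simp
    qed
    then show "wt z (\<chi> j. deriv (\<lambda>\<zeta>. f \<zeta> $ j) 0) \<le> C1 + C2" by (simp add: w_def)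
  qed
qed

lemma kobayashi_metric_ge:
  obtains C where "C > 0" "\<forall>z v. z \<in> \<Omega> \<longrightarrow> ennreal (wt z v / C) \<le> kobayashi_metric \<Omega> z v"
proof -
  obtain C where C: "C > 0"
    "\<forall>(f :: complex \<Rightarrow> complex^'n) z. (\<forall>j. (\<lambda>\<zeta>. f \<zeta> $ j) holomorphic_on ball 0 1) \<longrightarrow> f ` ball 0 1 \<subseteq> \<Omega> \<longrightarrow> f 0 = z
       \<longrightarrow> wt z (\<chi> j. deriv (\<lambda>\<zeta>. f \<zeta> $ j) 0) \<le> C"
    by (rule disc_derivative_bound)
  show thesis
  proof (rule that[OF C(1)], intro allI impI)
    fix z v assume z: "z \<in> \<Omega>"
    show "ennreal (wt z v / C) \<le> kobayashi_metric \<Omega> z v"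
      unfolding kobayashi_metric_def
    proof (rule Inf_greatest, clarify)
      fix \<xi> and f :: "complex \<Rightarrow> complex^'n" assume f: "\<forall>j. (\<lambda>\<zeta>. f \<zeta> $ j) holomorphic_on ball 0 1" "f ` ball 0 1 \<subseteq> \<Omega>" "z = f 0"
        "\<forall>j. deriv (\<lambda>\<zeta>. f \<zeta> $ j) 0 * \<xi> = v $ j"
      have "v = \<xi> *s (\<chi> j. deriv (\<lambda>\<zeta>. f \<zeta> $ j) 0)"
        using f(4) by (simp add: vec_eq_iff mult.commute)
      then have "wt z v = cmod \<xi> * wt z (\<chi> j. deriv (\<lambda>\<zeta>. f \<zeta> $ j) 0)" by (metis wt_csmult)
      also have "\<dots> \<le> cmod \<xi> * C" using f by (intro mult_left_mono C(2)[rule_format]) auto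
      finally show "ennreal (wt (f 0) v / C) \<le> ennreal (cmod \<xi>)"
        using C(1) f(3) by (intro ennreal_leI) (simp add: field_simps)
    qed
  qed
qed

end

section \<open>Upper bounds for the Kobayashi distance\<close>

lemma absolutely_continuous_on_lipschitz:
  assumes "\<And>s t. \<lbrakk>a \<le> s; s \<le> t; t \<le> b\<rbrakk> \<Longrightarrow> dist (\<sigma> s) (\<sigma> t) \<le> L * (t - s)" "L \<ge> 0"
  shows "absolutely_continuous_on a b \<sigma>"
  unfolding absolutely_continuous_on_def
proof (intro allI impI)
  fix e :: real assume "e > 0"
  have "(\<Sum>i<m. dist (\<sigma> (s i)) (\<sigma> (t i))) < e"
    if "\<forall>i<m. a \<le> s i \<and> s i \<le> t i \<and> t i \<le> b" "(\<Sum>i<m. t i - s i) < e / (L + 1)" for m :: nat and s t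
  proof -
    have "(\<Sum>i<m. dist (\<sigma> (s i)) (\<sigma> (t i))) \<le> (\<Sum>i<m. L * (t i - s i))"
      using that(1) by (intro sum_mono assms(1)) auto
    also have "\<dots> = L * (\<Sum>i<m. t i - s i)" by (simp add: sum_distrib_left)
    also have "\<dots> \<le> L * (e / (L + 1))" using that(2) assms(2) by (intro mult_left_mono) auto
    also have "\<dots> < e" using \<open>e > 0\<close> assms(2) by (simp add: field_simps)
    finally show ?thesis .
  qed
  then show "\<exists>\<delta>>0. \<forall>(m::nat) s t. (\<forall>i<m. a \<le> s i \<and> s i \<le> t i \<and> t i \<le> b) \<longrightarrow>
       (\<forall>i<m. \<forall>j<m. i \<noteq> j \<longrightarrow> {s i<..<t i} \<inter> {s j<..<t j} = {}) \<longrightarrow>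
       (\<Sum>i<m. t i - s i) < \<delta> \<longrightarrow> (\<Sum>i<m. dist (\<sigma> (s i)) (\<sigma> (t i))) < e"
    using \<open>e > 0\<close> assms(2) by (intro exI[of _ "e / (L + 1)"]) auto
qed

text \<open>Polygonal paths: \<open>kchain \<Omega> p q w\<close> says that \<open>p\<close> and \<open>q\<close> are joined by finitely many
  segments in \<open>\<Omega>\<close> whose Kobayashi lengths, in both directions, add up to at most \<open>w\<close>.\<close>

definition kseg :: "(complex^'n::finite) set \<Rightarrow> complex^'n \<Rightarrow> complex^'n \<Rightarrow> real \<Rightarrow> bool" where
  "kseg \<Omega> p q w \<longleftrightarrow> 0 \<le> w \<and> (\<forall>t\<in>{0..1}. p + t *\<^sub>R (q - p) \<in> \<Omega> \<and>
     kobayashi_metric \<Omega> (p + t *\<^sub>R (q - p)) (q - p) \<le> ennreal w \<and>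
     kobayashi_metric \<Omega> (p + t *\<^sub>R (q - p)) (p - q) \<le> ennreal w)"

inductive kchain :: "(complex^'n::finite) set \<Rightarrow> complex^'n \<Rightarrow> complex^'n \<Rightarrow> real \<Rightarrow> bool" for \<Omega> where
  refl: "\<lbrakk>p \<in> \<Omega>; 0 \<le> w\<rbrakk> \<Longrightarrow> kchain \<Omega> p p w"
| step: "\<lbrakk>kchain \<Omega> p q w; kseg \<Omega> q q' w'\<rbrakk> \<Longrightarrow> kchain \<Omega> p q' (w + w')"

lemma kseg_sym: "kseg \<Omega> p q w \<Longrightarrow> kseg \<Omega> q p w"
proof -
  assume a: "kseg \<Omega> p q w"
  have "q + t *\<^sub>R (p - q) \<in> \<Omega> \<and> kobayashi_metric \<Omega> (q + t *\<^sub>R (p - q)) (p - q) \<le> ennreal w \<and>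
     kobayashi_metric \<Omega> (q + t *\<^sub>R (p - q)) (q - p) \<le> ennreal w" if "t \<in> {0..1}" for t
  proof -
    have "q + t *\<^sub>R (p - q) = p + (1 - t) *\<^sub>R (q - p)" by (simp add: algebra_simps)
    moreover have "1 - t \<in> {0..1}" using that by auto
    ultimately show ?thesis using a unfolding kseg_def by metis
  qed
  then show ?thesis using a by (simp add: kseg_def)
qed

lemma kseg_ends: "kseg \<Omega> p q w \<Longrightarrow> p \<in> \<Omega> \<and> q \<in> \<Omega>"
proof -
  assume "kseg \<Omega> p q w"
  then have *: "\<forall>t\<in>{0..1}. p + t *\<^sub>R (q - p) \<in> \<Omega>" by (simp add: kseg_def)
  show ?thesis using bspec[OF *, of 0] bspec[OF *, of 1] by simp
qed

lemma kseg_nonneg: "kseg \<Omega> p q w \<Longrightarrow> 0 \<le> w"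
  by (simp add: kseg_def)

lemma kchain_ends: "kchain \<Omega> p q w \<Longrightarrow> p \<in> \<Omega> \<and> q \<in> \<Omega> \<and> 0 \<le> w"
  by (induction rule: kchain.induct) (auto dest: kseg_ends kseg_nonneg)

lemma kchain_mono: "kchain \<Omega> p q w \<Longrightarrow> w \<le> w' \<Longrightarrow> kchain \<Omega> p q w'"
proof (induction arbitrary: w' rule: kchain.induct)
  case (step p q w q' v)
  then have "kchain \<Omega> p q (w' - v)" by simp
  from kchain.step[OF this step.hyps(2)] show ?case by simp
qed (auto intro: kchain.refl)

lemma kchain_trans:
  assumes "kchain \<Omega> p q w" "kchain \<Omega> q s w'"
  shows "kchain \<Omega> p s (w + w')"
  using assms(2,1)
proof (induction rule: kchain.induct)
  case (refl q w')
  then show ?case by (auto intro: kchain_mono)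
next
  case (step q q1 v q2 v')
  then show ?case using kchain.step[of \<Omega> p q1 "w + v" q2 v'] by (simp add: add.assoc)
qed

lemma kseg_kchain: "kseg \<Omega> p q w \<Longrightarrow> kchain \<Omega> p q w"
  using kchain.step[OF kchain.refl[of p \<Omega> 0]] kseg_ends by force

lemma kchain_sym: "kchain \<Omega> p q w \<Longrightarrow> kchain \<Omega> q p w"
proof (induction rule: kchain.induct)
  case (step p q w q' w')
  have "kchain \<Omega> q' p (w' + w)"
    using kchain_trans[OF kseg_kchain[OF kseg_sym[OF step.hyps(2)]] step.IH] .
  then show ?case by (simp add: add.commute)
qed (auto intro: kchain.refl)

text \<open>Each segment takes unit time. A measurable majorant \<open>B\<close> of the metric is
  carried through the induction because the integral of a sum splits only for measurable functions.
  The bound is stated almost everywhere, as the curve may have no derivative at the break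
  points.\<close>

lemma kchain_curve:
  assumes "kchain \<Omega> p q w"
  shows "\<exists>(n::nat) \<sigma> L B. 0 \<le> L \<and> (\<forall>s t. 0 \<le> s \<and> s \<le> t \<and> t \<le> real n \<longrightarrow> dist (\<sigma> s) (\<sigma> t) \<le> L * (t - s)) \<and>
    \<sigma> ` {0..real n} \<subseteq> \<Omega> \<and> \<sigma> 0 = p \<and> \<sigma> (real n) = q \<and> B \<in> borel_measurable lebesgue \<and>
    (\<integral>\<^sup>+ t. B t \<partial>lebesgue) \<le> ennreal w \<and>
    (AE t in lebesgue. t \<in> {0<..<real n} \<longrightarrow> kobayashi_metric \<Omega> (\<sigma> t) (vector_derivative \<sigma> (at t)) \<le> B t)"
  using assms
proof (induction rule: kchain.induct)
  case (refl p w)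
  then show ?case
    by (intro exI[of _ "0::nat"] exI[of _ "\<lambda>t. p"] exI[of _ "0::real"] exI[of _ "\<lambda>t. 0"]) auto
next
  case (step p q w q' w')
  from step.IH obtain n \<sigma> L B where IH: "0 \<le> L" "\<forall>s t. 0 \<le> s \<and> s \<le> t \<and> t \<le> real n \<longrightarrow> dist (\<sigma> s) (\<sigma> t) \<le> L * (t - s)"
    "\<sigma> ` {0..real n} \<subseteq> \<Omega>" "\<sigma> 0 = p" "\<sigma> (real n) = q" and B: "B \<in> borel_measurable lebesgue"
    "(\<integral>\<^sup>+ t. B t \<partial>lebesgue) \<le> ennreal w"
    "AE t in lebesgue. t \<in> {0<..<real n} \<longrightarrow> kobayashi_metric \<Omega> (\<sigma> t) (vector_derivative \<sigma> (at t)) \<le> B t"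
    by (elim exE conjE)
  have w: "0 \<le> w" "0 \<le> w'" using kchain_ends[OF step.hyps(1)] step.hyps(2) by (auto simp: kseg_def)
  define u where "u = q' - q"
  define \<tau> where "\<tau> t = (if t \<le> real n then \<sigma> t else q + (t - real n) *\<^sub>R u)" for t
  define L' where "L' = L + norm u"
  define B' where "B' t = B t + ennreal w' * indicator {real n..real n + 1} t" for t
  have \<tau>2: "\<tau> t = q + (t - real n) *\<^sub>R u" if "real n \<le> t" for t
    using that IH(5) by (cases "t = real n") (auto simp: \<tau>_def)
  have \<tau>1: "\<tau> t = \<sigma> t" if "t \<le> real n" for t using that by (simp add: \<tau>_def)
  have d2: "dist (\<tau> s) (\<tau> t) \<le> norm u * (t - s)" if "real n \<le> s" "s \<le> t" for s t
  proof -
    have "\<tau> s - \<tau> t = (s - t) *\<^sub>R u" using that by (simp add: \<tau>2 algebra_simps)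
    then show ?thesis using that by (simp add: dist_norm)
  qed
  have lip: "dist (\<tau> s) (\<tau> t) \<le> L' * (t - s)" if st: "0 \<le> s" "s \<le> t" for s t
  proof -
    consider "t \<le> real n" | "real n \<le> s" | "s \<le> real n" "real n \<le> t" by linarith
    then show ?thesis
    proof cases
      case 1
      then have "dist (\<tau> s) (\<tau> t) \<le> L * (t - s)" using IH(2) st by (simp add: \<tau>1)
      also have "\<dots> \<le> L' * (t - s)" using st by (intro mult_right_mono) (auto simp: L'_def)
      finally show ?thesis .
    next
      case 2
      then have "dist (\<tau> s) (\<tau> t) \<le> norm u * (t - s)" using d2 st by simp
      also have "\<dots> \<le> L' * (t - s)" using st IH(1) by (intro mult_right_mono) (auto simp: L'_def)
      finally show ?thesis .
    next
      case 3
      have "dist (\<tau> s) (\<tau> t) \<le> dist (\<tau> s) (\<tau> (real n)) + dist (\<tau> (real n)) (\<tau> t)" by (rule dist_triangle)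
      also have "\<dots> \<le> L * (real n - s) + norm u * (t - real n)"
        using IH(2)[rule_format, of s "real n"] d2[of "real n" t] 3 st by (intro add_mono) (auto simp: \<tau>1)
      also have "\<dots> \<le> L' * (real n - s) + L' * (t - real n)"
        using 3 IH(1) by (intro add_mono mult_right_mono) (auto simp: L'_def)
      finally show ?thesis by (simp add: algebra_simps)
    qed
  qed
  have im: "\<tau> ` {0..real (Suc n)} \<subseteq> \<Omega>"
  proof clarify
    fix t assume t: "t \<in> {0..real (Suc n)}"
    show "\<tau> t \<in> \<Omega>"
    proof (cases "t \<le> real n")
      case True
      then show ?thesis using IH(3) t by (auto simp: \<tau>1)
    next
      case False
      then have "t - real n \<in> {0..1}" using t by auto
      then show ?thesis using step.hyps(2) False by (auto simp: \<tau>2 kseg_def u_def)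
    qed
  qed
  have "AE t in lebesgue. t \<noteq> real n"
    using AE_completion[OF AE_lborel_singleton] by blast
  with B(3) have "AE t in lebesgue. t \<in> {0<..<real (Suc n)} \<longrightarrow> kobayashi_metric \<Omega> (\<tau> t) (vector_derivative \<tau> (at t)) \<le> B' t"
  proof eventually_elim
    fix t assume t: "t \<in> {0<..<real n} \<longrightarrow> kobayashi_metric \<Omega> (\<sigma> t) (vector_derivative \<sigma> (at t)) \<le> B t" "t \<noteq> real n"
    show "t \<in> {0<..<real (Suc n)} \<longrightarrow> kobayashi_metric \<Omega> (\<tau> t) (vector_derivative \<tau> (at t)) \<le> B' t"
    proof
      assume tn: "t \<in> {0<..<real (Suc n)}"
      show "kobayashi_metric \<Omega> (\<tau> t) (vector_derivative \<tau> (at t)) \<le> B' t"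
      proof (cases "t < real n")
        case True
        have "eventually (\<lambda>x. \<tau> x = \<sigma> x) (nhds t)"
          by (rule eventually_nhds_in_open[of "{..<real n}", THEN eventually_mono]) (use True in \<open>auto simp: \<tau>1\<close>)
        then have "vector_derivative \<tau> (at t) = vector_derivative \<sigma> (at t)"
          by (intro vector_derivative_cong_eq) auto
        then have "kobayashi_metric \<Omega> (\<tau> t) (vector_derivative \<tau> (at t)) \<le> B t"
          using t True tn by (simp add: \<tau>1)
        then show ?thesis by (auto simp: B'_def intro: order_trans)
      next
        case False
        then have tgt: "t > real n" using t(2) by simp
        have "((\<lambda>x. q + (x - real n) *\<^sub>R u) has_vector_derivative u) (at t)"
          by (auto intro!: derivative_eq_intros)
        then have "(\<tau> has_vector_derivative u) (at t)"
          by (rule has_vector_derivative_transform_within_open[of _ _ _ "{real n<..}"]) (use tgt in \<open>auto simp: \<tau>2\<close>)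
        then have "vector_derivative \<tau> (at t) = u" by (rule vector_derivative_at)
        moreover have "t - real n \<in> {0..1}" using tn tgt by auto
        ultimately have "kobayashi_metric \<Omega> (\<tau> t) (vector_derivative \<tau> (at t)) \<le> ennreal w'"
          using step.hyps(2) tgt by (auto simp: \<tau>2 kseg_def u_def)
        also have "\<dots> \<le> B' t" using tn tgt by (auto simp: B'_def)
        finally show ?thesis .
      qed
    qed
  qed
  moreover have "(\<integral>\<^sup>+ t. B' t \<partial>lebesgue) \<le> ennreal (w + w')"
  proof -
    have [measurable]: "{real n..real n + 1} \<in> sets lebesgue" by simp
    have "(\<lambda>t. ennreal w' * indicator {real n..real n + 1} t) \<in> borel_measurable lebesgue" by measurable
    then have "(\<integral>\<^sup>+ t. B' t \<partial>lebesgue) = (\<integral>\<^sup>+ t. B t \<partial>lebesgue) + (\<integral>\<^sup>+ t. ennreal w' * indicator {real n..real n + 1} t \<partial>lebesgue)"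
      unfolding B'_def using B(1) by (intro nn_integral_add)
    also have "(\<integral>\<^sup>+ t. ennreal w' * indicator {real n..real n + 1} t \<partial>lebesgue) = ennreal w'"
      by (subst nn_integral_cmult_indicator) auto
    finally show ?thesis using B(2) w by (simp add: ennreal_plus add_right_mono)
  qed
  moreover have "B' \<in> borel_measurable lebesgue" unfolding B'_def using B(1)
    by (intro borel_measurable_add borel_measurable_times_ennreal borel_measurable_const borel_measurable_indicator) auto
  moreover have "\<tau> 0 = p" "\<tau> (real (Suc n)) = q'" using IH(4) by (auto simp: \<tau>_def u_def)
  moreover have "0 \<le> L'" using IH(1) by (simp add: L'_def)
  ultimately show ?case using lip im by (intro exI[of _ "Suc n"] exI[of _ \<tau>] exI[of _ L'] exI[of _ B']) auto
qed

lemma kobayashi_dist_le_kchain: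
  assumes "kchain \<Omega> p q w"
  shows "kobayashi_dist \<Omega> p q \<le> ennreal w"
proof -
  from kchain_curve[OF assms] obtain n :: nat and \<sigma> L B where s: "0 \<le> L" "\<forall>s t. 0 \<le> s \<and> s \<le> t \<and> t \<le> real n \<longrightarrow> dist (\<sigma> s) (\<sigma> t) \<le> L * (t - s)"
    "\<sigma> ` {0..real n} \<subseteq> \<Omega>" "\<sigma> 0 = p" "\<sigma> (real n) = q" "B \<in> borel_measurable lebesgue"
    "(\<integral>\<^sup>+ t. B t \<partial>lebesgue) \<le> ennreal w"
    "AE t in lebesgue. t \<in> {0<..<real n} \<longrightarrow> kobayashi_metric \<Omega> (\<sigma> t) (vector_derivative \<sigma> (at t)) \<le> B t"
    by (elim exE conjE)
  have "AE t in lebesgue. t \<noteq> 0" "AE t in lebesgue. t \<noteq> real n"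
    using AE_completion[OF AE_lborel_singleton] by blast+
  with s(8) have "AE t in lebesgue. kobayashi_metric \<Omega> (\<sigma> t) (vector_derivative \<sigma> (at t)) * indicator {0..real n} t \<le> B t"
    by eventually_elim (auto simp: indicator_def)
  then have "(\<integral>\<^sup>+ t \<in> {0..real n}. kobayashi_metric \<Omega> (\<sigma> t) (vector_derivative \<sigma> (at t)) \<partial>lebesgue) \<le> (\<integral>\<^sup>+ t. B t \<partial>lebesgue)"
    by (rule nn_integral_mono_AE)
  also have "\<dots> \<le> ennreal w" by fact
  finally have "(\<integral>\<^sup>+ t \<in> {0..real n}. kobayashi_metric \<Omega> (\<sigma> t) (vector_derivative \<sigma> (at t)) \<partial>lebesgue) \<le> ennreal w" .
  moreover have ac: "absolutely_continuous_on 0 (real n) \<sigma>"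
    using s(1,2) by (intro absolutely_continuous_on_lipschitz) auto
  have "kobayashi_dist \<Omega> p q \<le> (\<integral>\<^sup>+ t \<in> {0..real n}. kobayashi_metric \<Omega> (\<sigma> t) (vector_derivative \<sigma> (at t)) \<partial>lebesgue)"
    unfolding kobayashi_dist_def
    by (rule Inf_lower, rule CollectI, rule exI[of _ "0::real"], rule exI[of _ "real n"], rule exI[of _ \<sigma>])
      (use s(3,4,5) ac in auto)
  ultimately show ?thesis by (rule order_trans[rotated])
qed

section \<open>Chains of segments that are short in the weight\<close>

context spd
begin

text \<open>The height at least stays above one half of its value at \<open>p\<close>. The change of
  the normal functional, applied to \<open>u\<close>, is at most \<open>norm u * sqrt h / 2\<close>,
  which the tangential term of the weight absorbs.\<close>

lemma wt_segment:
  assumes p: "p \<in> \<Omega>" and u: "wt p u \<le> a\<^sub>0" and t: "0 \<le> t" "t \<le> 1"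
  shows "p + t *\<^sub>R u \<in> \<Omega>" "wt (p + t *\<^sub>R u) u \<le> 3 * wt p u"
proof -
  define h where "h = ht p"
  have h: "0 < h" using ht_pos[OF p] by (simp add: h_def)
  let ?z = "p + t *\<^sub>R u"
  have "wt p (t *\<^sub>R u) \<le> a\<^sub>0"
    unfolding wt_scaleR using t u wt_nonneg[OF p, of u] mult_left_le_one_le[of "wt p u" t] by simp
  note i = inside_wt[OF p this]
  show z: "?z \<in> \<Omega>" by (rule i(1))
  have hz: "h / 2 \<le> ht ?z" using i(2) by (simp add: h_def)
  have nu: "norm u \<le> a\<^sub>0 * sqrt h" using wtD(1)[OF p u] by (simp add: h_def)
  have "norm (F1 ?z - F1 p) \<le> M * norm (?z - p)" by (rule F1_lip[OF z p])
  also have "\<dots> \<le> M * norm u" using t csts(1) by (intro mult_left_mono) (auto simp: mult_left_le_one_le)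
  finally have F: "norm (F1 ?z - F1 p) \<le> M * norm u" .
  have "cmod (cpart (F1 ?z) u) \<le> cmod (cpart (F1 p) u) + cmod (cpart (F1 ?z - F1 p) u)"
    unfolding cpart_diff_left by (metis norm_triangle_sub)
  also have "cmod (cpart (F1 ?z - F1 p) u) \<le> 2 * norm (F1 ?z - F1 p) * norm u" by (rule norm_cpart)
  also have "\<dots> \<le> 2 * (M * norm u) * norm u" using F by (intro mult_right_mono mult_left_mono) auto
  also have "\<dots> \<le> 2 * (M * norm u) * (a\<^sub>0 * sqrt h)" using nu csts(1) by (intro mult_left_mono) auto
  also have "\<dots> = (r / 2) * (norm u * sqrt h)" using csts(1) by (simp add: a\<^sub>0_def)
  also have "\<dots> \<le> (1 / 2) * (norm u * sqrt h)" using csts h by (intro mult_right_mono) auto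
  finally have c1: "cmod (cpart (F1 ?z) u) \<le> cmod (cpart (F1 p) u) + norm u * sqrt h / 2" by simp
  have "cmod (cpart (F1 ?z) u) / ht ?z \<le> (cmod (cpart (F1 p) u) + norm u * sqrt h / 2) / (h / 2)"
    using c1 hz h by (intro frac_le) auto
  also have "\<dots> = 2 * (cmod (cpart (F1 p) u) / h) + norm u / sqrt h"
    using h by (simp add: field_simps)
  finally have 1: "cmod (cpart (F1 ?z) u) / ht ?z \<le> 2 * (cmod (cpart (F1 p) u) / h) + norm u / sqrt h" .
  have "sqrt h / 2 \<le> sqrt (ht ?z)"
  proof -
    have "sqrt h / 2 = sqrt (h / 4)" by (simp add: real_sqrt_divide)
    also have "\<dots> \<le> sqrt (ht ?z)" using hz h by simp
    finally show ?thesis .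
  qed
  then have "norm u / sqrt (ht ?z) \<le> norm u / (sqrt h / 2)" using h by (intro frac_le) auto
  then have 2: "norm u / sqrt (ht ?z) \<le> 2 * (norm u / sqrt h)" by (simp add: mult.commute)
  have "0 \<le> cmod (cpart (F1 p) u) / h" using h by simp
  with 1 2 show "wt ?z u \<le> 3 * wt p u" unfolding wt_def[of ?z] wt_def[of p] h_def[symmetric] by argo
qed

text \<open>The 3 is the growth of the weight in \<open>wt_segment\<close>, the
  \<open>1 / a\<^sub>0\<close> is the constant of \<open>kobayashi_metric_le\<close>.\<close>

definition C\<^sub>u :: real where "C\<^sub>u = 3 / a\<^sub>0"

lemma Cu_pos: "0 < C\<^sub>u" using a0(1) by (simp add: C\<^sub>u_def)

lemma kchain_wt:
  assumes p: "p \<in> \<Omega>" and u: "wt p (q - p) \<le> a\<^sub>0"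
  shows "kchain \<Omega> p q (C\<^sub>u * wt p (q - p))"
proof (rule kseg_kchain)
  show "kseg \<Omega> p q (C\<^sub>u * wt p (q - p))"
    unfolding kseg_def
  proof (intro conjI ballI)
    show "0 \<le> C\<^sub>u * wt p (q - p)" using Cu_pos wt_nonneg[OF p] by simp
    fix t :: real assume "t \<in> {0..1}"
    then have t: "0 \<le> t" "t \<le> 1" by auto
    let ?z = "p + t *\<^sub>R (q - p)"
    note s = wt_segment[OF p u t]
    show "?z \<in> \<Omega>" by (rule s(1))
    have w: "wt ?z (q - p) / a\<^sub>0 \<le> C\<^sub>u * wt p (q - p)"
      using s(2) a0(1) by (simp add: C\<^sub>u_def field_simps)
    show "kobayashi_metric \<Omega> ?z (q - p) \<le> ennreal (C\<^sub>u * wt p (q - p))"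
      using kobayashi_metric_le[OF s(1), of "q - p"] ennreal_leI[OF w] by (rule order_trans)
    have "wt ?z (p - q) = wt ?z (q - p)"
      using wt_scaleR[of ?z "-1" "q - p"] by simp
    then show "kobayashi_metric \<Omega> ?z (p - q) \<le> ennreal (C\<^sub>u * wt p (q - p))"
      using order_trans[OF kobayashi_metric_le[OF s(1), of "p - q"]] ennreal_leI[OF w] by simp
  qed
qed

lemma wt_le_norm:
  assumes "z \<in> \<Omega>"
  shows "wt z u \<le> (3 * M / ht z) * norm u"
proof -
  have h: "0 < ht z" "ht z \<le> M" using ht_pos ht_le assms by auto
  have "cmod (cpart (F1 z) u) \<le> 2 * norm (F1 z) * norm u" by (rule norm_cpart)
  also have "\<dots> \<le> 2 * M * norm u" using F1_le[OF assms] by (intro mult_right_mono) auto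
  finally have "cmod (cpart (F1 z) u) / ht z \<le> 2 * M * norm u / ht z" using h by (intro divide_right_mono) auto
  moreover have "norm u / sqrt (ht z) \<le> M * norm u / ht z"
  proof -
    have "sqrt (ht z) \<le> M"
      using h csts(1) by (intro real_le_lsqrt) (auto simp: power2_eq_square intro: order_trans[OF _ mult_left_mono[of 1 M M]])
    then have "sqrt (ht z) * sqrt (ht z) \<le> M * sqrt (ht z)" using h by (intro mult_right_mono) auto
    then have "ht z \<le> M * sqrt (ht z)" using h by simp
    then have "norm u * ht z \<le> norm u * (M * sqrt (ht z))" by (intro mult_left_mono) auto
    then show ?thesis using h by (simp add: field_simps)
  qed
  ultimately have "wt z u \<le> 2 * M * norm u / ht z + M * norm u / ht z" unfolding wt_def by linarith
  also have "\<dots> = (3 * M / ht z) * norm u" using h by (simp add: field_simps)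
  finally show ?thesis .
qed

lemma kchain_near:
  assumes "z \<in> \<Omega>"
  obtains d where "d > 0" "\<forall>q. dist z q < d \<longrightarrow> kchain \<Omega> z q 3"
proof -
  have h: "0 < ht z" using ht_pos assms by auto
  show thesis
  proof (rule that[of "a\<^sub>0 * ht z / (3 * M)"], goal_cases)
    case 1
    then show ?case using a0(1) h csts(1) by simp
  next
    case 2
    show ?case
    proof (intro allI impI)
      fix q assume "dist z q < a\<^sub>0 * ht z / (3 * M)"
      then have "(3 * M / ht z) * norm (q - z) \<le> a\<^sub>0"
        using h csts(1) by (simp add: dist_norm norm_minus_commute field_simps)
      then have w: "wt z (q - z) \<le> a\<^sub>0" using wt_le_norm[OF assms, of "q - z"] by linarith
      have "C\<^sub>u * wt z (q - z) \<le> C\<^sub>u * a\<^sub>0" using w Cu_pos by (intro mult_left_mono) auto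
      also have "\<dots> = 3" using a0(1) by (simp add: C\<^sub>u_def)
      finally show "kchain \<Omega> z q 3" using kchain_mono[OF kchain_wt[OF assms w]] by blast
    qed
  qed
qed

text \<open>Being joined by a chain is an equivalence relation with open classes, and the domain is
  connected.\<close>

lemma kchain_exists:
  assumes "p \<in> \<Omega>" "q \<in> \<Omega>"
  shows "\<exists>w. kchain \<Omega> p q w"
proof (rule connected_equivalence_relation[OF conn assms])
  show "\<exists>w. kchain \<Omega> y x w" if "\<exists>w. kchain \<Omega> x y w" for x y using that kchain_sym by blast
  show "\<exists>w. kchain \<Omega> x z w" if "\<exists>w. kchain \<Omega> x y w" "\<exists>w. kchain \<Omega> y z w" for x y z
    using that kchain_trans by blast
  fix a assume a: "a \<in> \<Omega>"
  obtain d where d: "d > 0" "\<forall>q. dist a q < d \<longrightarrow> kchain \<Omega> a q 3" by (rule kchain_near[OF a])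
  show "\<exists>T. openin (top_of_set \<Omega>) T \<and> a \<in> T \<and> (\<forall>x\<in>T. \<exists>w. kchain \<Omega> a x w)"
    using a d by (intro exI[of _ "\<Omega> \<inter> ball a d"]) auto
qed

text \<open>Finitely many balls, whose points are joined to the centres at cost 3, cover the compact
  set of points of height at least \<open>\<eta>\<close>. All chains run through the base point
  \<open>o'\<close>.\<close>

lemma kchain_core:
  assumes "\<eta> > 0"
  obtains C where "C > 0" "\<forall>p q. p \<in> \<Omega> \<longrightarrow> q \<in> \<Omega> \<longrightarrow> \<eta> \<le> ht p \<longrightarrow> \<eta> \<le> ht q \<longrightarrow> kchain \<Omega> p q C"
proof -
  obtain o' where o': "o' \<in> \<Omega>" using ne by blast
  have "\<forall>z\<in>\<Omega>. \<exists>d. d > 0 \<and> (\<forall>q. dist z q < d \<longrightarrow> kchain \<Omega> z q 3)" using kchain_near by metis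
  then obtain d where d: "\<And>z. z \<in> \<Omega> \<Longrightarrow> d z > 0" "\<And>z q. \<lbrakk>z \<in> \<Omega>; dist z q < d z\<rbrakk> \<Longrightarrow> kchain \<Omega> z q 3"
    by metis
  obtain w where w: "\<And>z. z \<in> \<Omega> \<Longrightarrow> kchain \<Omega> o' z (w z)" using kchain_exists[OF o'] by metis
  define Z where "Z = {z \<in> \<Omega>. \<eta> \<le> ht z}"
  have cZ: "compact Z" using core[OF assms] by (simp add: Z_def ht_def)
  have "Z \<subseteq> (\<Union>z\<in>Z. ball z (d z))" using d(1) by (auto simp: Z_def)
  then obtain T where T: "T \<subseteq> Z" "finite T" "Z \<subseteq> (\<Union>z\<in>T. ball z (d z))"
    by (rule compactE_image[OF cZ, of Z "\<lambda>z. ball z (d z)", OF open_ball])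
  define C where "C = (\<Sum>z\<in>T. w z) + 3"
  have wn: "0 \<le> w z" if "z \<in> \<Omega>" for z using kchain_ends[OF w[OF that]] by simp
  have C: "kchain \<Omega> o' q C" if "q \<in> Z" for q
  proof -
    have "q \<in> (\<Union>z\<in>T. ball z (d z))" using T(3) that by (rule subsetD)
    then obtain z where z: "z \<in> T" "dist z q < d z"
      unfolding UN_iff mem_ball by (elim bexE)
    have zO: "z \<in> \<Omega>" using z T by (auto simp: Z_def)
    have "kchain \<Omega> o' q (w z + 3)" by (rule kchain_trans[OF w[OF zO] d(2)[OF zO z(2)]])
    moreover have "w z \<le> (\<Sum>z\<in>T. w z)" using T z wn by (intro member_le_sum) (auto simp: Z_def)
    ultimately show ?thesis unfolding C_def by (auto intro: kchain_mono)
  qed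
  have "0 \<le> (\<Sum>z\<in>T. w z)" using T wn by (intro sum_nonneg) (auto simp: Z_def)
  then have Cp: "C + C > 0" by (simp add: C_def)
  show thesis
  proof (rule that[OF Cp], intro allI impI)
    fix p q assume "p \<in> \<Omega>" "q \<in> \<Omega>" "\<eta> \<le> ht p" "\<eta> \<le> ht q"
    then show "kchain \<Omega> p q (C + C)"
      using C[of p] C[of q] by (intro kchain_trans[OF kchain_sym]) (auto simp: Z_def)
  qed
qed

end

section \<open>Lower bounds for the Kobayashi distance\<close>

lemma absolutely_continuous_on_imp_continuous_on:
  assumes "absolutely_continuous_on a b \<sigma>"
  shows "continuous_on {a..b} \<sigma>"
  unfolding continuous_on_iff
proof (intro ballI allI impI)
  fix x and e :: real assume x: "x \<in> {a..b}" and "e > 0"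
  obtain d where d: "d > 0" "\<forall>(m::nat) s t. (\<forall>i<m. a \<le> s i \<and> s i \<le> t i \<and> t i \<le> b) \<longrightarrow>
          (\<forall>i<m. \<forall>j<m. i \<noteq> j \<longrightarrow> {s i<..<t i} \<inter> {s j<..<t j} = {}) \<longrightarrow>
          (\<Sum>i<m. t i - s i) < d \<longrightarrow> (\<Sum>i<m. dist (\<sigma> (s i)) (\<sigma> (t i))) < e"
    by (rule absolutely_continuous_onD[OF assms \<open>e > 0\<close>])
  have 1: "dist (\<sigma> s) (\<sigma> t) < e" if "a \<le> s" "s \<le> t" "t \<le> b" "t - s < d" for s t
    using d(2)[THEN spec[of _ 1], THEN spec[of _ "\<lambda>_. s"], THEN spec[of _ "\<lambda>_. t"]] that by simp
  show "\<exists>d>0. \<forall>x'\<in>{a..b}. dist x' x < d \<longrightarrow> dist (\<sigma> x') (\<sigma> x) < e"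
  proof (intro exI[of _ d] conjI ballI impI)
    fix x' assume "x' \<in> {a..b}" "dist x' x < d"
    then show "dist (\<sigma> x') (\<sigma> x) < e"
      using 1[of x x'] 1[of x' x] x by (cases "x \<le> x'") (auto simp: dist_real_def dist_commute)
  qed (rule d(1))
qed

lemma absolutely_continuous_on_subset:
  assumes "absolutely_continuous_on a b \<sigma>" "b' \<le> b"
  shows "absolutely_continuous_on a b' \<sigma>"
  unfolding absolutely_continuous_on_def
proof (intro allI impI)
  fix e :: real assume "e > 0"
  obtain d where d: "d > 0" "\<forall>(m::nat) s t. (\<forall>i<m. a \<le> s i \<and> s i \<le> t i \<and> t i \<le> b) \<longrightarrow>
          (\<forall>i<m. \<forall>j<m. i \<noteq> j \<longrightarrow> {s i<..<t i} \<inter> {s j<..<t j} = {}) \<longrightarrow>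
          (\<Sum>i<m. t i - s i) < d \<longrightarrow> (\<Sum>i<m. dist (\<sigma> (s i)) (\<sigma> (t i))) < e"
    by (rule absolutely_continuous_onD[OF assms(1) \<open>e > 0\<close>])
  show "\<exists>d>0. \<forall>(m::nat) s t. (\<forall>i<m. a \<le> s i \<and> s i \<le> t i \<and> t i \<le> b') \<longrightarrow>
          (\<forall>i<m. \<forall>j<m. i \<noteq> j \<longrightarrow> {s i<..<t i} \<inter> {s j<..<t j} = {}) \<longrightarrow>
          (\<Sum>i<m. t i - s i) < d \<longrightarrow> (\<Sum>i<m. dist (\<sigma> (s i)) (\<sigma> (t i))) < e"
  proof (intro exI[of _ d] conjI allI impI)
    fix m :: nat and s t
    assume 1: "\<forall>i<m. a \<le> s i \<and> s i \<le> t i \<and> t i \<le> b'"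
      and 2: "\<forall>i<m. \<forall>j<m. i \<noteq> j \<longrightarrow> {s i<..<t i} \<inter> {s j<..<t j} = {}" and 3: "(\<Sum>i<m. t i - s i) < d"
    have "\<forall>i<m. a \<le> s i \<and> s i \<le> t i \<and> t i \<le> b" using 1 assms(2) by (meson order_trans)
    then show "(\<Sum>i<m. dist (\<sigma> (s i)) (\<sigma> (t i))) < e" using d(2) 2 3 by blast
  qed (rule d(1))
qed

section \<open>Variation of functionals along curves of bounded Kobayashi length\<close>

context spd
begin

text \<open>Fixed by choice, so that later constants can be defined from it.\<close>

definition C\<^sub>l :: real where
  "C\<^sub>l = (SOME C. C > 0 \<and> (\<forall>z v. z \<in> \<Omega> \<longrightarrow> ennreal (wt z v / C) \<le> kobayashi_metric \<Omega> z v))"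

lemma Cl: "C\<^sub>l > 0" "z \<in> \<Omega> \<Longrightarrow> ennreal (wt z v / C\<^sub>l) \<le> kobayashi_metric \<Omega> z v"
proof -
  have "\<exists>C. C > 0 \<and> (\<forall>z v. z \<in> \<Omega> \<longrightarrow> ennreal (wt z v / C) \<le> kobayashi_metric \<Omega> z v)"
    by (rule kobayashi_metric_ge) blast
  from someI_ex[OF this, folded C\<^sub>l_def]
  show "C\<^sub>l > 0" "z \<in> \<Omega> \<Longrightarrow> ennreal (wt z v / C\<^sub>l) \<le> kobayashi_metric \<Omega> z v" by blast+
qed

lemma ht_lip: "\<lbrakk>p \<in> \<Omega>; q \<in> \<Omega>\<rbrakk> \<Longrightarrow> \<bar>ht p - ht q\<bar> \<le> M * norm (p - q)"
  using rho_lip[of p q] by (simp add: ht_def)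

lemma ht_continuous: "continuous_on \<Omega> ht"
proof -
  have "isCont \<rho> z" if "z \<in> \<Omega>" for z using F1_deriv[OF that] has_derivative_continuous by blast
  then show ?thesis unfolding ht_def by (intro continuous_intros continuous_at_imp_continuous_on) auto
qed

definition curve :: "real \<Rightarrow> real \<Rightarrow> (real \<Rightarrow> complex^'n) \<Rightarrow> real \<Rightarrow> bool" where
  "curve a b \<sigma> w \<longleftrightarrow> a \<le> b \<and> absolutely_continuous_on a b \<sigma> \<and> \<sigma> ` {a..b} \<subseteq> \<Omega> \<and>
     (\<integral>\<^sup>+ t \<in> {a..b}. kobayashi_metric \<Omega> (\<sigma> t) (vector_derivative \<sigma> (at t)) \<partial>lebesgue) \<le> ennreal w"

lemma curve_subset:
  assumes "curve a b \<sigma> w" "a \<le> b'" "b' \<le> b"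
  shows "curve a b' \<sigma> w"
proof -
  have "(\<integral>\<^sup>+ t \<in> {a..b'}. kobayashi_metric \<Omega> (\<sigma> t) (vector_derivative \<sigma> (at t)) \<partial>lebesgue) \<le>
      (\<integral>\<^sup>+ t \<in> {a..b}. kobayashi_metric \<Omega> (\<sigma> t) (vector_derivative \<sigma> (at t)) \<partial>lebesgue)"
    using assms(3) by (intro nn_integral_mono) (auto simp: indicator_def)
  then show ?thesis
    using assms absolutely_continuous_on_subset[of a b \<sigma> b'] unfolding curve_def by (auto intro: order_trans)
qed

lemma curve_exists:
  assumes "kobayashi_dist \<Omega> p q < ennreal w"
  obtains a b \<sigma> where "curve a b \<sigma> w" "\<sigma> a = p" "\<sigma> b = q"
proof -
  from assms obtain a b \<sigma> where
    "(\<integral>\<^sup>+ t \<in> {a..b}. kobayashi_metric \<Omega> (\<sigma> t) (vector_derivative \<sigma> (at t)) \<partial>lebesgue) < ennreal w"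
    "a \<le> b" "absolutely_continuous_on a b \<sigma>" "\<sigma> ` {a..b} \<subseteq> \<Omega>" "\<sigma> a = p" "\<sigma> b = q"
    unfolding kobayashi_dist_def Inf_less_iff by auto
  then show thesis using that[of a b \<sigma>] by (auto simp: curve_def)
qed

text \<open>The source of all lower bounds for the distance: along the curve the derivative of
  \<open>\<psi>\<close> is at most \<open>B\<close> times the weight of the velocity, hence
  \<open>B * C\<^sub>l\<close> times the metric. The Lipschitz condition is imposed on the curve
  only, since the logarithm of the height satisfies it only there.\<close>

lemma curve_functional:
  fixes \<psi> :: "complex^'n \<Rightarrow> real"
  assumes cu: "curve a b \<sigma> w" and "0 \<le> w" "B > 0" "L \<ge> 0"
    and lip: "\<And>s t. \<lbrakk>s \<in> {a..b}; t \<in> {a..b}\<rbrakk> \<Longrightarrow> \<bar>\<psi> (\<sigma> s) - \<psi> (\<sigma> t)\<bar> \<le> L * norm (\<sigma> s - \<sigma> t)"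
    and der: "\<And>z. z \<in> \<sigma> ` {a..b} \<Longrightarrow> (\<psi> has_derivative D z) (at z)"
    and le: "\<And>z v. z \<in> \<sigma> ` {a..b} \<Longrightarrow> \<bar>D z v\<bar> \<le> B * wt z v"
  shows "\<bar>\<psi> (\<sigma> b) - \<psi> (\<sigma> a)\<bar> \<le> B * C\<^sub>l * w"
proof -
  have ab: "a \<le> b" and ac: "absolutely_continuous_on a b \<sigma>" and im: "\<sigma> ` {a..b} \<subseteq> \<Omega>"
    and int: "(\<integral>\<^sup>+ t \<in> {a..b}. kobayashi_metric \<Omega> (\<sigma> t) (vector_derivative \<sigma> (at t)) \<partial>lebesgue) \<le> ennreal w"
    using cu by (auto simp: curve_def)
  have ac\<phi>: "absolutely_continuous_on a b (\<lambda>t. \<psi> (\<sigma> t))"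
    using lip by (intro absolutely_continuous_on_lipschitz_image[OF ac \<open>L \<ge> 0\<close>]) (auto simp: dist_real_def dist_norm)
  define N where "N = {t \<in> {a<..<b}. \<not> \<sigma> differentiable (at t)}"
  have N: "negligible N" unfolding N_def by (rule absolutely_continuous_on_differentiable_ae[OF ac])
  have "ennreal \<bar>\<psi> (\<sigma> b) - \<psi> (\<sigma> a)\<bar> \<le> ennreal (B * C\<^sub>l) *
    (\<integral>\<^sup>+ t \<in> {a..b}. kobayashi_metric \<Omega> (\<sigma> t) (vector_derivative \<sigma> (at t)) \<partial>lebesgue)"
  proof (rule absolutely_continuous_on_diff_le_nn_integral[OF ac\<phi> ab _ N])
    show "B * C\<^sub>l > 0" using \<open>B > 0\<close> Cl(1) by simp
    fix t assume t: "t \<in> {a<..<b} - N"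
    define v where "v = vector_derivative \<sigma> (at t)"
    have "(\<sigma> has_vector_derivative v) (at t)"
      using t by (auto simp: N_def v_def vector_derivative_works)
    then have hd: "(\<sigma> has_derivative (\<lambda>h. h *\<^sub>R v)) (at t)" by (simp add: has_vector_derivative_def)
    have z: "\<sigma> t \<in> \<sigma> ` {a..b}" using t by auto
    then have zO: "\<sigma> t \<in> \<Omega>" using im by blast
    interpret D: bounded_linear "D (\<sigma> t)" using der[OF z] by (rule has_derivative_bounded_linear)
    have "((\<lambda>t. \<psi> (\<sigma> t)) has_derivative (\<lambda>h. D (\<sigma> t) (h *\<^sub>R v))) (at t)"
      by (rule has_derivative_compose[OF hd der[OF z]])
    then have 1: "((\<lambda>t. \<psi> (\<sigma> t)) has_real_derivative D (\<sigma> t) v) (at t)"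
      by (simp add: has_field_derivative_def D.scaleR mult_commute_abs)
    have "\<bar>D (\<sigma> t) v\<bar> / (B * C\<^sub>l) \<le> wt (\<sigma> t) v / C\<^sub>l"
      using le[OF z, of v] \<open>B > 0\<close> Cl(1) by (simp add: field_simps)
    then have "ennreal (\<bar>D (\<sigma> t) v\<bar> / (B * C\<^sub>l)) \<le> ennreal (wt (\<sigma> t) v / C\<^sub>l)" by (rule ennreal_leI)
    also have "\<dots> \<le> kobayashi_metric \<Omega> (\<sigma> t) v" by (rule Cl(2)[OF zO])
    finally show "\<exists>m. ((\<lambda>t. \<psi> (\<sigma> t)) has_real_derivative m) (at t) \<and>
        ennreal (\<bar>m\<bar> / (B * C\<^sub>l)) \<le> kobayashi_metric \<Omega> (\<sigma> t) (vector_derivative \<sigma> (at t))"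
      using 1 by (auto simp: v_def)
  qed
  also have "\<dots> \<le> ennreal (B * C\<^sub>l) * ennreal w" by (rule mult_left_mono[OF int]) simp
  also have "\<dots> = ennreal (B * C\<^sub>l * w)"
    using \<open>B > 0\<close> Cl(1) \<open>0 \<le> w\<close> by (simp add: ennreal_mult)
  finally show ?thesis using \<open>B > 0\<close> Cl(1) \<open>0 \<le> w\<close> by (simp add: ennreal_le_iff)
qed

text \<open>The derivative of the logarithm of the height is bounded by the normal term of the
  weight. Its Lipschitz constant comes from the minimum \<open>m\<close> of the height on the
  compact curve.\<close>

lemma curve_ln_ht:
  assumes cu: "curve a b \<sigma> w" and "0 \<le> w"
  shows "\<bar>ln (ht (\<sigma> b)) - ln (ht (\<sigma> a))\<bar> \<le> C\<^sub>l * w"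
proof -
  have ab: "a \<le> b" and ac: "absolutely_continuous_on a b \<sigma>" and im: "\<sigma> ` {a..b} \<subseteq> \<Omega>"
    using cu by (auto simp: curve_def)
  have "continuous_on {a..b} (\<lambda>t. ht (\<sigma> t))"
    by (rule continuous_on_compose2[OF ht_continuous absolutely_continuous_on_imp_continuous_on[OF ac] im])
  then obtain t0 where t0: "t0 \<in> {a..b}" "\<And>t. t \<in> {a..b} \<Longrightarrow> ht (\<sigma> t0) \<le> ht (\<sigma> t)"
    using continuous_attains_inf[of "{a..b}"] ab by (metis atLeastatMost_empty_iff2 compact_Icc not_le)
  define m where "m = ht (\<sigma> t0)"
  have m: "m > 0" unfolding m_def using t0(1) im by (intro ht_pos) auto
  have "\<bar>ln (ht (\<sigma> b)) - ln (ht (\<sigma> a))\<bar> \<le> 1 * C\<^sub>l * w"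
  proof (rule curve_functional[OF cu \<open>0 \<le> w\<close> zero_less_one, of "M / m"])
    show "0 \<le> M / m" using csts(1) m by simp
    have ln_le: "ln x - ln y \<le> \<bar>x - y\<bar> / m" if "m \<le> x" "m \<le> y" for x y
    proof -
      have "ln x - ln y \<le> (x - y) / y" using that m by (intro ln_diff_le) auto
      also have "\<dots> \<le> \<bar>x - y\<bar> / y" using that m by (intro divide_right_mono) auto
      also have "\<dots> \<le> \<bar>x - y\<bar> / m" using that m by (intro divide_left_mono) auto
      finally show ?thesis .
    qed
    fix s t assume st: "s \<in> {a..b}" "t \<in> {a..b}"
    have "\<bar>ln (ht (\<sigma> s)) - ln (ht (\<sigma> t))\<bar> \<le> \<bar>ht (\<sigma> s) - ht (\<sigma> t)\<bar> / m"
      using ln_le[of "ht (\<sigma> s)" "ht (\<sigma> t)"] ln_le[of "ht (\<sigma> t)" "ht (\<sigma> s)"] t0(2)[OF st(1)] t0(2)[OF st(2)]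
      by (simp add: m_def abs_le_iff abs_minus_commute)
    also have "\<dots> \<le> M * norm (\<sigma> s - \<sigma> t) / m"
    proof (rule divide_right_mono)
      have "\<sigma> s \<in> \<Omega>" "\<sigma> t \<in> \<Omega>" using st im by blast+
      then show "\<bar>ht (\<sigma> s) - ht (\<sigma> t)\<bar> \<le> M * norm (\<sigma> s - \<sigma> t)" by (rule ht_lip)
    qed (use m in simp)
    finally show "\<bar>ln (ht (\<sigma> s)) - ln (ht (\<sigma> t))\<bar> \<le> M / m * norm (\<sigma> s - \<sigma> t)" by simp
  next
    fix z assume "z \<in> \<sigma> ` {a..b}"
    then have z: "z \<in> \<Omega>" using im by blast
    have "((\<lambda>z. - \<rho> z) has_derivative (\<lambda>v. - F1 z v)) (at z)"
      by (rule has_derivative_minus[OF F1_deriv[OF z]])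
    then have "(ht has_derivative (\<lambda>v. - F1 z v)) (at z)" by (simp add: ht_def[abs_def])
    from has_derivative_compose[OF this, of ln "\<lambda>x. inverse (ht z) * x"]
    show "((\<lambda>z. ln (ht z)) has_derivative (\<lambda>v. inverse (ht z) * (- F1 z v))) (at z)"
      using DERIV_ln[of "ht z"] ht_pos[OF z] by (simp add: has_field_derivative_def)
    fix v
    have "\<bar>F1 z v\<bar> \<le> cmod (cpart (F1 z) v)" using abs_Re_le_cmod[of "cpart (F1 z) v"] by simp
    then have "\<bar>F1 z v\<bar> / ht z \<le> cmod (cpart (F1 z) v) / ht z"
      using ht_pos[OF z] by (intro divide_right_mono) auto
    also have "\<dots> \<le> wt z v" using ht_pos[OF z] by (simp add: wt_def)
    finally show "\<bar>inverse (ht z) * (- F1 z v)\<bar> \<le> 1 * wt z v"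
      using ht_pos[OF z] by (simp add: abs_mult field_simps)
  qed
  then show ?thesis by simp
qed

lemma ln_ht_le:
  assumes "kobayashi_dist \<Omega> p q < ennreal w"
  shows "\<bar>ln (ht q) - ln (ht p)\<bar> \<le> C\<^sub>l * w"
proof -
  have "0 \<le> w" using assms by (metis ennreal_neg nle_le not_less_zero)
  obtain a b \<sigma> where "curve a b \<sigma> w" "\<sigma> a = p" "\<sigma> b = q" by (rule curve_exists[OF assms])
  then show ?thesis using curve_ln_ht[of a b \<sigma> w] \<open>0 \<le> w\<close> by simp
qed

text \<open>Three functionals are followed along an almost shortest curve. The logarithm of the
  height keeps the heights below \<open>2 * ht p\<close>; inner products with unit vectors bound the
  Euclidean displacement at every time; the normal functional at \<open>p\<close>, rotated to be
  real and nonnegative at \<open>q - p\<close>, bounds the normal displacement.\<close>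

lemma wt_le_dist:
  assumes d: "kobayashi_dist \<Omega> p q < ennreal w" and w: "C\<^sub>l * w \<le> 1 / 2"
  shows "wt p (q - p) \<le> 8 * M * C\<^sub>l * w"
proof -
  have w0: "0 \<le> w" using d by (metis ennreal_neg nle_le not_less_zero)
  obtain a b \<sigma> where cu: "curve a b \<sigma> w" and \<sigma>: "\<sigma> a = p" "\<sigma> b = q" by (rule curve_exists[OF d])
  have ab: "a \<le> b" and im: "\<sigma> ` {a..b} \<subseteq> \<Omega>" using cu by (auto simp: curve_def)
  have p: "p \<in> \<Omega>" using im \<sigma> ab by auto
  define h where "h = ht p"
  have h: "h > 0" using ht_pos[OF p] by (simp add: h_def)
  have ht2: "ht (\<sigma> t) \<le> 2 * h" if "t \<in> {a..b}" for t
  proof -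
    have t: "\<sigma> t \<in> \<Omega>" using that im by blast
    have "\<bar>ln (ht (\<sigma> t)) - ln (ht (\<sigma> a))\<bar> \<le> C\<^sub>l * w"
      using that by (intro curve_ln_ht[OF curve_subset[OF cu] w0]) auto
    then have "ln (ht (\<sigma> t)) \<le> ln h + 1 / 2" using w by (simp add: \<sigma> h_def)
    also have "1 / 2 \<le> ln (2::real)" using ln2_ge_two_thirds by simp
    finally have "ln (ht (\<sigma> t)) \<le> ln (2 * h)" using h by (simp add: ln_mult)
    then show ?thesis using h ht_pos[OF t] by simp
  qed
  have nv: "norm v \<le> 2 * sqrt h * wt z v" if "z \<in> \<sigma> ` {a..b}" for z v
  proof -
    have z: "z \<in> \<Omega>" using that im by blast
    have "norm v \<le> wt z v * sqrt (ht z)" by (rule wtD(1)[OF z order_refl])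
    \<comment> \<open>Rounding \<open>2 * h\<close> up to \<open>4 * h\<close> gives a rational
      factor after taking the root.\<close>
    also have "\<dots> \<le> wt z v * sqrt (4 * h)"
      using that ht2 h wt_nonneg[OF z] by (intro mult_left_mono) (auto intro!: order_trans[OF ht2])
    finally show ?thesis by (simp add: real_sqrt_mult mult_ac)
  qed
  have euc: "norm (\<sigma> t - p) \<le> 2 * sqrt h * C\<^sub>l * w" if t: "t \<in> {a..b}" for t
  proof (cases "\<sigma> t = p")
    case True
    then show ?thesis using h w0 Cl(1) by simp
  next
    case False
    define e where "e = (\<sigma> t - p) /\<^sub>R norm (\<sigma> t - p)"
    have e: "norm e = 1" using False by (simp add: e_def)
    have cu': "curve a t \<sigma> w" using curve_subset[OF cu] t by auto
    have "\<bar>\<sigma> t \<bullet> e - \<sigma> a \<bullet> e\<bar> \<le> (2 * sqrt h) * C\<^sub>l * w"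
    proof (rule curve_functional[OF cu' w0, of _ 1 "\<lambda>z. z \<bullet> e" "\<lambda>z v. v \<bullet> e"])
      show "0 < 2 * sqrt h" using h by simp
      show "\<bar>\<sigma> s \<bullet> e - \<sigma> s' \<bullet> e\<bar> \<le> 1 * norm (\<sigma> s - \<sigma> s')" for s s'
        using Cauchy_Schwarz_ineq2[of "\<sigma> s - \<sigma> s'" e] e by (simp add: inner_diff_left)
      show "((\<lambda>z. z \<bullet> e) has_derivative (\<lambda>v. v \<bullet> e)) (at z)" for z by (auto intro!: derivative_eq_intros)
      fix z v assume "z \<in> \<sigma> ` {a..t}"
      then have "z \<in> \<sigma> ` {a..b}" using t by auto
      then show "\<bar>v \<bullet> e\<bar> \<le> 2 * sqrt h * wt z v" using Cauchy_Schwarz_ineq2[of v e] e nv[of z v] by simp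
    qed simp
    moreover have "\<sigma> t \<bullet> e - \<sigma> a \<bullet> e = norm (\<sigma> t - p)"
    proof -
      have "\<sigma> t \<bullet> e - \<sigma> a \<bullet> e = (\<sigma> t - p) \<bullet> e" by (simp add: inner_diff_left \<sigma>)
      also have "\<dots> = inverse (norm (\<sigma> t - p)) * ((\<sigma> t - p) \<bullet> (\<sigma> t - p))" by (simp only: e_def inner_scaleR_right)
      also have "\<dots> = norm (\<sigma> t - p)" using False unfolding dot_square_norm power2_eq_square by simp
      finally show ?thesis .
    qed
    ultimately show ?thesis by simp
  qed
  have small: "norm (\<sigma> t - p) \<le> sqrt h" if "t \<in> {a..b}" for t
  proof -
    have "2 * sqrt h * C\<^sub>l * w = 2 * sqrt h * (C\<^sub>l * w)" by simp
    also have "\<dots> \<le> 2 * sqrt h * (1 / 2)" using w h by (intro mult_left_mono) auto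
    finally show ?thesis using euc[OF that] by simp
  qed
  have nor: "cmod (cpart (F1 p) (q - p)) \<le> 6 * M * h * C\<^sub>l * w"
  proof -
    define k where "k = cnj (sgn (cpart (F1 p) (q - p)))"
    have k: "cmod k \<le> 1" by (simp add: k_def norm_sgn)
    have kq: "k * cpart (F1 p) (q - p) = of_real (cmod (cpart (F1 p) (q - p)))"
    proof (cases "cpart (F1 p) (q - p) = 0")
      case False
      then show ?thesis
        by (simp add: k_def sgn_eq complex_norm_square[symmetric] power2_eq_square mult.commute)
    qed simp
    have ksub: "\<bar>Re (k * c)\<bar> \<le> cmod c" for c
    proof -
      have "\<bar>Re (k * c)\<bar> \<le> cmod (k * c)" by (rule abs_Re_le_cmod)
      also have "\<dots> \<le> 1 * cmod c" unfolding norm_mult using k by (intro mult_right_mono) auto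
      finally show ?thesis by simp
    qed
    have "\<bar>Re (k * cpart (F1 p) (\<sigma> b)) - Re (k * cpart (F1 p) (\<sigma> a))\<bar> \<le> (6 * M * h) * C\<^sub>l * w"
    proof (rule curve_functional[OF cu w0, of _ "2 * M" "\<lambda>z. Re (k * cpart (F1 p) z)" "\<lambda>z v. Re (k * cpart (F1 p) v)"])
      show "0 < 6 * M * h" using h csts(1) by simp
      show "0 \<le> 2 * M" using csts(1) by simp
      show "\<bar>Re (k * cpart (F1 p) (\<sigma> s)) - Re (k * cpart (F1 p) (\<sigma> s'))\<bar> \<le> 2 * M * norm (\<sigma> s - \<sigma> s')" for s s'
      proof -
        have eq: "Re (k * cpart (F1 p) (\<sigma> s)) - Re (k * cpart (F1 p) (\<sigma> s')) = Re (k * cpart (F1 p) (\<sigma> s - \<sigma> s'))"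
          using cpart_add[of "F1 p" "\<sigma> s - \<sigma> s'" "\<sigma> s'"] by (simp add: algebra_simps)
        have "\<bar>Re (k * cpart (F1 p) (\<sigma> s)) - Re (k * cpart (F1 p) (\<sigma> s'))\<bar> \<le> cmod (cpart (F1 p) (\<sigma> s - \<sigma> s'))"
          unfolding eq by (rule ksub)
        also have "\<dots> \<le> 2 * norm (F1 p) * norm (\<sigma> s - \<sigma> s')" by (rule norm_cpart)
        also have "\<dots> \<le> 2 * M * norm (\<sigma> s - \<sigma> s')" using F1_le[OF p] by (intro mult_right_mono) auto
        finally show ?thesis .
      qed
      show "((\<lambda>z. Re (k * cpart (F1 p) z)) has_derivative (\<lambda>v. Re (k * cpart (F1 p) v))) (at z)" for z
      proof (rule linear_imp_has_derivative, rule linearI)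
        show "Re (k * cpart (F1 p) (x + y)) = Re (k * cpart (F1 p) x) + Re (k * cpart (F1 p) y)" for x y
          by (simp add: cpart_add algebra_simps)
        show "Re (k * cpart (F1 p) (x *\<^sub>R y)) = x *\<^sub>R Re (k * cpart (F1 p) y)" for x y
          by (simp add: cpart_scaleR)
      qed
      fix z v assume z: "z \<in> \<sigma> ` {a..b}"
      then have zO: "z \<in> \<Omega>" and hz: "ht z \<le> 2 * h" and zp: "norm (z - p) \<le> sqrt h"
        using im ht2 small by auto
      \<comment> \<open>The functional is frozen at \<open>p\<close>, while the weight at
        \<open>z\<close> uses the one at \<open>z\<close>. They differ by at most a multiple of
        \<open>sqrt h\<close>, and \<open>norm v\<close> carries another \<open>sqrt h\<close>, so
        the error is of order \<open>h\<close> like the main term.\<close>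
      have "cmod (cpart (F1 p) v) \<le> cmod (cpart (F1 z) v) + cmod (cpart (F1 p - F1 z) v)"
        unfolding cpart_diff_left by (metis norm_triangle_sub)
      also have "cmod (cpart (F1 p - F1 z) v) \<le> 2 * norm (F1 p - F1 z) * norm v" by (rule norm_cpart)
      also have "\<dots> \<le> 2 * (M * sqrt h) * (2 * sqrt h * wt z v)"
      proof (intro mult_mono)
        have "norm (F1 p - F1 z) \<le> M * norm (p - z)" by (rule F1_lip[OF p zO])
        also have "\<dots> \<le> M * sqrt h" using zp csts(1) by (intro mult_left_mono) (auto simp: norm_minus_commute)
        finally show "norm (F1 p - F1 z) \<le> M * sqrt h" .
      qed (use nv[OF z] csts(1) h in auto)
      also have "\<dots> = 4 * M * h * wt z v" using h by simp
      also have "cmod (cpart (F1 z) v) \<le> wt z v * ht z" by (rule wtD(2)[OF zO order_refl])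
      also have "wt z v * ht z \<le> wt z v * (2 * h)" using hz wt_nonneg[OF zO] by (intro mult_left_mono) auto
      finally have 1: "cmod (cpart (F1 p) v) \<le> wt z v * (2 * h) + 4 * M * h * wt z v" by simp
      have "wt z v * (2 * h) \<le> M * (wt z v * (2 * h))"
        using csts(1) h wt_nonneg[OF zO, of v] mult_right_mono[of 1 M "wt z v * (2 * h)"] by simp
      then have "cmod (cpart (F1 p) v) \<le> 6 * M * h * wt z v" using 1 by (simp add: algebra_simps)
      then show "\<bar>Re (k * cpart (F1 p) v)\<bar> \<le> 6 * M * h * wt z v" using ksub order_trans by blast
    qed
    moreover have "Re (k * cpart (F1 p) (\<sigma> b)) - Re (k * cpart (F1 p) (\<sigma> a)) = cmod (cpart (F1 p) (q - p))"
      using cpart_add[of "F1 p" "q - p" p] kq by (simp add: \<sigma> algebra_simps)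
    ultimately show ?thesis by simp
  qed
  have "norm (q - p) / sqrt h \<le> 2 * C\<^sub>l * w"
    using euc[of b] ab h by (simp add: \<sigma> pos_divide_le_eq mult_ac)
  moreover have "cmod (cpart (F1 p) (q - p)) / h \<le> 6 * M * C\<^sub>l * w"
    using nor h by (simp add: pos_divide_le_eq mult_ac)
  moreover have "2 * C\<^sub>l * w \<le> 2 * M * C\<^sub>l * w"
    using csts(1) Cl(1) w0 by (intro mult_right_mono) auto
  ultimately show ?thesis unfolding wt_def h_def[symmetric] by argo
qed

end

section \<open>Pushing points into the domain\<close>

definition gradient :: "('a::euclidean_space \<Rightarrow>\<^sub>L real) \<Rightarrow> 'a" where
  "gradient L = (\<Sum>b\<in>Basis. blinfun_apply L b *\<^sub>R b)"

lemma gradient_inner: "gradient L \<bullet> u = blinfun_apply L u"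
proof -
  have "blinfun_apply L u = blinfun_apply L (\<Sum>b\<in>Basis. (u \<bullet> b) *\<^sub>R b)" by (simp add: euclidean_representation)
  also have "\<dots> = (\<Sum>b\<in>Basis. (u \<bullet> b) * blinfun_apply L b)"
    by (simp add: blinfun.sum_right blinfun.scaleR_right)
  finally show ?thesis by (simp add: gradient_def inner_sum_left inner_commute[of u] mult.commute)
qed

lemma norm_gradient: "norm (gradient L) = norm L"
proof (rule antisym)
  show "norm (gradient L) \<le> norm L"
  proof (cases "gradient L = 0")
    case False
    have "norm (gradient L) * norm (gradient L) = blinfun_apply L (gradient L)"
      unfolding gradient_inner[symmetric] dot_square_norm power2_eq_square ..
    also have "\<dots> \<le> norm L * norm (gradient L)" using norm_blinfun[of L "gradient L"] by simp
    finally show ?thesis using False by simp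
  qed simp
  show "norm L \<le> norm (gradient L)"
    by (rule norm_blinfun_bound) (auto simp: gradient_inner[symmetric] Cauchy_Schwarz_ineq2)
qed

lemma gradient_diff: "gradient (L - L') = gradient L - gradient L'"
  by (simp add: gradient_def blinfun.diff_left scaleR_diff_left sum_subtractf)

text \<open>\<open>R u v x\<close> is to be read as: passing from \<open>u\<close> to
  \<open>v\<close> costs at most \<open>x\<close>. Costs bounded by increments of \<open>G\<close>
  on short intervals telescope.\<close>

lemma local_to_global:
  fixes G :: "real \<Rightarrow> real"
  assumes trans: "\<And>u v w x y. \<lbrakk>a \<le> u; u \<le> v; v \<le> w; w \<le> b; R u v x; R v w y\<rbrakk> \<Longrightarrow> R u w (x + y)"
    and "\<delta> > 0"
    and loc: "\<And>u v. \<lbrakk>a \<le> u; u \<le> v; v \<le> b; v - u \<le> \<delta>\<rbrakk> \<Longrightarrow> R u v (G v - G u)"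
    and uv: "a \<le> u" "u \<le> v" "v \<le> b"
  shows "R u v (G v - G u)"
proof -
  have "R u v (G v - G u)" if "a \<le> u" "u \<le> v" "v \<le> b" "v - u \<le> real n * \<delta>" for n u v
    using that
  proof (induction n arbitrary: v)
    case 0
    then show ?case using \<open>\<delta> > 0\<close> by (intro loc) auto
  next
    case (Suc n)
    define m where "m = max u (v - \<delta>)"
    have m: "u \<le> m" "m \<le> v" "v - m \<le> \<delta>" "m - u \<le> real n * \<delta>"
      using Suc.prems \<open>\<delta> > 0\<close> by (auto simp: m_def max_def algebra_simps)
    have "R u m (G m - G u)" using Suc.prems m by (intro Suc.IH) auto
    moreover have "R m v (G v - G m)" using Suc.prems m by (intro loc) auto
    ultimately have "R u v ((G m - G u) + (G v - G m))" using Suc.prems m by (intro trans) auto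
    then show ?case by simp
  qed
  moreover obtain n :: nat where "(v - u) / \<delta> \<le> real n" using real_arch_simple by blast
  ultimately show ?thesis using uv \<open>\<delta> > 0\<close> by (simp add: pos_divide_le_eq)
qed

section \<open>Displacement against the gradient and its effect on lengths\<close>

context spd
begin

definition push :: "real \<Rightarrow> complex^'n \<Rightarrow> complex^'n" where
  "push s z = z - s *\<^sub>R gradient (F1 z)"

text \<open>The first bound limits the quadratic Taylor error of \<open>push\<close> to half of the
  gain in height; the second ensures that points above the collar are higher than the displacement
  parameter.\<close>

definition s\<^sub>1 :: real where "s\<^sub>1 = min (r / (2 * M)) h\<^sub>0"

definition c\<^sub>1 :: real where "c\<^sub>1 = min (1 / 2) (g\<^sup>2 / 2)"

lemma s1: "0 < s\<^sub>1" "s\<^sub>1 * M \<le> r / 2" "s\<^sub>1 \<le> 1 / 2" "s\<^sub>1 \<le> h\<^sub>0"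
proof -
  show "0 < s\<^sub>1" "s\<^sub>1 \<le> h\<^sub>0" using csts by (auto simp: s\<^sub>1_def)
  have "s\<^sub>1 \<le> r / (2 * M)" by (simp add: s\<^sub>1_def)
  then show 1: "s\<^sub>1 * M \<le> r / 2" using csts by (simp add: field_simps)
  have "s\<^sub>1 * 1 \<le> s\<^sub>1 * M" using csts \<open>0 < s\<^sub>1\<close> by (intro mult_left_mono) auto
  then show "s\<^sub>1 \<le> 1 / 2" using 1 csts(3) by simp
qed

lemma c1: "0 < c\<^sub>1" "c\<^sub>1 \<le> 1 / 2" "c\<^sub>1 \<le> g\<^sup>2 / 2"
  using csts by (auto simp: c\<^sub>1_def)

lemma push_0 [simp]: "push 0 z = z"
  by (simp add: push_def)

text \<open>The height grows by \<open>s\<close> times the squared gradient, up to an error of at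
  most half of this. In the collar the gradient is at least \<open>g\<close>; above it
  \<open>s \<le> h\<^sub>0 < ht z\<close>, and the old height alone is at least half of
  \<open>ht z + s\<close>.\<close>

lemma push_inside:
  assumes z: "z \<in> \<Omega>" and s: "0 \<le> s" "s \<le> s\<^sub>1"
  shows "push s z \<in> \<Omega>" "c\<^sub>1 * (ht z + s) \<le> ht (push s z)"
proof -
  define G where "G = norm (F1 z)"
  have G: "0 \<le> G" "G \<le> M" using F1_le[OF z] by (auto simp: G_def)
  define u where "u = - s *\<^sub>R gradient (F1 z)"
  have pu: "push s z = z + u" by (simp add: push_def u_def)
  have nu: "norm u = s * G" using s by (simp add: u_def norm_gradient G_def)
  have "s * G \<le> s\<^sub>1 * M" using s G csts(1) by (intro mult_mono) auto
  then have ur: "norm u \<le> r" using nu s1(2) csts(2) by linarith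
  have "F1 z u = - s * (G * G)"
    by (simp add: u_def blinfun.minus_right blinfun.scaleR_right gradient_inner[symmetric] dot_square_norm
        norm_gradient G_def power2_eq_square)
  moreover have "M * (norm u)\<^sup>2 \<le> s * (G * G) / 2"
  proof -
    have "M * (norm u)\<^sup>2 = (s * M) * (s * (G * G))" by (simp add: nu power2_eq_square)
    also have "s * M \<le> 1 / 2"
      using mult_right_mono[OF s(2), of M] s1(2) csts by linarith
    then have "(s * M) * (s * (G * G)) \<le> 1 / 2 * (s * (G * G))"
      using s G by (intro mult_right_mono) auto
    finally show ?thesis by simp
  qed
  ultimately have up: "\<rho> (z + u) \<le> \<rho> z - s * (G * G) / 2"
    using taylor[OF z ur] by linarith
  have sG: "0 \<le> s * (G * G)" using s by simp
  have "\<rho> (z + u) < 0" using up sG neg[OF z] by linarith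
  then show "push s z \<in> \<Omega>" unfolding pu by (rule inside[OF z ur])
  have h: "0 < ht z" by (rule ht_pos[OF z])
  have hp: "ht z + s * (G * G) / 2 \<le> ht (push s z)" using up by (simp add: pu ht_def)
  show "c\<^sub>1 * (ht z + s) \<le> ht (push s z)"
  proof (cases "ht z \<le> h\<^sub>0")
    case True
    then have "g \<le> G" using F1_ge[OF z] by (simp add: ht_def G_def)
    then have "g * g \<le> G * G" using csts by (intro mult_mono) auto
    then have "c\<^sub>1 \<le> G * G / 2" using c1(3) by (simp add: power2_eq_square)
    then have "c\<^sub>1 * s \<le> (G * G / 2) * s" using s by (intro mult_right_mono) auto
    moreover have "c\<^sub>1 * ht z \<le> 1 * ht z" using c1(2) h by (intro mult_right_mono) auto
    ultimately show ?thesis using hp by (simp add: algebra_simps)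
  next
    case False
    then have "ht z + s \<le> 2 * ht z" using s s1(4) by simp
    then have "c\<^sub>1 * (ht z + s) \<le> 1 / 2 * (2 * ht z)" using c1 h s by (intro mult_mono) auto
    then show ?thesis using hp sG by simp
  qed
qed

definition C\<^sub>v :: real where "C\<^sub>v = 2 * C\<^sub>u * (3 * M\<^sup>2 / c\<^sub>1)"

lemma Cv_pos: "0 < C\<^sub>v"
  using Cu_pos csts(1) c1(1) by (simp add: C\<^sub>v_def)

text \<open>At parameter \<open>t\<close> the height is at least \<open>c\<^sub>1 * (h + t)\<close>,
  so a short step costs a multiple of its relative size \<open>x = (t' - t) / (h + t)\<close>. For
  small \<open>x\<close> this is at most a multiple of \<open>ln (1 + x)\<close>, which
  telescopes.\<close>

lemma push_vertical:
  assumes z: "z \<in> \<Omega>" and t: "0 \<le> t" "t \<le> t'" "t' \<le> s\<^sub>1"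
  shows "kchain \<Omega> (push t z) (push t' z) (C\<^sub>v * ln (ht z + t') - C\<^sub>v * ln (ht z + t))"
proof -
  define h where "h = ht z"
  have h: "0 < h" using ht_pos[OF z] by (simp add: h_def)
  define k where "k = 3 * M\<^sup>2 / c\<^sub>1"
  have k: "0 < k" using csts(1) c1(1) by (simp add: k_def)
  define d where "d = min (1 / 2) (a\<^sub>0 / k) * h"
  have d: "0 < d" using a0(1) k h by (simp add: d_def)
  have "kchain \<Omega> (push t z) (push t' z) ((\<lambda>t. C\<^sub>v * ln (h + t)) t' - (\<lambda>t. C\<^sub>v * ln (h + t)) t)"
  proof (rule local_to_global[where R = "\<lambda>t t' w. kchain \<Omega> (push t z) (push t' z) w" and a = 0 and b = "s\<^sub>1", OF _ d])
    show "kchain \<Omega> (push u z) (push w z) (x + y)"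
      if "kchain \<Omega> (push u z) (push v z) x" "kchain \<Omega> (push v z) (push w z) y" for u v w x y
      using that by (rule kchain_trans)
    fix t t' assume tt: "0 \<le> t" "t \<le> t'" "t' \<le> s\<^sub>1" "t' - t \<le> d"
    define p where "p = push t z"
    define x where "x = (t' - t) / (h + t)"
    note pi = push_inside[OF z tt(1) order_trans[OF tt(2,3)], folded p_def]
    have ht0: "0 < h + t" using h tt by simp
    have x0: "0 \<le> x" using tt ht0 by (simp add: x_def)
    have "t' - t \<le> min (1 / 2) (a\<^sub>0 / k) * (h + t)"
    proof -
      have "0 \<le> min (1 / 2) (a\<^sub>0 / k)" using a0(1) k by simp
      then have "min (1 / 2) (a\<^sub>0 / k) * h \<le> min (1 / 2) (a\<^sub>0 / k) * (h + t)"
        using tt(1) by (intro mult_left_mono) auto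
      then show ?thesis using tt(4) unfolding d_def by (rule order_trans[rotated])
    qed
    then have x1: "x \<le> min (1 / 2) (a\<^sub>0 / k)" unfolding x_def by (simp only: pos_divide_le_eq[OF ht0])
    have pd: "push t' z - p = (t - t') *\<^sub>R gradient (F1 z)" by (simp add: p_def push_def algebra_simps)
    have nd: "norm (push t' z - p) \<le> (t' - t) * M"
      unfolding pd using tt F1_le[OF z] by (simp add: norm_gradient mult_left_mono)
    have "wt p (push t' z - p) \<le> (3 * M / ht p) * norm (push t' z - p)" by (rule wt_le_norm[OF pi(1)])
    also have "\<dots> \<le> (3 * M / (c\<^sub>1 * (h + t))) * ((t' - t) * M)"
      using pi(2) nd c1(1) ht0 csts(1) ht_pos[OF pi(1)] by (intro mult_mono divide_left_mono mult_pos_pos) (auto simp: h_def)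
    also have "\<dots> = k * x" by (simp add: k_def x_def power2_eq_square)
    finally have w: "wt p (push t' z - p) \<le> k * x" .
    have "k * x \<le> k * (a\<^sub>0 / k)" using x1 k by (intro mult_left_mono) auto
    then have wa: "wt p (push t' z - p) \<le> a\<^sub>0" using w k by simp
    have "C\<^sub>u * wt p (push t' z - p) \<le> C\<^sub>u * (k * x)" using w Cu_pos by (intro mult_left_mono) auto
    also have "\<dots> \<le> C\<^sub>u * (k * (2 * ln (1 + x)))"
    proof -
      have "x * x \<le> (1 / 2) * x" using x0 x1 by (intro mult_right_mono) auto
      then have "x / 2 \<le> x - x\<^sup>2" by (simp add: power2_eq_square)
      also have "\<dots> \<le> ln (1 + x)" using x0 x1 by (intro ln_one_plus_pos_lower_bound) auto
      finally have "x \<le> 2 * ln (1 + x)" by simp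
      then show ?thesis using Cu_pos k by (intro mult_left_mono) auto
    qed
    also have "\<dots> = C\<^sub>v * ln (1 + x)" by (simp add: C\<^sub>v_def k_def)
    also have "\<dots> = C\<^sub>v * ln (h + t') - C\<^sub>v * ln (h + t)"
    proof -
      have "1 + x = (h + t') / (h + t)" using ht0 by (simp add: x_def field_simps)
      then have "ln (1 + x) = ln (h + t') - ln (h + t)" using ht0 h tt by (simp add: ln_div)
      then show ?thesis by (simp add: right_diff_distrib)
    qed
    finally show "kchain \<Omega> (push t z) (push t' z) (C\<^sub>v * ln (h + t') - C\<^sub>v * ln (h + t))"
      using kchain_mono[OF kchain_wt[OF pi(1) wa]] unfolding p_def by blast
  qed (use t in auto)
  then show ?thesis by (simp add: h_def)
qed

text \<open>The sum of the coefficients of the three terms in \<open>wt_push\<close>.\<close>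

definition C\<^sub>p :: real where "C\<^sub>p = 1 / c\<^sub>1 + 4 * M\<^sup>2 / c\<^sub>1 + 2 / sqrt c\<^sub>1"

lemma Cp_pos: "0 < C\<^sub>p"
  unfolding C\<^sub>p_def using c1(1) csts(1) by (intro add_pos_pos) auto

text \<open>The lifted height is at least \<open>c\<^sub>1 * s\<close>. Lifting changes the normal
  functional and also changes \<open>q - p\<close> by \<open>s\<close> times a difference of
  gradients. Either error is at most \<open>2 * M\<^sup>2 * s * norm (q - p)\<close>, and its factor
  \<open>s\<close> cancels against the height.\<close>

lemma wt_push:
  assumes p: "p \<in> \<Omega>" and q: "q \<in> \<Omega>" and s: "0 < s" "s \<le> s\<^sub>1"
  shows "wt (push s p) (push s q - push s p) \<le>
     cmod (cpart (F1 p) (q - p)) / (c\<^sub>1 * s) + 4 * M\<^sup>2 / c\<^sub>1 * norm (q - p) + 2 / sqrt c\<^sub>1 * (norm (q - p) / sqrt s)"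
proof -
  define u where "u = q - p"
  define U where "U = push s q - push s p"
  define P where "P = push s p"
  note pi = push_inside[OF p less_imp_le[OF s(1)] s(2), folded P_def]
  have sM: "s * M \<le> 1 / 2" using mult_right_mono[OF s(2), of M] s1(2) csts by linarith
  have Uu: "U - u = s *\<^sub>R (gradient (F1 p) - gradient (F1 q))"
    by (simp add: U_def u_def push_def algebra_simps)
  have nUu: "norm (U - u) \<le> s * (M * norm u)"
    unfolding Uu gradient_diff[symmetric] using s F1_lip[OF p q]
    by (simp add: norm_gradient u_def norm_minus_commute mult_left_mono)
  have "norm U \<le> norm u + norm (U - u)" by (metis norm_triangle_sub)
  also have "\<dots> \<le> norm u + (s * M) * norm u" using nUu by (simp add: mult.assoc)
  also have "(s * M) * norm u \<le> 1 / 2 * norm u" using sM by (intro mult_right_mono) auto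
  finally have nU: "norm U \<le> 2 * norm u" using norm_ge_zero[of u] by linarith
  have "norm (P - p) \<le> s * M" using F1_le[OF p] s by (simp add: P_def push_def norm_gradient mult_left_mono)
  then have "norm (F1 P - F1 p) \<le> M * (s * M)"
    using F1_lip[OF pi(1) p] csts(1) by (meson mult_left_mono order_trans zero_le_one)
  then have 1: "cmod (cpart (F1 P - F1 p) u) \<le> 2 * (M * (s * M)) * norm u"
    by (intro order_trans[OF norm_cpart] mult_right_mono mult_left_mono) auto
  have 2: "cmod (cpart (F1 P) (U - u)) \<le> 2 * M * (s * (M * norm u))"
    using F1_le[OF pi(1)] nUu csts(1) by (intro order_trans[OF norm_cpart] mult_mono) auto
  have eq: "cpart (F1 P) U = cpart (F1 p) u + cpart (F1 P - F1 p) u + cpart (F1 P) (U - u)"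
    using cpart_add[of "F1 P" u "U - u"] by (simp add: cpart_diff_left)
  have "cmod (cpart (F1 P) U) \<le> cmod (cpart (F1 p) u) + cmod (cpart (F1 P - F1 p) u) + cmod (cpart (F1 P) (U - u))"
    unfolding eq by (rule order_trans[OF norm_triangle_ineq], rule add_right_mono, rule norm_triangle_ineq)
  also have "\<dots> \<le> cmod (cpart (F1 p) u) + 4 * M\<^sup>2 * s * norm u"
    using 1 2 by (simp add: power2_eq_square mult_ac)
  finally have 3: "cmod (cpart (F1 P) U) \<le> cmod (cpart (F1 p) u) + 4 * M\<^sup>2 * s * norm u" .
  have "c\<^sub>1 * s \<le> c\<^sub>1 * (ht p + s)" using ht_pos[OF p] c1(1) by (intro mult_left_mono) auto
  then have H: "c\<^sub>1 * s \<le> ht P" using pi(2) by simp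
  have cs: "0 < c\<^sub>1 * s" using c1(1) s by simp
  have "cmod (cpart (F1 P) U) / ht P \<le> (cmod (cpart (F1 p) u) + 4 * M\<^sup>2 * s * norm u) / (c\<^sub>1 * s)"
    using 3 H cs s by (intro frac_le) auto
  also have "\<dots> = cmod (cpart (F1 p) u) / (c\<^sub>1 * s) + 4 * M\<^sup>2 / c\<^sub>1 * norm u"
    using cs s by (simp add: add_divide_distrib)
  finally have 4: "cmod (cpart (F1 P) U) / ht P \<le> cmod (cpart (F1 p) u) / (c\<^sub>1 * s) + 4 * M\<^sup>2 / c\<^sub>1 * norm u" .
  have "norm U / sqrt (ht P) \<le> 2 * norm u / sqrt (c\<^sub>1 * s)"
    using nU H cs by (intro frac_le) auto
  also have "\<dots> = 2 / sqrt c\<^sub>1 * (norm u / sqrt s)" by (simp add: real_sqrt_mult)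
  finally show ?thesis using 4 unfolding wt_def U_def[symmetric] unfolding P_def[symmetric] u_def[symmetric] by linarith
qed

text \<open>Relative to \<open>X\<close> the three terms of \<open>wt_push\<close> carry the factors
  \<open>h / s\<close>, \<open>sqrt h\<close> and \<open>sqrt (h / s)\<close>; since
  \<open>h \<le> s \<le> 1\<close>, the last one dominates.\<close>

lemma kchain_push_near:
  assumes p: "p \<in> \<Omega>" and q: "q \<in> \<Omega>" and s: "ht p \<le> s" "s \<le> s\<^sub>1"
    and w: "wt p (q - p) \<le> X" "X * C\<^sub>p \<le> a\<^sub>0"
  shows "kchain \<Omega> (push s p) (push s q) (C\<^sub>u * C\<^sub>p * X * sqrt (ht p / s))"
proof -
  define h where "h = ht p"
  have h: "0 < h" "h \<le> s" "0 < s" "s \<le> 1" using ht_pos[OF p] s s1(3) by (auto simp: h_def)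
  have X: "0 \<le> X" using wt_nonneg[OF p] w(1) by (rule order_trans)
  have nu: "norm (q - p) \<le> X * sqrt h" and cu: "cmod (cpart (F1 p) (q - p)) \<le> X * h"
    using wtD[OF p w(1)] by (simp_all add: h_def)
  define y where "y = sqrt (h / s)"
  have y: "0 < y" "y \<le> 1" using h by (auto simp: y_def)
  have hs: "h / s \<le> y"
  proof -
    have "h / s = y * y" using h by (simp add: y_def)
    also have "\<dots> \<le> y * 1" using y by (intro mult_left_mono) auto
    finally show ?thesis by simp
  qed
  have yy: "y = sqrt h / sqrt s" by (simp add: y_def real_sqrt_divide)
  have sh: "sqrt h \<le> y"
    unfolding yy using h by (simp add: pos_le_divide_eq mult_left_le)
  have "cmod (cpart (F1 p) (q - p)) / (c\<^sub>1 * s) \<le> X * h / (c\<^sub>1 * s)"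
    using cu c1(1) h by (intro divide_right_mono) auto
  also have "\<dots> = X * (1 / c\<^sub>1) * (h / s)" by simp
  also have "\<dots> \<le> X * (1 / c\<^sub>1) * y" using hs X c1(1) by (intro mult_left_mono) auto
  finally have 1: "cmod (cpart (F1 p) (q - p)) / (c\<^sub>1 * s) \<le> X * (1 / c\<^sub>1) * y" .
  have "norm (q - p) \<le> X * y" using nu sh X by (meson mult_left_mono order_trans)
  then have 2: "4 * M\<^sup>2 / c\<^sub>1 * norm (q - p) \<le> 4 * M\<^sup>2 / c\<^sub>1 * (X * y)"
    using c1(1) by (intro mult_left_mono) auto
  have "norm (q - p) / sqrt s \<le> X * sqrt h / sqrt s" using nu h by (intro divide_right_mono) auto
  then have 3: "2 / sqrt c\<^sub>1 * (norm (q - p) / sqrt s) \<le> 2 / sqrt c\<^sub>1 * (X * y)"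
    using c1(1) by (intro mult_left_mono) (auto simp: yy)
  have "wt (push s p) (push s q - push s p) \<le> X * (1 / c\<^sub>1) * y + 4 * M\<^sup>2 / c\<^sub>1 * (X * y) + 2 / sqrt c\<^sub>1 * (X * y)"
    using wt_push[OF p q h(3) s(2)] 1 2 3 by linarith
  also have "\<dots> = X * C\<^sub>p * y" by (simp add: C\<^sub>p_def algebra_simps)
  finally have W: "wt (push s p) (push s q - push s p) \<le> X * C\<^sub>p * y" .
  have "X * C\<^sub>p * y \<le> X * C\<^sub>p * 1" using y X Cp_pos by (intro mult_left_mono) auto
  then have "wt (push s p) (push s q - push s p) \<le> a\<^sub>0" using W w(2) by simp
  from kchain_wt[OF push_inside(1)[OF p _ s(2)] this] h
  have "kchain \<Omega> (push s p) (push s q) (C\<^sub>u * wt (push s p) (push s q - push s p))" by simp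
  moreover have "C\<^sub>u * wt (push s p) (push s q - push s p) \<le> C\<^sub>u * (X * C\<^sub>p * y)"
    using W Cu_pos by (intro mult_left_mono) auto
  ultimately have "kchain \<Omega> (push s p) (push s q) (C\<^sub>u * (X * C\<^sub>p * y))" by (rule kchain_mono)
  then show ?thesis by (simp add: y_def h_def mult_ac)
qed

text \<open>With the normal functional bounded crudely by \<open>2 * M\<close>, the choice of
  \<open>\<theta>\<close> keeps the sum of the three terms of \<open>wt_push\<close> below
  \<open>a\<^sub>0\<close>.\<close>

lemma kchain_push_euclidean:
  obtains \<theta> where "0 < \<theta>" "\<theta> \<le> 1"
    "\<forall>p q s. p \<in> \<Omega> \<longrightarrow> q \<in> \<Omega> \<longrightarrow> 0 < s \<longrightarrow> s \<le> s\<^sub>1 \<longrightarrow> norm (p - q) \<le> \<theta> * s \<longrightarrow> kchain \<Omega> (push s p) (push s q) 3"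
proof -
  define \<theta> where "\<theta> = min 1 (a\<^sub>0 / (2 * M * C\<^sub>p))"
  have mc: "0 < 2 * M * C\<^sub>p" using csts(1) Cp_pos by simp
  then have \<theta>: "0 < \<theta>" "\<theta> \<le> 1" "\<theta> * (2 * M * C\<^sub>p) \<le> a\<^sub>0"
    using a0(1) by (auto simp: \<theta>_def min_def pos_le_divide_eq not_le intro: less_imp_le)
  show thesis
  proof (rule that[OF \<theta>(1,2)], intro allI impI)
    fix p q s assume p: "p \<in> \<Omega>" and q: "q \<in> \<Omega>" and s: "0 < s" "s \<le> s\<^sub>1" and n: "norm (p - q) \<le> \<theta> * s"
    have n: "norm (q - p) \<le> \<theta> * s" using n by (simp add: norm_minus_commute)
    have s1: "s \<le> 1" using s s1(3) by simp
    have \<theta>s: "\<theta> * s \<le> \<theta>" using s1 \<theta>(1) by (simp add: mult_left_le)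
    have "cmod (cpart (F1 p) (q - p)) \<le> 2 * M * (\<theta> * s)"
      using F1_le[OF p] n csts(1) by (intro order_trans[OF norm_cpart] mult_mono) auto
    then have "cmod (cpart (F1 p) (q - p)) / (c\<^sub>1 * s) \<le> 2 * M * (\<theta> * s) / (c\<^sub>1 * s)"
      using c1(1) s by (intro divide_right_mono) auto
    also have "\<dots> = 2 * M * \<theta> * (1 / c\<^sub>1)" using s by simp
    finally have 1: "cmod (cpart (F1 p) (q - p)) / (c\<^sub>1 * s) \<le> 2 * M * \<theta> * (1 / c\<^sub>1)" .
    have M2: "\<theta> \<le> 2 * M * \<theta>" using csts(1) \<theta>(1) by simp
    have "norm (q - p) \<le> 2 * M * \<theta>" using n \<theta>s M2 by linarith
    then have 2: "4 * M\<^sup>2 / c\<^sub>1 * norm (q - p) \<le> 4 * M\<^sup>2 / c\<^sub>1 * (2 * M * \<theta>)"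
      using c1(1) by (intro mult_left_mono) auto
    have "norm (q - p) / sqrt s \<le> \<theta> * s / sqrt s" using n s by (intro divide_right_mono) auto
    also have "\<dots> = \<theta> * sqrt s" unfolding times_divide_eq_right[symmetric] using s by (subst real_div_sqrt) auto
    also have "\<dots> \<le> \<theta> * 1" using s1 s \<theta>(1) by (intro mult_left_mono) auto
    finally have "norm (q - p) / sqrt s \<le> 2 * M * \<theta>" using M2 by simp
    then have 3: "2 / sqrt c\<^sub>1 * (norm (q - p) / sqrt s) \<le> 2 / sqrt c\<^sub>1 * (2 * M * \<theta>)"
      using c1(1) by (intro mult_left_mono) auto
    have "wt (push s p) (push s q - push s p) \<le> 2 * M * \<theta> * (1 / c\<^sub>1) + 4 * M\<^sup>2 / c\<^sub>1 * (2 * M * \<theta>) + 2 / sqrt c\<^sub>1 * (2 * M * \<theta>)"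
      using wt_push[OF p q s] 1 2 3 by linarith
    also have "\<dots> = \<theta> * (2 * M * C\<^sub>p)" by (simp add: C\<^sub>p_def algebra_simps)
    also have "\<dots> \<le> a\<^sub>0" by (rule \<theta>(3))
    finally have W: "wt (push s p) (push s q - push s p) \<le> a\<^sub>0" .
    have "C\<^sub>u * wt (push s p) (push s q - push s p) \<le> C\<^sub>u * a\<^sub>0" using W Cu_pos by (intro mult_left_mono) auto
    also have "\<dots> = 3" using a0(1) by (simp add: C\<^sub>u_def)
    finally show "kchain \<Omega> (push s p) (push s q) 3"
      using kchain_mono[OF kchain_wt[OF push_inside(1)[OF p _ s(2)] W]] s by simp
  qed
qed

text \<open>Both points are raised to a level \<open>s'\<close> comparable to their distance, joined
  there at bounded cost and lowered again; a vertical leg costs the logarithm of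
  \<open>s' / s\<close>. If the distance is too large for that, both points are raised to level
  \<open>s\<^sub>1\<close>, which puts them in a compact core.\<close>

lemma kchain_push_far:
  obtains C where "0 < C"
    "\<forall>p q s. p \<in> \<Omega> \<longrightarrow> q \<in> \<Omega> \<longrightarrow> 0 < s \<longrightarrow> s \<le> s\<^sub>1 \<longrightarrow>
       kchain \<Omega> (push s p) (push s q) (C * (1 + ln (1 + norm (p - q) / s)))"
proof -
  obtain \<theta> where \<theta>: "0 < \<theta>" "\<theta> \<le> 1" and near:
    "\<forall>p q s. p \<in> \<Omega> \<longrightarrow> q \<in> \<Omega> \<longrightarrow> 0 < s \<longrightarrow> s \<le> s\<^sub>1 \<longrightarrow> norm (p - q) \<le> \<theta> * s \<longrightarrow> kchain \<Omega> (push s p) (push s q) 3"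
    by (rule kchain_push_euclidean)
  have "0 < c\<^sub>1 * s\<^sub>1" using c1(1) s1(1) by simp
  then obtain C0 where C0: "C0 > 0" and core:
    "\<forall>p q. p \<in> \<Omega> \<longrightarrow> q \<in> \<Omega> \<longrightarrow> c\<^sub>1 * s\<^sub>1 \<le> ht p \<longrightarrow> c\<^sub>1 * s\<^sub>1 \<le> ht q \<longrightarrow> kchain \<Omega> p q C0"
    by (rule kchain_core)
  define C where "C = 3 + C0 + 2 * C\<^sub>v * (1 + ln (1 / \<theta>))"
  have lt: "0 \<le> ln (1 / \<theta>)" using \<theta> by simp
  have C: "0 < C" using C0 Cv_pos lt by (simp add: C_def add_pos_nonneg)
  show thesis
  proof (rule that[OF C], intro allI impI)
    fix p q s assume p: "p \<in> \<Omega>" and q: "q \<in> \<Omega>" and s: "0 < s" "s \<le> s\<^sub>1"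
    define e where "e = norm (p - q)"
    define l where "l = ln (1 + e / s)"
    have l: "0 \<le> l" using s by (simp add: l_def e_def)
    define s' where "s' = max s (min (e / \<theta>) s\<^sub>1)"
    have s': "s \<le> s'" "s' \<le> s\<^sub>1" "0 < s'" using s by (auto simp: s'_def)
    have ratio: "s' / s \<le> (1 + e / s) / \<theta>"
    proof -
      have "s' \<le> (s + e) / \<theta>"
      proof -
        have "s \<le> s / \<theta>" "0 \<le> e / \<theta>" using s \<theta> by (auto simp: pos_le_divide_eq mult_left_le e_def)
        moreover have "0 \<le> s / \<theta>" using s \<theta> by simp
        ultimately show ?thesis by (simp add: s'_def add_divide_distrib)
      qed
      then have "s' / s \<le> (s + e) / \<theta> / s" using s by (intro divide_right_mono) auto
      also have "\<dots> = (1 + e / s) / \<theta>" using s \<theta> by (simp add: field_simps)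
      finally show ?thesis .
    qed
    have vert: "kchain \<Omega> (push s z) (push s' z) (C\<^sub>v * (l + ln (1 / \<theta>)))" if z: "z \<in> \<Omega>" for z
    proof -
      have h: "0 < ht z" by (rule ht_pos[OF z])
      have "(ht z + s') / (ht z + s) \<le> s' / s"
        using h s s' mult_left_mono[OF s'(1), of "ht z"] by (simp add: divide_simps algebra_simps)
      also have "\<dots> \<le> (1 + e / s) * (1 / \<theta>)" using ratio by simp
      finally have r: "(ht z + s') / (ht z + s) \<le> (1 + e / s) * (1 / \<theta>)" .
      have e0: "0 < 1 + e / s" using s by (simp add: e_def add_pos_nonneg)
      have "ln (ht z + s') - ln (ht z + s) = ln ((ht z + s') / (ht z + s))"
        using h s s' by (simp add: ln_div)
      also have "\<dots> \<le> ln ((1 + e / s) * (1 / \<theta>))"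
        using r h s s' e0 \<theta> by (subst ln_le_cancel_iff) (auto intro!: divide_pos_pos mult_pos_pos)
      also have "\<dots> = l + ln (1 / \<theta>)" using e0 \<theta> unfolding l_def by (intro ln_mult_pos) auto
      finally have "C\<^sub>v * (ln (ht z + s') - ln (ht z + s)) \<le> C\<^sub>v * (l + ln (1 / \<theta>))"
        using Cv_pos by (intro mult_left_mono) auto
      then show ?thesis
        using kchain_mono[OF push_vertical[OF z less_imp_le[OF s(1)] s'(1,2)]] by (simp add: right_diff_distrib)
    qed
    have mid: "kchain \<Omega> (push s' p) (push s' q) (3 + C0)"
    proof (cases "e / \<theta> \<le> s\<^sub>1")
      case True
      then have "e / \<theta> \<le> s'" by (simp add: s'_def)
      then have "e \<le> \<theta> * s'" using \<theta> by (simp add: pos_divide_le_eq mult.commute)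
      then have "kchain \<Omega> (push s' p) (push s' q) 3" using near p q s' by (simp add: e_def)
      then show ?thesis by (rule kchain_mono) (use C0 in simp)
    next
      case False
      then have ss: "s' = s\<^sub>1" using s by (simp add: s'_def)
      have i: "push s\<^sub>1 z \<in> \<Omega> \<and> c\<^sub>1 * s\<^sub>1 \<le> ht (push s\<^sub>1 z)" if z: "z \<in> \<Omega>" for z
      proof -
        have "c\<^sub>1 * s\<^sub>1 \<le> c\<^sub>1 * (ht z + s\<^sub>1)" using ht_pos[OF z] c1(1) by (intro mult_left_mono) auto
        then show ?thesis using push_inside[OF z less_imp_le[OF s1(1)] order_refl] by auto
      qed
      have "kchain \<Omega> (push s' p) (push s' q) C0" unfolding ss using core i[OF p] i[OF q] by blast
      then show ?thesis by (rule kchain_mono) simp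
    qed
    have "kchain \<Omega> (push s p) (push s q) (C\<^sub>v * (l + ln (1 / \<theta>)) + (3 + C0) + C\<^sub>v * (l + ln (1 / \<theta>)))"
      by (rule kchain_trans[OF kchain_trans[OF vert[OF p] mid] kchain_sym[OF vert[OF q]]])
    moreover have "C\<^sub>v * (l + ln (1 / \<theta>)) + (3 + C0) + C\<^sub>v * (l + ln (1 / \<theta>)) \<le> C * (1 + l)"
    proof -
      have "0 \<le> (3 + C0) * l" "0 \<le> 2 * C\<^sub>v * ln (1 / \<theta>) * l" "0 \<le> 2 * C\<^sub>v" using l C0 Cv_pos lt by auto
      moreover have "C * (1 + l) = (3 + C0) + 2 * C\<^sub>v + 2 * C\<^sub>v * ln (1 / \<theta>) + (3 + C0) * l + 2 * C\<^sub>v * l + 2 * C\<^sub>v * ln (1 / \<theta>) * l"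
        by (simp add: C_def algebra_simps)
      moreover have "C\<^sub>v * (l + ln (1 / \<theta>)) + (3 + C0) + C\<^sub>v * (l + ln (1 / \<theta>)) = (3 + C0) + 2 * C\<^sub>v * l + 2 * C\<^sub>v * ln (1 / \<theta>)"
        by (simp add: algebra_simps)
      ultimately show ?thesis by linarith
    qed
    ultimately show "kchain \<Omega> (push s p) (push s q) (C * (1 + ln (1 + norm (p - q) / s)))"
      unfolding l_def e_def by (rule kchain_mono)
  qed
qed

end

section \<open>The length of quasi-geodesics\<close>

lemma le_two_times_if_ln:
  fixes x y :: real
  assumes "0 < x" "0 < y" "\<bar>ln x - ln y\<bar> \<le> 1 / 2"
  shows "x \<le> 2 * y"
proof -
  have "ln x \<le> ln 2 + ln y" using assms(3) ln2_ge_two_thirds by linarith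
  also have "\<dots> = ln (2 * y)" using assms(2) by (simp add: ln_mult)
  finally show ?thesis using assms by simp
qed

context spd
begin

text \<open>Lipschitz constant in time of the logarithm of the height along a
  quasi-geodesic.\<close>

definition \<Lambda>\<^sub>1 :: "real \<Rightarrow> real" where "\<Lambda>\<^sub>1 \<kappa> = 2 * \<kappa> * C\<^sub>l"

text \<open>Growth rate in time of the weight of a displacement: \<open>8 * M * C\<^sub>l\<close>
  from \<open>wt_le_dist\<close>, times \<open>2 * \<kappa>\<close> from the strict upper bound for
  the distance.\<close>

definition \<Lambda>\<^sub>2 :: "real \<Rightarrow> real" where "\<Lambda>\<^sub>2 \<kappa> = 16 * \<kappa> * M * C\<^sub>l"

lemma Lambda_pos: "\<kappa> \<ge> 1 \<Longrightarrow> 0 < \<Lambda>\<^sub>1 \<kappa>" "\<kappa> \<ge> 1 \<Longrightarrow> 0 < \<Lambda>\<^sub>2 \<kappa>"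
  using Cl(1) csts(1) by (auto simp: \<Lambda>\<^sub>1_def \<Lambda>\<^sub>2_def)

end

section \<open>Length and time estimates along one quasi-geodesic\<close>

locale spd_quasi_geodesic = spd \<Omega> \<rho> F1 F2 M r h\<^sub>0 g c
  for \<Omega> :: "(complex^'n::finite) set" and \<rho> F1 F2 M r h\<^sub>0 g c +
  fixes \<kappa> a b :: real and \<gamma> :: "real \<Rightarrow> complex^'n"
  assumes kap: "\<kappa> \<ge> 1" and ab: "a \<le> b" and qg: "kobayashi_quasi_geodesic \<Omega> \<kappa> {a..b} \<gamma>"
begin

lemma in_dom: "t \<in> {a..b} \<Longrightarrow> \<gamma> t \<in> \<Omega>"
  using qg by (auto simp: kobayashi_quasi_geodesic_def)

definition hh :: "real \<Rightarrow> real" where "hh t = ht (\<gamma> t)"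

lemma hh_pos: "t \<in> {a..b} \<Longrightarrow> 0 < hh t"
  unfolding hh_def by (intro ht_pos in_dom)

lemma hh_cont: "continuous_on {a..b} hh"
  unfolding hh_def
  by (rule continuous_on_compose2[OF ht_continuous]) (use qg in \<open>auto simp: kobayashi_quasi_geodesic_def\<close>)

lemma sqrt_hh_cont: "{u..v} \<subseteq> {a..b} \<Longrightarrow> continuous_on {u..v} (\<lambda>t. sqrt (hh t))"
  using continuous_on_subset[OF hh_cont] by (intro continuous_on_real_sqrt)

text \<open>Doubling \<open>\<kappa>\<close> makes the inequality strict, and only then does the
  infimum provide an actual curve of at most that length.\<close>

lemma dist_lt:
  assumes "s \<in> {a..b}" "t \<in> {a..b}" "s \<noteq> t"
  shows "kobayashi_dist \<Omega> (\<gamma> s) (\<gamma> t) < ennreal (2 * \<kappa> * \<bar>t - s\<bar>)"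
proof -
  have "kobayashi_dist \<Omega> (\<gamma> s) (\<gamma> t) \<le> ennreal (\<kappa> * \<bar>t - s\<bar>)"
    using qg assms by (auto simp: kobayashi_quasi_geodesic_def)
  also have "\<dots> < ennreal (2 * \<kappa> * \<bar>t - s\<bar>)"
    using kap assms(3) by (subst ennreal_less_iff) auto
  finally show ?thesis .
qed

lemma ln_hh:
  assumes "s \<in> {a..b}" "t \<in> {a..b}"
  shows "\<bar>ln (hh t) - ln (hh s)\<bar> \<le> \<Lambda>\<^sub>1 \<kappa> * \<bar>t - s\<bar>"
proof (cases "s = t")
  case False
  then show ?thesis using ln_ht_le[OF dist_lt[OF assms False]] by (simp add: hh_def \<Lambda>\<^sub>1_def mult_ac)
qed simp

text \<open>A time step over which the smallness condition of \<open>wt_le_dist\<close> holds and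
  the height changes by a factor of at most 2.\<close>

definition \<delta>\<^sub>0 :: real where "\<delta>\<^sub>0 = 1 / (2 * \<Lambda>\<^sub>1 \<kappa>)"

lemma delta0: "0 < \<delta>\<^sub>0" "x \<le> \<delta>\<^sub>0 \<Longrightarrow> \<Lambda>\<^sub>1 \<kappa> * x \<le> 1 / 2"
  using Lambda_pos(1)[OF kap] by (auto simp: \<delta>\<^sub>0_def field_simps)

lemma wt_step:
  assumes uv: "a \<le> u" "u \<le> v" "v \<le> b" "v - u \<le> \<delta>\<^sub>0"
  shows "wt (\<gamma> u) (\<gamma> v - \<gamma> u) \<le> \<Lambda>\<^sub>2 \<kappa> * (v - u)"
proof (cases "u = v")
  case True
  then show ?thesis by (simp add: wt_def cpart_def clin_def blinfun.zero_right)
next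
  case False
  have m: "u \<in> {a..b}" "v \<in> {a..b}" using uv by auto
  have "C\<^sub>l * (2 * \<kappa> * \<bar>v - u\<bar>) \<le> 1 / 2"
    using delta0(2)[OF uv(4)] uv by (simp add: \<Lambda>\<^sub>1_def algebra_simps)
  from wt_le_dist[OF dist_lt[OF m False] this] show ?thesis using uv by (simp add: \<Lambda>\<^sub>2_def algebra_simps)
qed

lemma sqrt_step:
  assumes uv: "a \<le> u" "u \<le> v" "v \<le> b" "v - u \<le> \<delta>\<^sub>0"
  shows "(v - u) * sqrt (hh u) \<le> 2 * integral {u..v} (\<lambda>t. sqrt (hh t))"
proof -
  have "integral {u..v} (\<lambda>t. sqrt (hh u) / 2) \<le> integral {u..v} (\<lambda>t. sqrt (hh t))"
  proof (rule integral_le)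
    show "(\<lambda>t. sqrt (hh t)) integrable_on {u..v}"
      using uv by (intro integrable_continuous_real sqrt_hh_cont) auto
    fix t assume t: "t \<in> {u..v}"
    have m: "u \<in> {a..b}" "t \<in> {a..b}" using t uv by auto
    have "\<bar>ln (hh u) - ln (hh t)\<bar> \<le> \<Lambda>\<^sub>1 \<kappa> * \<bar>u - t\<bar>" by (rule ln_hh[OF m(2,1)])
    also have "\<dots> \<le> 1 / 2" using t uv by (intro delta0(2)) auto
    finally have "hh u \<le> 2 * hh t" by (intro le_two_times_if_ln hh_pos m)
    then have "sqrt (hh u) \<le> sqrt (4 * hh t)" using hh_pos[OF m(2)] by simp
    then show "sqrt (hh u) / 2 \<le> sqrt (hh t)" by (simp add: real_sqrt_mult)
  qed auto
  then show ?thesis using uv by simp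
qed

text \<open>Euclidean displacement is bounded by \<open>2 * \<Lambda>\<^sub>2 \<kappa>\<close> times
  the increment of \<open>P\<close>, so the length estimate reduces to bounding
  \<open>P b\<close>.\<close>

definition P :: "real \<Rightarrow> real" where "P t = integral {a..t} (\<lambda>t. sqrt (hh t))"

lemma P_diff:
  assumes "a \<le> u" "u \<le> v" "v \<le> b"
  shows "P v - P u = integral {u..v} (\<lambda>t. sqrt (hh t))"
proof -
  have "(\<lambda>t. sqrt (hh t)) integrable_on {a..v}"
    using assms by (intro integrable_continuous_real sqrt_hh_cont) auto
  from Henstock_Kurzweil_Integration.integral_combine[OF assms(1,2) this] show ?thesis by (simp add: P_def)
qed

lemma P_mono:
  assumes "a \<le> u" "u \<le> v" "v \<le> b"
  shows "P u \<le> P v"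
proof -
  have "0 \<le> integral {u..v} (\<lambda>t. sqrt (hh t))"
    using assms hh_pos by (intro integral_nonneg integrable_continuous_real sqrt_hh_cont) (auto intro: less_imp_le)
  then show ?thesis using P_diff[OF assms] by simp
qed

lemma dist_le_P:
  assumes "a \<le> u" "u \<le> v" "v \<le> b"
  shows "dist (\<gamma> u) (\<gamma> v) \<le> 2 * \<Lambda>\<^sub>2 \<kappa> * P v - 2 * \<Lambda>\<^sub>2 \<kappa> * P u"
proof (rule local_to_global[where R = "\<lambda>u v w. dist (\<gamma> u) (\<gamma> v) \<le> w" and a = a and b = b, OF _ delta0(1)])
  show "dist (\<gamma> u) (\<gamma> w) \<le> x + y" if "dist (\<gamma> u) (\<gamma> v) \<le> x" "dist (\<gamma> v) (\<gamma> w) \<le> y" for u v w x y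
    using that dist_triangle[of "\<gamma> u" "\<gamma> w" "\<gamma> v"] by linarith
  fix u v assume uv: "a \<le> u" "u \<le> v" "v \<le> b" "v - u \<le> \<delta>\<^sub>0"
  have "norm (\<gamma> v - \<gamma> u) \<le> \<Lambda>\<^sub>2 \<kappa> * (v - u) * sqrt (ht (\<gamma> u))"
    by (rule wtD(1)[OF in_dom wt_step[OF uv]]) (use uv in auto)
  also have "\<dots> = \<Lambda>\<^sub>2 \<kappa> * ((v - u) * sqrt (hh u))" by (simp add: hh_def)
  also have "\<dots> \<le> \<Lambda>\<^sub>2 \<kappa> * (2 * (P v - P u))"
    unfolding P_diff[OF uv(1,2,3)] using sqrt_step[OF uv] Lambda_pos(2)[OF kap] by (intro mult_left_mono) auto
  finally show "dist (\<gamma> u) (\<gamma> v) \<le> 2 * \<Lambda>\<^sub>2 \<kappa> * P v - 2 * \<Lambda>\<^sub>2 \<kappa> * P u"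
    by (simp add: dist_norm norm_minus_commute algebra_simps)
qed (use assms in auto)

lemma curve_length_le:
  "curve_length {a..b} \<gamma> \<le> ennreal (2 * \<Lambda>\<^sub>2 \<kappa> * P b)"
  unfolding curve_length_def
proof (rule Sup_least, clarify)
  fix m :: nat and t :: "nat \<Rightarrow> real"
  assume t: "\<forall>i\<le>m. t i \<in> {a..b}" "\<forall>i<m. t i \<le> t (Suc i)"
  have "(\<Sum>i<m. dist (\<gamma> (t i)) (\<gamma> (t (Suc i)))) \<le> (\<Sum>i<m. 2 * \<Lambda>\<^sub>2 \<kappa> * P (t (Suc i)) - 2 * \<Lambda>\<^sub>2 \<kappa> * P (t i))"
  proof (rule sum_mono)
    fix i assume "i \<in> {..<m}"
    then show "dist (\<gamma> (t i)) (\<gamma> (t (Suc i))) \<le> 2 * \<Lambda>\<^sub>2 \<kappa> * P (t (Suc i)) - 2 * \<Lambda>\<^sub>2 \<kappa> * P (t i)"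
      using t by (intro dist_le_P) auto
  qed
  also have "\<dots> = 2 * \<Lambda>\<^sub>2 \<kappa> * P (t m) - 2 * \<Lambda>\<^sub>2 \<kappa> * P (t 0)" by (rule sum_lessThan_telescope)
  also have "\<dots> \<le> 2 * \<Lambda>\<^sub>2 \<kappa> * P b"
  proof -
    have "P (t m) \<le> P b" using t(1) by (intro P_mono) auto
    moreover have "P a \<le> P (t 0)" using t(1) by (intro P_mono) auto
    moreover have "P a = 0" by (simp add: P_def)
    ultimately show ?thesis using Lambda_pos(2)[OF kap] by (smt (verit) mult_left_mono mult_nonneg_nonneg)
  qed
  finally show "(\<Sum>i<m. ennreal (dist (\<gamma> (t i)) (\<gamma> (t (Suc i))))) \<le> ennreal (2 * \<Lambda>\<^sub>2 \<kappa> * P b)"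
    by (subst sum_ennreal) (auto intro: ennreal_leI)
qed

text \<open>A short step of weight \<open>\<Lambda>\<^sub>2 \<kappa> * (q - p)\<close> is lifted at
  the cost given by \<open>kchain_push_near\<close>; its factor \<open>sqrt (hh p / s)\<close>
  integrates to increments of \<open>P\<close> divided by \<open>sqrt s\<close>.\<close>

lemma kchain_push_along:
  assumes s: "0 < s" "s \<le> s\<^sub>1" and uv: "a \<le> u" "u \<le> v" "v \<le> b" and low: "\<And>t. t \<in> {u..v} \<Longrightarrow> hh t \<le> s"
  shows "kchain \<Omega> (push s (\<gamma> u)) (push s (\<gamma> v)) (2 * C\<^sub>u * C\<^sub>p * \<Lambda>\<^sub>2 \<kappa> / sqrt s * (P v - P u))"
proof -
  define B where "B = 2 * C\<^sub>u * C\<^sub>p * \<Lambda>\<^sub>2 \<kappa> / sqrt s"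
  define d where "d = min \<delta>\<^sub>0 (a\<^sub>0 / (\<Lambda>\<^sub>2 \<kappa> * C\<^sub>p))"
  have LC: "0 < \<Lambda>\<^sub>2 \<kappa> * C\<^sub>p" using Lambda_pos(2)[OF kap] Cp_pos by simp
  have d: "0 < d" using delta0(1) a0(1) LC by (simp add: d_def)
  have "kchain \<Omega> (push s (\<gamma> u)) (push s (\<gamma> v)) (B * P v - B * P u)"
  proof (rule local_to_global[where R = "\<lambda>u v w. kchain \<Omega> (push s (\<gamma> u)) (push s (\<gamma> v)) w" and a = u and b = v, OF _ d])
    show "kchain \<Omega> (push s (\<gamma> p)) (push s (\<gamma> q)) (x + y)"
      if "kchain \<Omega> (push s (\<gamma> p)) (push s (\<gamma> m)) x" "kchain \<Omega> (push s (\<gamma> m)) (push s (\<gamma> q)) y" for p m q x y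
      using that by (rule kchain_trans)
    fix p q assume pq: "u \<le> p" "p \<le> q" "q \<le> v" "q - p \<le> d"
    have pq': "a \<le> p" "p \<le> q" "q \<le> b" "q - p \<le> \<delta>\<^sub>0" using pq uv by (auto simp: d_def)
    have m: "\<gamma> p \<in> \<Omega>" "\<gamma> q \<in> \<Omega>" using pq' by (auto intro: in_dom)
    have hp: "0 < hh p" "hh p \<le> s" using pq pq' by (auto intro!: hh_pos low)
    have "\<Lambda>\<^sub>2 \<kappa> * (q - p) * C\<^sub>p = (q - p) * (\<Lambda>\<^sub>2 \<kappa> * C\<^sub>p)" by simp
    also have "\<dots> \<le> a\<^sub>0" using pq(4) LC by (simp add: d_def pos_le_divide_eq)
    finally have X: "\<Lambda>\<^sub>2 \<kappa> * (q - p) * C\<^sub>p \<le> a\<^sub>0" .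
    have "kchain \<Omega> (push s (\<gamma> p)) (push s (\<gamma> q)) (C\<^sub>u * C\<^sub>p * (\<Lambda>\<^sub>2 \<kappa> * (q - p)) * sqrt (ht (\<gamma> p) / s))"
      using hp by (intro kchain_push_near[OF m _ s(2) wt_step[OF pq'] X]) (simp add: hh_def)
    moreover have "C\<^sub>u * C\<^sub>p * (\<Lambda>\<^sub>2 \<kappa> * (q - p)) * sqrt (ht (\<gamma> p) / s) \<le> B * P q - B * P p"
    proof -
      have "C\<^sub>u * C\<^sub>p * (\<Lambda>\<^sub>2 \<kappa> * (q - p)) * sqrt (ht (\<gamma> p) / s) = B / 2 * ((q - p) * sqrt (hh p))"
        by (simp add: B_def hh_def real_sqrt_divide)
      also have "\<dots> \<le> B / 2 * (2 * (P q - P p))"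
        unfolding P_diff[OF pq'(1,2,3)] using sqrt_step[OF pq'] Lambda_pos(2)[OF kap] Cu_pos Cp_pos s
        by (intro mult_left_mono) (auto simp: B_def)
      finally show ?thesis by (simp add: algebra_simps)
    qed
    ultimately show "kchain \<Omega> (push s (\<gamma> p)) (push s (\<gamma> q)) (B * P q - B * P p)" by (rule kchain_mono)
  qed (use uv in auto)
  then show ?thesis by (simp add: B_def right_diff_distrib)
qed

text \<open>As \<open>hh t + s \<le> 2 * hh t\<close>, the logarithm in \<open>push_vertical\<close>
  is at most \<open>ln 2\<close>.\<close>

lemma kchain_lift:
  assumes s: "0 < s" "s \<le> s\<^sub>1" and t: "t \<in> {a..b}" "s \<le> hh t"
  shows "kchain \<Omega> (\<gamma> t) (push s (\<gamma> t)) C\<^sub>v"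
proof -
  have h: "0 < hh t" by (rule hh_pos[OF t(1)])
  have "kchain \<Omega> (push 0 (\<gamma> t)) (push s (\<gamma> t)) (C\<^sub>v * ln (hh t + s) - C\<^sub>v * ln (hh t + 0))"
    unfolding hh_def using s by (intro push_vertical in_dom t(1)) auto
  moreover have "C\<^sub>v * ln (hh t + s) - C\<^sub>v * ln (hh t + 0) \<le> C\<^sub>v"
  proof -
    have "ln (hh t + s) \<le> ln (2 * hh t)" using h s t(2) by (subst ln_le_cancel_iff) auto
    also have "\<dots> \<le> 1 + ln (hh t)" using h ln_le_minus_one[of "2::real"] by (simp add: ln_mult)
    finally have "C\<^sub>v * (ln (hh t + s) - ln (hh t)) \<le> C\<^sub>v * 1" using Cv_pos by (intro mult_left_mono) auto
    then show ?thesis by (simp add: right_diff_distrib)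
  qed
  ultimately show ?thesis using kchain_mono by fastforce
qed

text \<open>The comparison path goes from \<open>\<gamma> u\<close> up to its lift, back along the
  lifted initial piece to the lift of \<open>\<gamma> a\<close>, across to that of
  \<open>\<gamma> b\<close>, back along the lifted final piece and down to
  \<open>\<gamma> v\<close>. Its length is at least \<open>(v - u) / \<kappa>\<close>. The
  alternatives \<open>u = a\<close> and \<open>v = b\<close> allow endpoints above height
  \<open>s\<close>, where the outer piece is empty.\<close>

lemma time_le:
  assumes far: "\<forall>p q s. p \<in> \<Omega> \<longrightarrow> q \<in> \<Omega> \<longrightarrow> 0 < s \<longrightarrow> s \<le> s\<^sub>1 \<longrightarrow>
       kchain \<Omega> (push s p) (push s q) (C * (1 + ln (1 + norm (p - q) / s)))"
    and C: "0 < C" and s: "0 < s" "s \<le> s\<^sub>1" and uv: "a \<le> u" "u \<le> v" "v \<le> b"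
    and lowu: "u = a \<or> (\<forall>t\<in>{a..u}. hh t \<le> s)" and lowv: "v = b \<or> (\<forall>t\<in>{v..b}. hh t \<le> s)"
    and high: "s \<le> hh u" "s \<le> hh v"
  shows "v - u \<le> \<kappa> * (2 * C\<^sub>v + C + 2 * C\<^sub>u * C\<^sub>p * \<Lambda>\<^sub>2 \<kappa>) *
      (1 + ln (1 + norm (\<gamma> a - \<gamma> b) / s) + (P u + (P b - P v)) / sqrt s)"
proof -
  define l where "l = ln (1 + norm (\<gamma> a - \<gamma> b) / s)"
  define B where "B = 2 * C\<^sub>u * C\<^sub>p * \<Lambda>\<^sub>2 \<kappa>"
  define J where "J = (P u + (P b - P v)) / sqrt s"
  have B: "0 < B" using Lambda_pos(2)[OF kap] Cu_pos Cp_pos by (simp add: B_def)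
  have l: "0 \<le> l" using s by (simp add: l_def)
  have Pa: "P a = 0" by (simp add: P_def)
  have Pm: "0 \<le> P u" "P v \<le> P b" using P_mono[of a u] P_mono[of v b] uv Pa by auto
  have J: "0 \<le> J" using Pm s by (simp add: J_def)
  have m: "u \<in> {a..b}" "v \<in> {a..b}" "a \<in> {a..b}" "b \<in> {a..b}" using uv by auto
  have pO: "push s (\<gamma> t) \<in> \<Omega>" if "t \<in> {a..b}" for t using push_inside(1)[OF in_dom[OF that]] s by simp
  have left: "kchain \<Omega> (push s (\<gamma> a)) (push s (\<gamma> u)) (B / sqrt s * P u)"
  proof (cases "u = a")
    case True
    then show ?thesis using Pa pO[OF m(3)] by (auto intro: kchain.refl)
  next
    case False
    then show ?thesis using lowu kchain_push_along[OF s, of a u] uv Pa by (auto simp: B_def)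
  qed
  have right: "kchain \<Omega> (push s (\<gamma> v)) (push s (\<gamma> b)) (B / sqrt s * (P b - P v))"
  proof (cases "v = b")
    case True
    then show ?thesis using pO[OF m(4)] by (auto intro: kchain.refl)
  next
    case False
    then show ?thesis using lowv kchain_push_along[OF s, of v b] uv by (auto simp: B_def)
  qed
  have mid: "kchain \<Omega> (push s (\<gamma> a)) (push s (\<gamma> b)) (C * (1 + l))"
    unfolding l_def using far in_dom m s by blast
  have ch: "kchain \<Omega> (\<gamma> u) (\<gamma> v) (C\<^sub>v + (B / sqrt s * P u + (C * (1 + l) + (B / sqrt s * (P b - P v) + C\<^sub>v))))"
    by (rule kchain_trans[OF kchain_lift[OF s m(1) high(1)] kchain_trans[OF kchain_sym[OF left]
          kchain_trans[OF mid kchain_trans[OF kchain_sym[OF right] kchain_sym[OF kchain_lift[OF s m(2) high(2)]]]]]])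
  have eq: "C\<^sub>v + (B / sqrt s * P u + (C * (1 + l) + (B / sqrt s * (P b - P v) + C\<^sub>v))) = 2 * C\<^sub>v + C * (1 + l) + B * J"
    by (simp add: J_def add_divide_distrib diff_divide_distrib algebra_simps)
  have "kchain \<Omega> (\<gamma> u) (\<gamma> v) (2 * C\<^sub>v + C * (1 + l) + B * J)" using ch unfolding eq .
  then have "kobayashi_dist \<Omega> (\<gamma> u) (\<gamma> v) \<le> ennreal (2 * C\<^sub>v + C * (1 + l) + B * J)"
    by (rule kobayashi_dist_le_kchain)
  moreover have "ennreal (1 / \<kappa> * \<bar>v - u\<bar>) \<le> kobayashi_dist \<Omega> (\<gamma> u) (\<gamma> v)"
    using qg m by (auto simp: kobayashi_quasi_geodesic_def)
  ultimately have "ennreal (1 / \<kappa> * \<bar>v - u\<bar>) \<le> ennreal (2 * C\<^sub>v + C * (1 + l) + B * J)"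
    by (rule order_trans[rotated])
  then have "1 / \<kappa> * \<bar>v - u\<bar> \<le> 2 * C\<^sub>v + C * (1 + l) + B * J"
    using Cv_pos C l B J by (subst (asm) ennreal_le_iff) auto
  also have "\<dots> \<le> (2 * C\<^sub>v + C + B) * (1 + l + J)"
  proof -
    have "0 \<le> C\<^sub>v * l" "0 \<le> C\<^sub>v * J" "0 \<le> C * J" "0 \<le> B * l" using Cv_pos C l B J by auto
    then show ?thesis using B by (simp add: algebra_simps)
  qed
  finally have "v - u \<le> \<kappa> * ((2 * C\<^sub>v + C + B) * (1 + l + J))"
    using kap uv by (simp add: field_simps)
  then show ?thesis unfolding l_def B_def J_def by (simp add: mult.assoc)
qed

end

section \<open>The recursion over dyadic heights\<close>

lemma ln_one_plus_le_sqrt: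
  fixes x :: real
  assumes "0 \<le> x"
  shows "ln (1 + x) \<le> 2 * sqrt x"
proof -
  have "sqrt (1 + x) \<le> 1 + sqrt x"
    using assms by (intro real_le_lsqrt) (auto simp: power2_eq_square algebra_simps)
  moreover have "ln (1 + x) = 2 * ln (sqrt (1 + x))" using assms by (simp add: ln_sqrt)
  moreover have "ln (sqrt (1 + x)) \<le> sqrt (1 + x) - 1" using assms by (intro ln_le_minus_one) auto
  ultimately show ?thesis by linarith
qed

text \<open>The recursion over dyadic heights: \<open>J\<close> is the rescaled length below height \<open>s\<close> and
  \<open>T\<close> the time spent between the first and the last visit to that height. Length gained on the
  way up to height \<open>2 s\<close> is paid for by \<open>T\<close>, while \<open>J\<close> contracts by the factor \<open>1 / sqrt 2\<close>.\<close>

lemma dyadic_recursion: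
  fixes J T L :: "nat \<Rightarrow> real" and C :: real
  assumes C: "1 \<le> C" and J0: "J 0 = 0"
    and Jn: "\<And>k. k \<le> n \<Longrightarrow> 0 \<le> J k" and Ln: "\<And>k. k \<le> n \<Longrightarrow> 0 \<le> L k"
    and rec: "\<And>k. Suc k \<le> n \<Longrightarrow> J (Suc k) \<le> 3 / 4 * J k + T k - T (Suc k)"
    and T: "\<And>k. k \<le> n \<Longrightarrow> T k \<le> C * (1 + L k + J k)"
    and L: "\<And>k. Suc k \<le> n \<Longrightarrow> L k \<le> L (Suc k) + 1"
  shows "J n + T n \<le> 8 * C * (8 * C + 1 + L n)"
proof -
  have "k \<le> n \<Longrightarrow> J k + T k \<le> 8 * C * (8 * C + 1 + L k)" for k
  proof (induction k)
    case 0
    have "T 0 \<le> C * (1 + L 0)" using T[of 0] J0 by simp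
    also have "\<dots> \<le> 8 * C * (8 * C + 1 + L 0)" using C Ln[of 0] by (intro mult_mono) auto
    finally show ?case using J0 by simp
  next
    case (Suc k)
    \<comment> \<open>\<open>T k\<close> is split into \<open>\<theta> * T k\<close> and
      \<open>T k / (8 * C)\<close>; the bound for \<open>T k\<close> makes the second part at most
      \<open>(1 + L k + J k) / 8\<close>. Since \<open>3 / 4 + 1 / 8 \<le> \<theta>\<close>, the sum
      \<open>J k + T k\<close> contracts by \<open>\<theta>\<close>. This lowers the bound by
      \<open>8 * C + 1 + L k\<close>, enough for the remaining \<open>(1 + L k) / 8\<close> and for
      the drift of \<open>L\<close>, which costs \<open>8 * C\<close>.\<close>
    define \<theta> where "\<theta> = 1 - 1 / (8 * C)"
    have \<theta>: "7 / 8 \<le> \<theta>" "(1 - \<theta>) * C = 1 / 8" "(1 - \<theta>) * (8 * C) = 1" using C by (auto simp: \<theta>_def field_simps)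
    have k: "k \<le> n" "Suc k \<le> n" using Suc.prems by auto
    have IH: "J k + T k \<le> 8 * C * (8 * C + 1 + L k)" using Suc.IH k by simp
    have "(1 - \<theta>) * T k \<le> (1 - \<theta>) * (C * (1 + L k + J k))"
      using T[OF k(1)] C by (intro mult_left_mono) (auto simp: \<theta>_def)
    also have "\<dots> = 1 / 8 * (1 + L k + J k)" using \<theta>(2) by (simp only: mult.assoc[symmetric])
    finally have "(1 - \<theta>) * T k \<le> 1 / 8 * (1 + L k + J k)" .
    moreover have "(1 - \<theta>) * T k = T k - \<theta> * T k" by (simp add: left_diff_distrib)
    ultimately have T1: "T k \<le> \<theta> * T k + 1 / 8 * (1 + L k + J k)" by linarith
    have J1: "7 / 8 * J k \<le> \<theta> * J k" using \<theta>(1) Jn[OF k(1)] by (intro mult_right_mono) auto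
    have lin: "j' + t' \<le> z + 1 / 8 * (1 + l)"
      if "7 / 8 * j \<le> x" "j' \<le> 3 / 4 * j + t - t'" "t \<le> y + 1 / 8 * (1 + l + j)" "x + y \<le> z" for j j' t t' x y z l :: real
      using that by argo
    have "\<theta> * J k + \<theta> * T k = \<theta> * (J k + T k)" by (simp only: distrib_left)
    also have "\<dots> \<le> \<theta> * (8 * C * (8 * C + 1 + L k))"
      using IH \<theta>(1) by (intro mult_left_mono) auto
    also have "\<dots> = 8 * C * (8 * C + 1 + L k) - ((1 - \<theta>) * (8 * C)) * (8 * C + 1 + L k)"
      by (simp add: algebra_simps)
    also have "\<dots> = 8 * C * (8 * C + 1 + L k) - (8 * C + 1 + L k)" unfolding \<theta>(3) by simp
    finally have "J (Suc k) + T (Suc k) \<le> 8 * C * (8 * C + 1 + L k) - (8 * C + 1 + L k) + 1 / 8 * (1 + L k)"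
      by (rule lin[OF J1 rec[OF k(2)] T1])
    also have "\<dots> \<le> 8 * C * (8 * C + 1 + L k) - 8 * C"
    proof -
      have "1 / 8 * (1 + L k) \<le> 1 + L k" using Ln[OF k(1)] by simp
      then show ?thesis by linarith
    qed
    also have "\<dots> = 8 * C * (8 * C + 1 + (L k - 1))" by (simp add: algebra_simps)
    also have "\<dots> \<le> 8 * C * (8 * C + 1 + L (Suc k))" using L[OF k(2)] C by (intro mult_left_mono) auto
    finally show ?case .
  qed
  then show ?thesis by simp
qed

lemma exists_dyadic_scale:
  fixes s S :: real
  assumes "0 < s" "s \<le> S"
  obtains n :: nat where "2 ^ n * s \<le> S" "S < 2 ^ Suc n * s"
proof -
  define Q where "Q k \<longleftrightarrow> S < 2 ^ k * s" for k :: nat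
  obtain k where "S / s < 2 ^ k" using real_arch_pow[of 2 "S / s"] by auto
  then have Qk: "Q k" using assms(1) by (simp add: Q_def field_simps)
  define m where "m = (LEAST k. Q k)"
  have Qm: "Q m" unfolding m_def using Qk by (rule LeastI)
  have "m \<noteq> 0" using Qm assms by (auto simp: Q_def intro: gr0I)
  then obtain n where n: "m = Suc n" by (cases m) auto
  have "\<not> Q n" using not_less_Least[of n Q] n m_def by simp
  then show thesis using that[of n] Qm n by (simp add: Q_def)
qed

section \<open>First and last visits to a height\<close>

context spd_quasi_geodesic
begin

definition U :: "real \<Rightarrow> real set" where "U s = {t \<in> {a..b}. s \<le> hh t}"

definition first :: "real \<Rightarrow> real" where "first s = Inf (U s)"

definition last_time :: "real \<Rightarrow> real" where "last_time s = Sup (U s)"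

lemma U_compact: "compact (U s)"
proof -
  have "closed (U s)" unfolding U_def
    by (intro continuous_on_closed_Collect_le continuous_on_const hh_cont) auto
  moreover have "bounded (U s)" by (rule bounded_subset[of "{a..b}"]) (auto simp: U_def)
  ultimately show ?thesis by (simp add: compact_eq_bounded_closed)
qed

lemma visits:
  assumes "U s \<noteq> {}"
  shows "first s \<in> U s" "last_time s \<in> U s" "first s \<le> last_time s"
    "\<And>t. t \<in> U s \<Longrightarrow> first s \<le> t \<and> t \<le> last_time s"
proof -
  have bd: "bdd_below (U s)" "bdd_above (U s)"
    using compact_imp_bounded[OF U_compact[of s]]
    by (auto intro: bounded_imp_bdd_below bounded_imp_bdd_above)
  show 1: "\<And>t. t \<in> U s \<Longrightarrow> first s \<le> t \<and> t \<le> last_time s"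
    using bd by (auto simp: first_def last_time_def intro: cInf_lower cSup_upper)
  have cl: "closed (U s)" using U_compact by (rule compact_imp_closed)
  show "first s \<in> U s" unfolding first_def by (rule closed_contains_Inf[OF assms bd(1) cl])
  show "last_time s \<in> U s" unfolding last_time_def by (rule closed_contains_Sup[OF assms bd(2) cl])
  then show "first s \<le> last_time s" using 1 by blast
qed

lemma low_limit:
  assumes "x \<in> {a..b}" and "x islimpt {t \<in> {a..b}. hh t \<le> s}"
  shows "hh x \<le> s"
proof -
  have "closed {t \<in> {a..b}. hh t \<le> s}"
    by (intro continuous_on_closed_Collect_le continuous_on_const hh_cont) auto
  then show ?thesis using assms(2) closed_limpt by blast
qed

text \<open>Before the first visit the height is below \<open>s\<close>, and at
  \<open>first s\<close> the bound follows by continuity. For \<open>first s = a\<close> there is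
  nothing before, and the height at \<open>a\<close> may exceed \<open>s\<close>.\<close>

lemma low_before:
  assumes "U s \<noteq> {}" "first s \<noteq> a" "t \<in> {a..first s}"
  shows "hh t \<le> s"
proof -
  note v = visits[OF assms(1)]
  have f: "a < first s" "first s \<le> b" using v(1) assms(2) by (auto simp: U_def)
  have lo: "hh x \<le> s" if "a \<le> x" "x < first s" for x
    using v(4)[of x] that f by (force simp: U_def)
  show ?thesis
  proof (cases "t = first s")
    case True
    have "first s islimpt {a<..<first s}" using f(1) by (simp add: islimpt_greaterThanLessThan2)
    then have "first s islimpt {t \<in> {a..b}. hh t \<le> s}"
      by (rule islimpt_subset) (use lo f in auto)
    then show ?thesis using low_limit[of "first s" s] f True by auto
  qed (use lo assms(3) in auto)
qed

lemma low_after: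
  assumes "U s \<noteq> {}" "last_time s \<noteq> b" "t \<in> {last_time s..b}"
  shows "hh t \<le> s"
proof -
  note v = visits[OF assms(1)]
  have f: "last_time s < b" "a \<le> last_time s" using v(2) assms(2) by (auto simp: U_def)
  have lo: "hh x \<le> s" if "last_time s < x" "x \<le> b" for x
    using v(4)[of x] that f by (force simp: U_def)
  show ?thesis
  proof (cases "t = last_time s")
    case True
    have "last_time s islimpt {last_time s<..<b}" using f(1) by (simp add: islimpt_greaterThanLessThan1)
    then have "last_time s islimpt {t \<in> {a..b}. hh t \<le> s}"
      by (rule islimpt_subset) (use lo f in auto)
    then show ?thesis using low_limit[of "last_time s" s] f True by auto
  qed (use lo assms(3) in auto)
qed

lemma P_diff_le:
  assumes "a \<le> u" "u \<le> v" "v \<le> b" "\<And>t. t \<in> {u..v} \<Longrightarrow> hh t \<le> H" "u \<noteq> v \<Longrightarrow> 0 \<le> H"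
  shows "P v - P u \<le> (v - u) * sqrt H"
proof -
  have "integral {u..v} (\<lambda>t. sqrt (hh t)) \<le> integral {u..v} (\<lambda>t. sqrt H)"
    using assms by (intro integral_le integrable_continuous_real sqrt_hh_cont) auto
  then show ?thesis using P_diff[OF assms(1,2,3)] assms(2) by simp
qed

text \<open>The integral of \<open>sqrt hh\<close> over the two outer pieces; divided by
  \<open>sqrt s\<close> it is the \<open>J\<close> of the recursion.\<close>

definition out :: "real \<Rightarrow> real" where "out s = P (first s) + (P b - P (last_time s))"

text \<open>The \<open>T\<close> of the recursion. Excursions below \<open>s\<close> between the
  first and the last visit are counted.\<close>

definition dur :: "real \<Rightarrow> real" where "dur s = last_time s - first s"

lemma out_nonneg:
  assumes "U s \<noteq> {}"
  shows "0 \<le> out s"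
proof -
  note v = visits[OF assms]
  have "P a \<le> P (first s)" "P (last_time s) \<le> P b" using v(1,2) by (auto simp: U_def intro!: P_mono)
  then show ?thesis by (simp add: out_def P_def)
qed

text \<open>What the outer pieces gain lies before the first or after the last visit to
  \<open>2 * s\<close>, hence at height at most \<open>2 * s\<close>, and lasts as long as
  \<open>dur\<close> decreases.\<close>

lemma out_step:
  assumes s: "0 < s" and ne: "U (2 * s) \<noteq> {}"
  shows "out (2 * s) \<le> out s + sqrt (2 * s) * (dur s - dur (2 * s))"
proof -
  have sub: "U (2 * s) \<subseteq> U s" using s by (auto simp: U_def)
  then have ne': "U s \<noteq> {}" using ne by auto
  note v = visits[OF ne] and v' = visits[OF ne']
  have m: "first s \<le> first (2 * s)" "last_time (2 * s) \<le> last_time s" using v'(4) v(1,2) sub by auto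
  have r: "a \<le> first s" "first (2 * s) \<le> b" "a \<le> last_time (2 * s)" "last_time s \<le> b"
    using v(1,2) v'(1,2) by (auto simp: U_def)
  have "P (first (2 * s)) - P (first s) \<le> (first (2 * s) - first s) * sqrt (2 * s)"
  proof (cases "first (2 * s) = first s")
    case False
    then have "first (2 * s) \<noteq> a" using m r by auto
    then show ?thesis using low_before[OF ne] m r s by (intro P_diff_le) auto
  qed simp
  moreover have "P (last_time s) - P (last_time (2 * s)) \<le> (last_time s - last_time (2 * s)) * sqrt (2 * s)"
  proof (cases "last_time (2 * s) = last_time s")
    case False
    then have "last_time (2 * s) \<noteq> b" using m r by auto
    then show ?thesis using low_after[OF ne] m r s by (intro P_diff_le) auto
  qed simp
  ultimately show ?thesis by (simp add: out_def dur_def algebra_simps)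
qed

lemma scale_bound:
  assumes C: "1 \<le> C" and time: "\<And>s. \<lbrakk>0 < s; s \<le> s\<^sub>1; U s \<noteq> {}\<rbrakk> \<Longrightarrow> dur s \<le> C * (1 + ln (1 + e / s) + out s / sqrt s)"
    and e: "0 \<le> e" and s0: "0 < s\<^sub>0" "s\<^sub>0 \<le> hh a" "s\<^sub>0 \<le> hh b"
    and n: "2 ^ n * s\<^sub>0 \<le> s\<^sub>1" "U (2 ^ n * s\<^sub>0) \<noteq> {}"
  defines "s \<equiv> 2 ^ n * s\<^sub>0"
  shows "out s / sqrt s + dur s \<le> 8 * C * (8 * C + 1 + ln (1 + e / s))"
proof -
  define sk where "sk k = 2 ^ k * s\<^sub>0" for k :: nat
  have sk: "0 < sk k" "sk (Suc k) = 2 * sk k" for k using s0(1) by (auto simp: sk_def)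
  have le: "sk k \<le> sk n" if "k \<le> n" for k
    using that s0(1) by (auto simp: sk_def intro!: mult_right_mono power_increasing)
  have ne: "U (sk k) \<noteq> {}" if "k \<le> n" for k
    using n(2) le[OF that] unfolding sk_def[symmetric] by (auto simp: U_def)
  have m: "a \<in> {a..b}" "b \<in> {a..b}" using ab by auto
  have "(\<lambda>k. out (sk k) / sqrt (sk k)) n + (\<lambda>k. dur (sk k)) n \<le> 8 * C * (8 * C + 1 + (\<lambda>k. ln (1 + e / sk k)) n)"
  proof (rule dyadic_recursion[OF C])
    \<comment> \<open>\<open>s\<^sub>0\<close> does not exceed the height of either endpoint, so the
      outer pieces are empty at the initial scale.\<close>
    have "a \<in> U (sk 0)" "b \<in> U (sk 0)" using s0 m by (auto simp: U_def sk_def)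
    then have "first (sk 0) = a" "last_time (sk 0) = b"
      using visits[of "sk 0"] by (force simp: U_def)+
    then show "out (sk 0) / sqrt (sk 0) = 0" by (simp add: out_def P_def)
    show "0 \<le> out (sk k) / sqrt (sk k)" if "k \<le> n" for k
      using out_nonneg[OF ne[OF that]] sk(1)[of k] by simp
    show "0 \<le> ln (1 + e / sk k)" for k using e sk(1)[of k] by simp
    show "out (sk (Suc k)) / sqrt (sk (Suc k)) \<le> 3 / 4 * (out (sk k) / sqrt (sk k)) + dur (sk k) - dur (sk (Suc k))"
      if "Suc k \<le> n" for k
    proof -
      have kn: "k \<le> n" using that by simp
      have o: "0 \<le> out (sk k)" by (rule out_nonneg[OF ne[OF kn]])
      have "out (2 * sk k) \<le> out (sk k) + sqrt (2 * sk k) * (dur (sk k) - dur (2 * sk k))"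
        using ne[OF that] by (intro out_step sk(1)) (simp add: sk(2))
      then have "out (2 * sk k) / sqrt (2 * sk k) \<le> (out (sk k) + sqrt (2 * sk k) * (dur (sk k) - dur (2 * sk k))) / sqrt (2 * sk k)"
        using sk(1)[of k] by (intro divide_right_mono) auto
      also have "\<dots> = out (sk k) / sqrt (2 * sk k) + (dur (sk k) - dur (2 * sk k))"
        using sk(1)[of k] by (simp add: add_divide_distrib)
      \<comment> \<open>\<open>sqrt 2 \<ge> 4 / 3\<close> yields the factor \<open>3 / 4\<close> of
        the recursion.\<close>
      also have "out (sk k) / sqrt (2 * sk k) \<le> out (sk k) / (4 / 3 * sqrt (sk k))"
      proof (rule divide_left_mono)
        have "4 / 3 * sqrt (sk k) = sqrt (16 / 9 * sk k)" by (simp add: real_sqrt_mult real_sqrt_divide)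
        also have "\<dots> \<le> sqrt (2 * sk k)" using sk(1)[of k] by simp
        finally show "4 / 3 * sqrt (sk k) \<le> sqrt (2 * sk k)" .
      qed (use o sk(1)[of k] in auto)
      also have "out (sk k) / (4 / 3 * sqrt (sk k)) = 3 / 4 * (out (sk k) / sqrt (sk k))" by simp
      finally show ?thesis unfolding sk(2) by simp
    qed
    show "dur (sk k) \<le> C * (1 + ln (1 + e / sk k) + out (sk k) / sqrt (sk k))" if "k \<le> n" for k
      using le[OF that] n(1) by (intro time sk(1) ne[OF that]) (simp add: sk_def)
    show "ln (1 + e / sk k) \<le> ln (1 + e / sk (Suc k)) + 1" for k
    proof -
      have p: "0 \<le> e / sk k" using e sk(1)[of k] by simp
      have "1 + e / sk k \<le> 2 * (1 + e / sk (Suc k))" by (simp add: sk(2))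
      then have "ln (1 + e / sk k) \<le> ln (2 * (1 + e / sk (Suc k)))" using p by simp
      also have "\<dots> = ln 2 + ln (1 + e / sk (Suc k))"
        by (rule ln_mult_pos) (use p in \<open>auto simp: sk(2)\<close>)
      also have "ln 2 \<le> (1::real)" using ln_le_minus_one[of "2::real"] by simp
      finally show ?thesis by simp
    qed
  qed
  then show ?thesis by (simp add: s_def sk_def)
qed

lemma P_end_split:
  assumes "U s \<noteq> {}" "\<And>t. t \<in> {first s..last_time s} \<Longrightarrow> hh t \<le> H" "0 \<le> H"
  shows "P b \<le> out s + dur s * sqrt H"
proof -
  note v = visits[OF assms(1)]
  have "P (last_time s) - P (first s) \<le> (last_time s - first s) * sqrt H"
    using v(1,2,3) assms by (intro P_diff_le) (auto simp: U_def)
  then show ?thesis by (simp add: out_def dur_def)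
qed

lemma hh_exp_le:
  assumes "s \<in> {a..b}" "t \<in> {a..b}" "\<bar>t - s\<bar> \<le> d"
  shows "hh t \<le> hh s * exp (\<Lambda>\<^sub>1 \<kappa> * d)"
proof -
  have "ln (hh t) - ln (hh s) \<le> \<Lambda>\<^sub>1 \<kappa> * \<bar>t - s\<bar>" using ln_hh[OF assms(1,2)] by linarith
  also have "\<dots> \<le> \<Lambda>\<^sub>1 \<kappa> * d" using assms(3) Lambda_pos(1)[OF kap] by (intro mult_left_mono) auto
  finally have "ln (hh t) \<le> ln (hh s) + \<Lambda>\<^sub>1 \<kappa> * d" by simp
  then have "exp (ln (hh t)) \<le> exp (ln (hh s) + \<Lambda>\<^sub>1 \<kappa> * d)" by simp
  then show ?thesis using hh_pos assms(1,2) by (simp add: exp_add)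
qed

text \<open>The recursion runs up to a dyadic \<open>s\<close> within a factor 2 of
  \<open>S\<close>, the least of the maximal height, \<open>s\<^sub>1\<close> and
  \<open>B * e\<close>. If the maximal height is least, the curve stays below \<open>2 * s\<close>,
  and \<open>sqrt s * ln (1 + e / s) \<le> 2 * sqrt e\<close> absorbs the logarithm. Otherwise
  \<open>e / s\<close> is bounded, hence \<open>dur s \<le> Q\<close>; starting from height O(e),
  the middle piece can rise only by the factor
  \<open>exp (\<Lambda>\<^sub>1 \<kappa> * Q)\<close>.\<close>

lemma P_end_le_low:
  assumes C: "1 \<le> C" and time: "\<And>s. \<lbrakk>0 < s; s \<le> s\<^sub>1; U s \<noteq> {}\<rbrakk> \<Longrightarrow> dur s \<le> C * (1 + ln (1 + e / s) + out s / sqrt s)"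
    and e: "0 < e" "e \<le> 2 * M" and B: "1 \<le> B" "hh a \<le> B * e" "hh b \<le> B * e"
  defines "Q \<equiv> 8 * C * (8 * C + 1 + (4 * M / s\<^sub>1 + 2))"
  shows "P b \<le> (2 * (8 * C * (8 * C + 3)) * B + 2 * B * Q * exp (\<Lambda>\<^sub>1 \<kappa> * Q)) * sqrt e"
proof -
  have m: "a \<in> {a..b}" "b \<in> {a..b}" using ab by auto
  have M: "1 \<le> M" by (rule csts(1))
  obtain tm where tm: "tm \<in> {a..b}" "\<And>t. t \<in> {a..b} \<Longrightarrow> hh t \<le> hh tm"
    using continuous_attains_sup[of "{a..b}" hh] hh_cont ab by auto
  define s0 where "s0 = min (min (hh a) (hh b)) s\<^sub>1"
  have s0: "0 < s0" "s0 \<le> hh a" "s0 \<le> hh b" "s0 \<le> s\<^sub>1" using hh_pos[OF m(1)] hh_pos[OF m(2)] s1(1) by (auto simp: s0_def)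
  define S where "S = min (hh tm) (min s\<^sub>1 (B * e))"
  have "s0 \<le> S" using s0 tm(2)[OF m(1)] B(2) by (auto simp: S_def)
  then obtain n where n: "2 ^ n * s0 \<le> S" "S < 2 ^ Suc n * s0" using exists_dyadic_scale[OF s0(1)] by blast
  define s where "s = 2 ^ n * s0"
  have s: "0 < s" "s \<le> S" "S < 2 * s" using n s0(1) by (auto simp: s_def)
  have ss: "s \<le> hh tm" "s \<le> s\<^sub>1" "s \<le> B * e" using s(2) by (auto simp: S_def)
  have ne: "U s \<noteq> {}" using tm(1) ss(1) by (auto simp: U_def)
  have key: "out s / sqrt s + dur s \<le> 8 * C * (8 * C + 1 + ln (1 + e / s))"
    unfolding s_def using ss(2) ne e by (intro scale_bound[OF C time _ s0(1,2,3)]) (auto simp: s_def)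
  note v = visits[OF ne]
  have dn: "0 \<le> dur s" using v(3) by (simp add: dur_def)
  have on: "0 \<le> out s" by (rule out_nonneg[OF ne])
  have sq: "0 < sqrt s" using s(1) by simp
  have sB: "sqrt s \<le> B * sqrt e"
  proof -
    have "sqrt s \<le> sqrt B * sqrt e" using ss(3) by (simp add: real_sqrt_mult[symmetric])
    also have "sqrt B \<le> B" using B(1) by (intro real_le_lsqrt) (auto simp: power2_eq_square)
    finally show ?thesis using e by simp
  qed
  define A1 where "A1 = 2 * (8 * C * (8 * C + 3)) * B"
  define A2 where "A2 = 2 * B * Q * exp (\<Lambda>\<^sub>1 \<kappa> * Q)"
  have Q: "0 \<le> Q" unfolding Q_def using C M s1(1) by (intro mult_nonneg_nonneg add_nonneg_nonneg) auto
  have A: "0 \<le> A1" "0 \<le> A2" using C B Q by (auto simp: A1_def A2_def)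
  have "P b \<le> (A1 + A2) * sqrt e"
  proof (cases "S = hh tm")
    case True
    have "hh t \<le> 2 * s" if "t \<in> {first s..last_time s}" for t
    proof -
      have "t \<in> {a..b}" using that v(1,2) by (auto simp: U_def)
      then show ?thesis using tm(2)[of t] True s(3) by simp
    qed
    then have "P b \<le> out s + dur s * sqrt (2 * s)" using s(1) by (intro P_end_split[OF ne]) auto
    also have "\<dots> \<le> 2 * sqrt s * (out s / sqrt s + dur s)"
    proof -
      have "sqrt (2 * s) \<le> sqrt (4 * s)" using s(1) by simp
      then have "dur s * sqrt (2 * s) \<le> dur s * (2 * sqrt s)" using dn by (intro mult_left_mono) (auto simp: real_sqrt_mult)
      moreover have "2 * sqrt s * (out s / sqrt s + dur s) = 2 * out s + dur s * (2 * sqrt s)"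
        using s(1) by (simp add: distrib_left)
      ultimately show ?thesis using on by linarith
    qed
    also have "\<dots> \<le> 2 * sqrt s * (8 * C * (8 * C + 1 + ln (1 + e / s)))"
      using key sq by (intro mult_left_mono) auto
    also have "\<dots> = 2 * (8 * C) * ((8 * C + 1) * sqrt s + sqrt s * ln (1 + e / s))" by (simp add: algebra_simps)
    also have "\<dots> \<le> 2 * (8 * C) * ((8 * C + 1) * (B * sqrt e) + 2 * (B * sqrt e))"
    proof (intro mult_left_mono add_mono)
      have "sqrt s * ln (1 + e / s) \<le> sqrt s * (2 * sqrt (e / s))"
        using ln_one_plus_le_sqrt[of "e / s"] e s(1) by (intro mult_left_mono) auto
      also have "\<dots> = 2 * sqrt e" using s(1) by (simp add: real_sqrt_divide)
      also have "\<dots> \<le> 2 * (B * sqrt e)" using B(1) e by simp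
      finally show "sqrt s * ln (1 + e / s) \<le> 2 * (B * sqrt e)" .
    qed (use sB C in auto)
    also have "\<dots> = A1 * sqrt e" by (simp add: A1_def algebra_simps)
    also have "\<dots> \<le> (A1 + A2) * sqrt e" using A e by (intro mult_right_mono) auto
    finally show ?thesis .
  next
    case False
    have es: "e / s \<le> 4 * M / s\<^sub>1 + 2"
    proof (cases "S = s\<^sub>1")
      case True
      then have "e / s \<le> 2 * M / (s\<^sub>1 / 2)" using e s s1(1) M by (intro frac_le) auto
      then show ?thesis by simp
    next
      case False
      then have "S = B * e" using \<open>S \<noteq> hh tm\<close> by (auto simp: S_def min_def split: if_splits)
      then have "e \<le> B * e" "B * e < 2 * s" using B(1) e s(3) by auto
      then have "e / s \<le> 2" using s(1) by (simp add: pos_divide_le_eq)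
      moreover have "0 \<le> 4 * M / s\<^sub>1" using M s1(1) by simp
      ultimately show ?thesis by linarith
    qed
    have "ln (1 + e / s) \<le> e / s" using e s(1) by (intro ln_add_one_self_le_self) auto
    then have "8 * C * (8 * C + 1 + ln (1 + e / s)) \<le> Q"
      unfolding Q_def using es C by (intro mult_left_mono) auto
    with key have JT: "out s / sqrt s + dur s \<le> Q" by linarith
    then have dQ: "dur s \<le> Q" "out s / sqrt s \<le> Q" using dn on sq
      by (smt (verit) divide_nonneg_pos)+
    \<comment> \<open>Either the high part starts at \<open>a\<close>, where the height is bounded
      by assumption, or the curve has just risen to \<open>s\<close>, which is at most
      \<open>B * e\<close>.\<close>
    have hf: "hh (first s) \<le> B * e"
    proof (cases "first s = a")
      case True
      then show ?thesis using B(2) by simp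
    next
      case False
      then have "hh (first s) \<le> s" using low_before[OF ne] v(1) by (auto simp: U_def)
      then show ?thesis using ss(3) by simp
    qed
    define E where "E = exp (\<Lambda>\<^sub>1 \<kappa> * Q)"
    have E: "1 \<le> E" using Q Lambda_pos(1)[OF kap] by (simp add: E_def)
    have "hh t \<le> B * e * E" if t: "t \<in> {first s..last_time s}" for t
    proof -
      have "\<bar>t - first s\<bar> \<le> Q" using t dQ(1) by (auto simp: dur_def)
      then have "hh t \<le> hh (first s) * E"
        unfolding E_def using t v(1,2) by (intro hh_exp_le) (auto simp: U_def)
      also have "\<dots> \<le> B * e * E" using hf E by (intro mult_right_mono) auto
      finally show ?thesis .
    qed
    then have "P b \<le> out s + dur s * sqrt (B * e * E)"
      using B e E by (intro P_end_split[OF ne]) auto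
    also have "out s = out s / sqrt s * sqrt s" using sq by simp
    also have "out s / sqrt s * sqrt s \<le> Q * (B * sqrt e)" using dQ(2) sB Q sq by (intro mult_mono) auto
    also have "dur s * sqrt (B * e * E) \<le> Q * (B * sqrt e * E)"
    proof (rule mult_mono[OF dQ(1)])
      have "sqrt (B * e * E) = sqrt (B * E) * sqrt e" by (simp add: real_sqrt_mult[symmetric] mult_ac)
      also have "sqrt (B * E) \<le> B * E"
      proof -
        have "1 * 1 \<le> B * E" using B(1) E by (intro mult_mono) auto
        then have "B * E * 1 \<le> B * E * (B * E)" by (intro mult_left_mono) auto
        then show ?thesis using B(1) E by (intro real_le_lsqrt) (auto simp: power2_eq_square)
      qed
      finally show "sqrt (B * e * E) \<le> B * sqrt e * E" using e by (simp add: mult_ac mult_left_mono)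
    qed (use Q B e E in auto)
    also have "Q * (B * sqrt e) + Q * (B * sqrt e * E) \<le> A2 * sqrt e"
    proof -
      have "Q * (B * sqrt e) * 1 \<le> Q * (B * sqrt e) * E" using Q B e E by (intro mult_left_mono) auto
      then show ?thesis by (simp add: A2_def E_def mult_ac)
    qed
    also have "\<dots> \<le> (A1 + A2) * sqrt e" using A e by (intro mult_right_mono) auto
    finally show ?thesis by simp
  qed
  then show ?thesis by (simp add: A1_def A2_def)
qed

end

section \<open>A bound uniform over all quasi-geodesics\<close>

context spd
begin

text \<open>If the distance \<open>e\<close> of the endpoints is at most \<open>c0\<close> times the
  height \<open>h\<close> of the first, a segment joins them at cost O(e / h); the curve then lasts
  only O(e / h) and its height stays at most a multiple of \<open>h\<close>. Otherwise both
  endpoints have height O(e), and \<open>P_end_le_low\<close> applies.\<close>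

lemma length_bound:
  assumes kap: "\<kappa> \<ge> 1"
  obtains A where "0 < A"
    "\<forall>a b \<gamma>. a \<le> b \<longrightarrow> kobayashi_quasi_geodesic \<Omega> \<kappa> {a..b} \<gamma> \<longrightarrow>
      curve_length {a..b} \<gamma> \<le> ennreal (A * sqrt (norm (\<gamma> a - \<gamma> b)))"
proof -
  obtain C0 where C0: "0 < C0" and far:
    "\<forall>p q s. p \<in> \<Omega> \<longrightarrow> q \<in> \<Omega> \<longrightarrow> 0 < s \<longrightarrow> s \<le> s\<^sub>1 \<longrightarrow>
       kchain \<Omega> (push s p) (push s q) (C0 * (1 + ln (1 + norm (p - q) / s)))"
    by (rule kchain_push_far)
  have M: "1 \<le> M" by (rule csts(1))
  define C where "C = max 1 (\<kappa> * (2 * C\<^sub>v + C0 + 2 * C\<^sub>u * C\<^sub>p * \<Lambda>\<^sub>2 \<kappa>))"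
  have C: "1 \<le> C" by (simp add: C_def)
  \<comment> \<open>Up to this ratio of distance to height, \<open>wt_le_norm\<close> yields a
    displacement of weight at most \<open>a\<^sub>0\<close>.\<close>
  define c0 where "c0 = a\<^sub>0 / (3 * M)"
  have c0: "0 < c0" using a0(1) M by (simp add: c0_def)
  \<comment> \<open>In units of the distance, \<open>1 / c0\<close> bounds the height at
    \<open>a\<close> and \<open>M\<close> the change of height from \<open>a\<close> to
    \<open>b\<close>.\<close>
  define B where "B = 1 + 1 / c0 + M"
  have B: "1 \<le> B" using c0 M by (simp add: B_def)
  define Q where "Q = 8 * C * (8 * C + 1 + (4 * M / s\<^sub>1 + 2))"
  define A1 where "A1 = 2 * (8 * C * (8 * C + 3)) * B + 2 * B * Q * exp (\<Lambda>\<^sub>1 \<kappa> * Q)"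
  define R where "R = \<kappa> * C\<^sub>u * (3 * M)"
  have R: "0 < R" using kap Cu_pos M by (simp add: R_def)
  define A2 where "A2 = R * sqrt c0 * exp (\<Lambda>\<^sub>1 \<kappa> * (R * c0))"
  have Q: "0 \<le> Q" unfolding Q_def using C M s1(1) by (intro mult_nonneg_nonneg add_nonneg_nonneg) auto
  have A1: "0 \<le> A1" unfolding A1_def using C B Q by (intro add_nonneg_nonneg mult_nonneg_nonneg) auto
  have A2: "0 \<le> A2" unfolding A2_def using R c0 by (intro mult_nonneg_nonneg) auto
  define A where "A = 2 * \<Lambda>\<^sub>2 \<kappa> * (A1 + A2 + 1)"
  have A: "0 < A" using A1 A2 Lambda_pos(2)[OF kap] by (simp add: A_def)
  show thesis
  proof (rule that[OF A], intro allI impI)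
    fix a b :: real and \<gamma> assume ab: "a \<le> b" and qg: "kobayashi_quasi_geodesic \<Omega> \<kappa> {a..b} \<gamma>"
    interpret q: spd_quasi_geodesic \<Omega> \<rho> F1 F2 M r h\<^sub>0 g c \<kappa> a b \<gamma>
      by unfold_locales fact+
    define e where "e = norm (\<gamma> a - \<gamma> b)"
    have e: "0 \<le> e" by (simp add: e_def)
    have m: "a \<in> {a..b}" "b \<in> {a..b}" using ab by auto
    note x = q.in_dom[OF m(1)] and y = q.in_dom[OF m(2)]
    have ha: "0 < q.hh a" by (rule q.hh_pos[OF m(1)])
    have "q.P b \<le> (A1 + A2 + 1) * sqrt e"
    proof (cases "e \<le> c0 * q.hh a")
      case True
      have w: "wt (\<gamma> a) (\<gamma> b - \<gamma> a) \<le> 3 * M * e / q.hh a"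
        using wt_le_norm[OF x, of "\<gamma> b - \<gamma> a"] by (simp add: e_def norm_minus_commute q.hh_def)
      have "3 * M * e / q.hh a \<le> 3 * M * (c0 * q.hh a) / q.hh a"
        using True ha M by (intro divide_right_mono mult_left_mono) auto
      also have "\<dots> = a\<^sub>0" using ha M by (simp add: c0_def)
      finally have "wt (\<gamma> a) (\<gamma> b - \<gamma> a) \<le> a\<^sub>0" using w by simp
      from kobayashi_dist_le_kchain[OF kchain_wt[OF x this]]
      have "kobayashi_dist \<Omega> (\<gamma> a) (\<gamma> b) \<le> ennreal (C\<^sub>u * wt (\<gamma> a) (\<gamma> b - \<gamma> a))" .
      also have "\<dots> \<le> ennreal (C\<^sub>u * (3 * M * e / q.hh a))"
        using w Cu_pos by (intro ennreal_leI mult_left_mono) auto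
      finally have "kobayashi_dist \<Omega> (\<gamma> a) (\<gamma> b) \<le> ennreal (C\<^sub>u * (3 * M * e / q.hh a))" .
      moreover have "ennreal (1 / \<kappa> * \<bar>b - a\<bar>) \<le> kobayashi_dist \<Omega> (\<gamma> a) (\<gamma> b)"
        using qg m unfolding kobayashi_quasi_geodesic_def by blast
      ultimately have "ennreal (1 / \<kappa> * \<bar>b - a\<bar>) \<le> ennreal (C\<^sub>u * (3 * M * e / q.hh a))" by (rule order_trans[rotated])
      then have "1 / \<kappa> * \<bar>b - a\<bar> \<le> C\<^sub>u * (3 * M * e / q.hh a)"
        using Cu_pos M e ha by (subst (asm) ennreal_le_iff) auto
      then have "b - a \<le> \<kappa> * (C\<^sub>u * (3 * M * e / q.hh a))" using kap ab by (simp add: field_simps)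
      then have T: "b - a \<le> R * (e / q.hh a)" by (simp add: R_def mult_ac)
      have eh: "e / q.hh a \<le> c0" using True ha by (simp add: pos_divide_le_eq)
      have "R * (e / q.hh a) \<le> R * c0" using eh R by (intro mult_left_mono) auto
      with T have T': "b - a \<le> R * c0" by simp
      define E where "E = exp (\<Lambda>\<^sub>1 \<kappa> * (R * c0))"
      have E: "1 \<le> E" using Lambda_pos(1)[OF kap] R c0 by (simp add: E_def)
      have h: "q.hh t \<le> q.hh a * E" if "t \<in> {a..b}" for t
        unfolding E_def using that T' by (intro q.hh_exp_le[OF m(1) that]) auto
      have "q.P b - q.P a \<le> (b - a) * sqrt (q.hh a * E)"
        using h ab ha E by (intro q.P_diff_le) auto
      then have "q.P b \<le> (b - a) * sqrt (q.hh a * E)" by (simp add: q.P_def)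
      also have "\<dots> \<le> R * (e / q.hh a) * (sqrt (q.hh a) * E)"
      proof (rule mult_mono[OF T])
        have "sqrt E \<le> E" using E by (intro real_le_lsqrt) (auto simp: power2_eq_square)
        then show "sqrt (q.hh a * E) \<le> sqrt (q.hh a) * E" using ha by (simp add: real_sqrt_mult mult_left_mono)
      qed (use R e ha E in auto)
      \<comment> \<open>Rewritten so that the ratio of distance to height, which is at most
        \<open>c0\<close>, can be replaced by its bound and \<open>sqrt e\<close> remains.\<close>
      also have "\<dots> = R * E * (sqrt (e / q.hh a) * sqrt e)"
      proof -
        have eq: "e / q.hh a * sqrt (q.hh a) = sqrt (e / q.hh a) * sqrt e"
        proof -
          have "e / q.hh a * sqrt (q.hh a) = e / sqrt (q.hh a)"
            using ha real_sqrt_mult_self[of "q.hh a"] by (simp add: field_simps)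
          also have "\<dots> = sqrt (e / q.hh a) * sqrt e" using e by (simp add: real_sqrt_divide)
          finally show ?thesis .
        qed
        have "R * (e / q.hh a) * (sqrt (q.hh a) * E) = R * E * (e / q.hh a * sqrt (q.hh a))"
          by (simp only: mult_ac)
        then show ?thesis unfolding eq .
      qed
      also have "\<dots> \<le> R * E * (sqrt c0 * sqrt e)"
        using eh R E e by (intro mult_left_mono mult_right_mono) auto
      also have "\<dots> = A2 * sqrt e" by (simp add: A2_def E_def)
      also have "\<dots> \<le> (A1 + A2 + 1) * sqrt e" using A1 e by (intro mult_right_mono) auto
      finally show ?thesis .
    next
      case False
      have e0: "0 < e" using False c0 ha mult_pos_pos[of c0 "q.hh a"] by linarith
      have h1: "q.hh a \<le> 1 / c0 * e" using False c0 by (simp add: field_simps)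
      have hb: "q.hh b \<le> q.hh a + M * e"
        using ht_lip[OF x y] by (simp add: q.hh_def e_def)
      have Be: "B * e = e + 1 / c0 * e + M * e" by (simp add: B_def algebra_simps)
      have Me: "0 \<le> M * e" using M e by simp
      have time: "q.dur s \<le> C * (1 + ln (1 + e / s) + q.out s / sqrt s)"
        if s: "0 < s" "s \<le> s\<^sub>1" "q.U s \<noteq> {}" for s
      proof -
        note v = q.visits[OF s(3)]
        have "q.dur s \<le> \<kappa> * (2 * C\<^sub>v + C0 + 2 * C\<^sub>u * C\<^sub>p * \<Lambda>\<^sub>2 \<kappa>) * (1 + ln (1 + e / s) + q.out s / sqrt s)"
          unfolding q.dur_def q.out_def e_def
          using v(1,2,3) q.low_before[OF s(3)] q.low_after[OF s(3)]
          by (intro q.time_le[OF far C0 s(1,2)]) (auto simp: q.U_def)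
        also have "\<dots> \<le> C * (1 + ln (1 + e / s) + q.out s / sqrt s)"
          using q.out_nonneg[OF s(3)] e s(1) by (intro mult_right_mono) (auto simp: C_def)
        finally show ?thesis .
      qed
      have e2: "e \<le> 2 * M"
        using norm_triangle_ineq4[of "\<gamma> a" "\<gamma> b"] norm_le[OF x] norm_le[OF y] by (simp add: e_def)
      have "q.P b \<le> A1 * sqrt e"
        unfolding A1_def Q_def
        using h1 hb Be Me e0 by (intro q.P_end_le_low[OF C time e0 e2 B]) linarith+
      also have "\<dots> \<le> (A1 + A2 + 1) * sqrt e" using A2 e by (intro mult_right_mono) auto
      finally show ?thesis .
    qed
    then have "2 * \<Lambda>\<^sub>2 \<kappa> * q.P b \<le> 2 * \<Lambda>\<^sub>2 \<kappa> * ((A1 + A2 + 1) * sqrt e)"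
      using Lambda_pos(2)[OF kap] by (intro mult_left_mono) auto
    also have "\<dots> = A * sqrt e" by (simp add: A_def)
    finally have "ennreal (2 * \<Lambda>\<^sub>2 \<kappa> * q.P b) \<le> ennreal (A * sqrt e)" by (rule ennreal_leI)
    with q.curve_length_le show "curve_length {a..b} \<gamma> \<le> ennreal (A * sqrt (norm (\<gamma> a - \<gamma> b)))"
      unfolding e_def by (rule order_trans)
  qed
qed

end

theorem theorem1p6:
  fixes \<Omega> :: "(complex^'n::finite) set" and \<kappa> c\<^sub>2 :: real
  assumes "CARD('n) \<ge> 2"
    and "bounded \<Omega>" and "strongly_pseudoconvex_domain \<Omega>"
    and "\<kappa> \<ge> 1"
    and "0 < c\<^sub>2" and "c\<^sub>2 < 1 / 16"
  shows "\<exists>c\<^sub>1::real. c\<^sub>1 > 0 \<and>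
    (\<forall>x\<in>\<Omega>. \<forall>y\<in>\<Omega>. \<forall>(a::real) (b::real) (\<gamma> :: real \<Rightarrow> complex^'n).
       a \<le> b \<longrightarrow> kobayashi_quasi_geodesic \<Omega> \<kappa> {a..b} \<gamma> \<longrightarrow> \<gamma> a = x \<longrightarrow> \<gamma> b = y \<longrightarrow>
       curve_length {a..b} \<gamma> \<le> ennreal (c\<^sub>1 * norm (x - y) powr c\<^sub>2))"
proof -
  obtain \<rho> F1 F2 M r h\<^sub>0 g c where "spd \<Omega> \<rho> F1 F2 M r h\<^sub>0 g c"
    by (rule spd_exists[OF assms(2,3)])
  then interpret spd \<Omega> \<rho> F1 F2 M r h\<^sub>0 g c .
  obtain A where A: "0 < A" and len:
    "\<forall>a b \<gamma>. a \<le> b \<longrightarrow> kobayashi_quasi_geodesic \<Omega> \<kappa> {a..b} \<gamma> \<longrightarrow>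
      curve_length {a..b} \<gamma> \<le> ennreal (A * sqrt (norm (\<gamma> a - \<gamma> b)))"
    by (rule length_bound[OF assms(4)])
  \<comment> \<open>Distances in the domain are at most \<open>2 * M\<close>, so the larger exponent
    \<open>1 / 2\<close> can be lowered to \<open>c\<^sub>2\<close> at the price of this
    factor.\<close>
  define D where "D = (2 * M) powr (1 / 2 - c\<^sub>2)"
  have M: "1 \<le> M" by (rule csts(1))
  have D: "0 < D" using M by (simp add: D_def)
  have pw: "sqrt e \<le> D * e powr c\<^sub>2" if "0 \<le> e" "e \<le> 2 * M" for e
  proof -
    have "sqrt e = e powr (1 / 2 - c\<^sub>2 + c\<^sub>2)" using that(1) by (simp add: powr_half_sqrt)
    also have "\<dots> = e powr (1 / 2 - c\<^sub>2) * e powr c\<^sub>2" by (rule powr_add)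
    also have "\<dots> \<le> D * e powr c\<^sub>2"
      unfolding D_def using that assms(6) by (intro mult_right_mono powr_mono2) auto
    finally show ?thesis .
  qed
  show ?thesis
  proof (intro exI[of _ "A * D"] conjI ballI allI impI)
    show "0 < A * D" using A D by simp
    fix x y a b and \<gamma> :: "real \<Rightarrow> complex^'n"
    assume x: "x \<in> \<Omega>" and y: "y \<in> \<Omega>" and "a \<le> b" "kobayashi_quasi_geodesic \<Omega> \<kappa> {a..b} \<gamma>" "\<gamma> a = x" "\<gamma> b = y"
    then have "curve_length {a..b} \<gamma> \<le> ennreal (A * sqrt (norm (x - y)))" using len by blast
    also have "\<dots> \<le> ennreal (A * (D * norm (x - y) powr c\<^sub>2))"
    proof (intro ennreal_leI mult_left_mono pw)
      show "norm (x - y) \<le> 2 * M"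
        using norm_triangle_ineq4[of x y] norm_le[OF x] norm_le[OF y] by simp
    qed (use A in auto)
    finally show "curve_length {a..b} \<gamma> \<le> ennreal (A * D * norm (x - y) powr c\<^sub>2)" by (simp add: mult.assoc)
  qed
qed

end
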